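(* Let $\mathcal E\subset \mathbb{R}\mathrm{P}^8$ be the essential variety and let $\mathbb G=G(3,\mathbb{R}\mathrm{P}^8)$ be the Grassmannian of $3$-dimensional (projective) linear subspaces of $\mathbb{R}\mathrm{P}^8$. If $L\sim\mathrm{Unif}(\mathbb G)$, then $$\mathop{\mathbb E}_{L\sim \mathrm{Unif}(\mathbb G)} \#(\mathcal E\cap L)=4.$$
   Context: For $\mathbf t\in\mathbb R^3$ let $[\mathbf t]_\times\in\mathbb R^{3\times 3}$ be the matrix with $[\mathbf t]_\times\mathbf x=\mathbf t\times\mathbf x$ (cross product) for all $\mathbf x\in\mathbb R^3$. For $R\in\mathrm{SO}(3)$ and $\mathbf t\in\mathbb R^3$ put $E(R,\mathbf t)=[\mathbf t]_\times R$, and let $\widehat{\mathcal E}=\{E(R,\mathbf t)\mid R\in\mathrm{SO}(3),\ \mathbf t\in\mathbb R^3\}\subset\mathbb R^{3\times 3}$. The essential variety $\mathcal E\subset \mathrm P(\mathbb R^{3\times 3})\cong\mathbb{R}\mathrm{P}^8$ is the image of $\widehat{\mathcal E}\setminus\{0\}$ under projectivization; it has dimension $5$. The space $\mathbb R^{3\times 3}$ is identified with $\mathbb R^9$ via the matrix entries, so that the orthogonal group $\mathrm O(9)$ acts on $\mathbb{R}\mathrm{P}^8$ and on $\mathbb G$. The distribution $\mathrm{Unif}(\mathbb G)$ is the law of $L=U\cdot L_0$, where $L_0\in\mathbb G$ is fixed and $U$ is distributed according to the normalized Haar measure on $\mathrm O(9)$ (it does not depend on the choice of $L_0$). $\#$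 denotes the number of (real) points. *)

theory Defs
  imports "HOL-Analysis.Analysis" "HOL-Probability.Probability"
begin

(* A point of the projective space P(V) is a line through the origin of V; a projective
   linear subspace is the set of points it contains. *)

definition projectivization :: "'a::real_vector set \<Rightarrow> 'a set set" where
  "projectivization S = (\<lambda>x. span {x}) ` (S - {0})"

definition grassmannian :: "nat \<Rightarrow> 'a::euclidean_space set set set" where
  "grassmannian k = {projectivization W | W. subspace W \<and> dim W = k + 1}"

definition skew_matrix :: "real^3 \<Rightarrow> real^3^3" where
  "skew_matrix t = matrix (cross3 t)"

definition essential_matrices :: "(real^3^3) set" where
  "essential_matrices = {skew_matrix t ** R | R t. rotation_matrix R}"

definition essential_variety :: "(real^3^3) set set" where
  "essential_variety = projectivization essential_matrices"

definition orthogonal_group :: "(real^'n^'n) set" where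
  "orthogonal_group = {Q. orthogonal_matrix Q}"

(* The left-invariant Borel probability measure; it is unique, and also right-invariant, since the
   group is compact. *)

definition normalized_haar :: "(real^'n^'n) measure \<Rightarrow> bool" where
  "normalized_haar \<mu> \<longleftrightarrow>
     prob_space \<mu> \<and>
     sets \<mu> = sets (restrict_space borel orthogonal_group) \<and>
     (\<forall>Q\<in>orthogonal_group. distr \<mu> \<mu> (\<lambda>U. Q ** U) = \<mu>)"

(* The coordinates of R^9 are indexed by the matrix positions (i, j) rather than by 1, ..., 9,
   so that no ordering of the entries has to be chosen; O(9) is accordingly
   orthogonal_group :: (real^(3 \<times> 3)^(3 \<times> 3)) set. *)

definition vec_of_mat :: "real^'n^'m \<Rightarrow> real^('m \<times> 'n)" where
  "vec_of_mat A = (\<chi> p. A $ fst p $ snd p)"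

definition mat_of_vec :: "real^('m \<times> 'n) \<Rightarrow> real^'n^'m" where
  "mat_of_vec v = (\<chi> i j. v $ (i, j))"

definition act :: "real^('m \<times> 'n)^('m \<times> 'n) \<Rightarrow> real^'n^'m \<Rightarrow> real^'n^'m" where
  "act U A = mat_of_vec (U *v vec_of_mat A)"

definition act_subspace ::
  "real^('m \<times> 'n)^('m \<times> 'n) \<Rightarrow> (real^'n^'m) set set \<Rightarrow> (real^'n^'m) set set" where
  "act_subspace U L = (\<lambda>p. act U ` p) ` L"

(* The Borel sigma-algebra of the Grassmannian as a homogeneous space: a set of subspaces is open
   iff its preimage under the orbit maps U \<mapsto> U L0 is open in the orthogonal group. The orbit maps
   of different L0 differ by a right translation, so quantifying over L0 only avoids a choice. *)

definition grassmannian_borel :: "nat \<Rightarrow> (real^'n^'m) set set measure" where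
  "grassmannian_borel k = sigma (grassmannian k)
     {A. A \<subseteq> grassmannian k \<and>
         (\<forall>L0\<in>grassmannian k.
            openin (top_of_set orthogonal_group) {U \<in> orthogonal_group. act_subspace U L0 \<in> A})}"

(* The law of U L0. The existentials denote the normalized Haar measure, which exists and is
   unique, and a base point L0, on which the law does not depend. *)

definition unif_grassmannian :: "nat \<Rightarrow> (real^'n^'m) set set measure \<Rightarrow> bool" where
  "unif_grassmannian k \<nu> \<longleftrightarrow>
     (\<exists>\<mu>. normalized_haar \<mu> \<and>
       (\<exists>L0\<in>grassmannian k. \<nu> = distr \<mu> (grassmannian_borel k) (\<lambda>U. act_subspace U L0)))"

(* The number of elements, with value \<infinity> (and not 0, as for card) on infinite sets. *)

abbreviation num_points :: "'a set \<Rightarrow> ennreal" where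
  "num_points S \<equiv> emeasure (count_space UNIV) S"

end

theory Submission
  imports Defs "HOL-Real_Asymp.Real_Asymp"
begin

text \<open>
  The cone over \<open>\<E>\<close> is parametrised, up to a cone of smaller dimension and two-to-one, by
  \<open>y (t, a) = skew_matrix t ** cayley a\<close> with \<open>(t, a) \<in> \<real>\<^sup>3 \<times> \<real>\<^sup>3\<close>. Fix a three-dimensional subspace \<open>W\<close>.
  By invariance the expectation does not change if \<open>L\<close> is replaced by \<open>U\<^sup>T\<close> applied to the span of \<open>W\<close>
  and \<open>z\<close>, for any \<open>z \<notin> W\<close>. Almost surely \<open>L\<close> then contains no point of \<open>\<E>\<close> in the image of \<open>W\<close>, so that its points
  on \<open>\<E>\<close> correspond, each twice, to the solutions of \<open>U (y p) + w = z\<close> with \<open>w \<in> W\<close>. Averaging over \<open>z\<close>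
  in a set of measure one, the area formula for the map \<open>(p, w) \<mapsto> U (y p) + w\<close> between nine-dimensional
  spaces turns the expected number of solutions into an integral over \<open>p\<close>. The integrand is the Jacobian of \<open>y\<close>
  times a function of \<open>norm (y p)\<close> that is the same for every six-dimensional cone. For a
  linear six-dimensional subspace the expected number of solutions is one, which fixes the integral
  of that function. The rest is a ratio of volumes: the cone over \<open>\<E>\<close>, covered twice, has eight times the
  volume of the linear subspace.
\<close>

section \<open>Jacobians of linear maps\<close>

text \<open>The function of the norm is never computed. It is radial because a reflection of the
  model space \<open>range frame\<close> extends to a reflection of the whole matrix space, which
  the invariance of the Haar measure absorbs; only its total integral enters. The other constants
  are explicit. A matrix \<open>skew_matrix t ** R\<close> has norm \<open>sqrt 2 * norm t\<close>,
  and the Jacobian of the chart is the product of \<open>2 * norm t ^ 3\<close> and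
  \<open>8 / (1 + norm a ^ 2) ^ 2\<close>. The second factor is the density of the rotation group in
  Cayley coordinates, of total mass \<open>8 * pi ^ 2\<close>. The first, integrated over
  three-space against a function of \<open>sqrt 2 * norm t\<close>, gives \<open>1 / pi ^ 2\<close>
  times the integral of that function over six-space; besides scaling, only the areas
  \<open>4 * pi\<close> and \<open>pi ^ 3\<close> of the unit spheres enter. Two exceptional sets
  have to be avoided, for different reasons: matrices in the translate of W are points at infinity
  of an affine slice, and half turns have no Cayley coordinate.\<close>

definition from_coords :: "('n::finite \<Rightarrow> 'a::euclidean_space) \<Rightarrow> real^'n \<Rightarrow> 'a" where
  "from_coords \<beta> v = (\<Sum>i\<in>UNIV. v $ i *\<^sub>R \<beta> i)"

definition to_coords :: "('n::finite \<Rightarrow> 'a::euclidean_space) \<Rightarrow> 'a \<Rightarrow> real^'n" where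
  "to_coords \<beta> x = (\<chi> i. x \<bullet> \<beta> i)"

text \<open>For linear maps between spaces of equal dimension this is the absolute determinant in
  orthonormal bases. The form without bases suits maps between different types, such as
  \<open>((real^3) \<times> (real^3)) \<times> (real^3)\<close> and \<open>real^3^3\<close>.\<close>

definition jac :: "('a::euclidean_space \<Rightarrow> 'b::euclidean_space) \<Rightarrow> real" where
  "jac L = measure lborel (L ` cbox 0 One)"

lemma ex_basis_enumeration:
  assumes "DIM('a::euclidean_space) = CARD('n::finite)"
  obtains \<beta> :: "'n::finite \<Rightarrow> 'a::euclidean_space" where "bij_betw \<beta> UNIV Basis"
  using finite_same_card_bij[of "UNIV :: 'n set" "Basis :: 'a set"] assms by auto

context
  fixes \<beta> :: "'n::finite \<Rightarrow> 'a::euclidean_space"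
  assumes bij: "bij_betw \<beta> UNIV Basis"
begin

lemma enumeration_in_Basis: "\<beta> i \<in> Basis"
  using bij by (auto simp: bij_betw_def)

lemma enumeration_inner: "\<beta> i \<bullet> \<beta> j = (if i = j then 1 else 0)"
  using bij by (auto simp: inner_Basis enumeration_in_Basis bij_betw_def inj_eq)

lemma to_from_coords [simp]: "to_coords \<beta> (from_coords \<beta> v) = v"
  by (simp add: to_coords_def from_coords_def vec_eq_iff inner_sum_left enumeration_inner if_distrib
        cong: if_cong)

lemma from_to_coords [simp]: "from_coords \<beta> (to_coords \<beta> x) = x"
proof -
  have "(\<Sum>i\<in>UNIV. (x \<bullet> \<beta> i) *\<^sub>R \<beta> i) = (\<Sum>b\<in>Basis. (x \<bullet> b) *\<^sub>R b)"
    by (rule sum.reindex_bij_betw[OF bij])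
  then show ?thesis
    by (simp add: to_coords_def from_coords_def euclidean_representation)
qed

lemma linear_from_coords: "linear (from_coords \<beta>)"
  by (rule linearI) (simp_all add: from_coords_def scaleR_add_left sum.distrib scaleR_sum_right)

lemma linear_to_coords: "linear (to_coords \<beta>)"
  by (rule linearI) (simp_all add: to_coords_def vec_eq_iff inner_add_left)

lemma from_coords_axis [simp]: "from_coords \<beta> (axis i 1) = \<beta> i"
  by (simp add: from_coords_def axis_def if_distrib[of "\<lambda>c. c *\<^sub>R _"] cong: if_cong)

lemma vimage_to_coords: "to_coords \<beta> -` K = from_coords \<beta> ` K"
  by (auto simp: image_iff) (metis from_to_coords)

lemma continuous_from_coords: "continuous_on S (from_coords \<beta>)"
  by (simp add: linear_continuous_on linear_conv_bounded_linear[symmetric] linear_from_coords)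

lemma continuous_to_coords: "continuous_on S (to_coords \<beta>)"
  by (simp add: linear_continuous_on linear_conv_bounded_linear[symmetric] linear_to_coords)

lemma distr_lborel_from_coords: "distr lborel borel (from_coords \<beta>) = lborel"
proof (rule lborel_eqI[symmetric])
  fix l u :: 'a
  assume le: "\<And>b. b \<in> Basis \<Longrightarrow> l \<bullet> b \<le> u \<bullet> b"
  have [measurable]: "from_coords \<beta> \<in> borel_measurable borel"
    by (intro borel_measurable_continuous_onI continuous_from_coords)
  have *: "from_coords \<beta> v \<in> box l u \<longleftrightarrow> v \<in> box (to_coords \<beta> l) (to_coords \<beta> u)" for v
  proof -
    have "from_coords \<beta> v \<bullet> \<beta> i = v $ i" for i
      by (metis to_from_coords to_coords_def vec_lambda_beta)
    moreover have "(\<forall>b\<in>Basis. P b) \<longleftrightarrow> (\<forall>i. P (\<beta> i))" for P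
      using bij by (metis bij_betw_imp_surj_on rangeI rangeE)
    ultimately show ?thesis
      by (simp add: mem_box box_def to_coords_def Basis_vec_def inner_axis)
  qed
  have "from_coords \<beta> -` box l u = box (to_coords \<beta> l) (to_coords \<beta> u)"
    using * by auto
  then have "emeasure (distr lborel borel (from_coords \<beta>)) (box l u) =
      emeasure lborel (box (to_coords \<beta> l) (to_coords \<beta> u))"
    by (simp add: emeasure_distr)
  also have "\<dots> = (\<Prod>b\<in>Basis. (to_coords \<beta> u - to_coords \<beta> l) \<bullet> b)"
    using le by (intro emeasure_lborel_box)
      (auto simp: to_coords_def Basis_vec_def inner_axis enumeration_in_Basis)
  also have "\<dots> = (\<Prod>i\<in>UNIV. (u - l) \<bullet> \<beta> i)"
  proof -
    have "bij_betw (\<lambda>i. axis i (1::real) :: real^'n) UNIV Basis"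
      by (auto simp: bij_betw_def inj_on_def axis_eq_axis Basis_vec_def)
    then show ?thesis
      by (subst prod.reindex_bij_betw[symmetric])
        (auto simp: to_coords_def inner_axis inner_diff_left)
  qed
  also have "\<dots> = (\<Prod>b\<in>Basis. (u - l) \<bullet> b)"
    by (subst prod.reindex_bij_betw[OF bij, symmetric]) simp
  finally show "emeasure (distr lborel borel (from_coords \<beta>)) (box l u) = (\<Prod>b\<in>Basis. (u - l) \<bullet> b)" .
qed simp

lemma distr_lborel_to_coords: "distr lborel borel (to_coords \<beta>) = lborel"
proof -
  have [measurable]: "from_coords \<beta> \<in> borel_measurable borel" "to_coords \<beta> \<in> borel_measurable borel"
    by (intro borel_measurable_continuous_onI continuous_from_coords continuous_to_coords)+
  have "distr (lborel :: 'a measure) borel (to_coords \<beta>) =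
      distr (distr lborel borel (from_coords \<beta>)) borel (to_coords \<beta>)"
    by (simp add: distr_lborel_from_coords)
  also have "\<dots> = distr lborel borel (\<lambda>x. x)"
    by (subst distr_distr) (simp_all add: o_def)
  also have "\<dots> = lborel"
    by (simp add: distr_id2)
  finally show ?thesis .
qed

lemma emeasure_from_coords_image:
  assumes [measurable]: "K \<in> sets borel"
  shows "emeasure lborel (from_coords \<beta> ` K) = emeasure lborel K"
proof -
  have [measurable]: "to_coords \<beta> \<in> borel_measurable borel"
    by (intro borel_measurable_continuous_onI continuous_to_coords)
  have "emeasure lborel K = emeasure (distr lborel borel (to_coords \<beta>)) K"
    by (simp add: distr_lborel_to_coords)
  also have "\<dots> = emeasure lborel (to_coords \<beta> -` K)"
    by (simp add: emeasure_distr)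
  finally show ?thesis by (simp add: vimage_to_coords)
qed

end

text \<open>In this entrywise form the matrix depends continuously on L as soon as the values of L
  at fixed vectors do, which is how the continuity of Jacobians is obtained.\<close>

lemma det_matrix_coords:
  fixes \<alpha> :: "'n::finite \<Rightarrow> 'a::euclidean_space" and \<beta> :: "'n \<Rightarrow> 'b::euclidean_space"
  assumes "bij_betw \<alpha> UNIV Basis" "bij_betw \<beta> UNIV Basis"
  shows "matrix (to_coords \<beta> \<circ> L \<circ> from_coords \<alpha>) = (\<chi> i j. L (\<alpha> j) \<bullet> \<beta> i)"
  by (simp add: matrix_def to_coords_def vec_eq_iff assms)

lemma compact_linear_image:
  fixes f :: "'a::euclidean_space \<Rightarrow> 'b::euclidean_space"
  assumes "linear f" "compact K"
  shows "compact (f ` K)"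
  by (intro compact_continuous_image assms linear_continuous_on)
    (simp add: linear_conv_bounded_linear[symmetric] assms)

text \<open>Compactness of K makes all images Borel, so that \<open>lborel\<close> and
  \<open>lebesgue\<close> agree on them and the determinant formula on \<open>real^'n\<close> can be
  transported by coordinates.\<close>

lemma measure_linear_image_compact:
  fixes \<alpha> :: "'n::{finite,wellorder} \<Rightarrow> 'a::euclidean_space" and \<beta> :: "'n \<Rightarrow> 'b::euclidean_space"
  assumes \<alpha>: "bij_betw \<alpha> UNIV Basis" and \<beta>: "bij_betw \<beta> UNIV Basis"
    and L: "linear L" and K: "compact K"
  shows "measure lborel (L ` K) = \<bar>det (matrix (to_coords \<beta> \<circ> L \<circ> from_coords \<alpha>))\<bar> * measure lborel K"
proof -
  let ?M = "to_coords \<beta> \<circ> L \<circ> from_coords \<alpha>"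
  let ?K = "to_coords \<alpha> ` K"
  have lin: "linear ?M"
    by (intro linear_compose linear_from_coords linear_to_coords assms)
  have K': "compact ?K"
    using K by (intro compact_continuous_image continuous_to_coords \<alpha>)
  have MK: "compact (?M ` ?K)"
    by (rule compact_linear_image[OF lin K'])
  have "L ` K = from_coords \<beta> ` (?M ` ?K)"
    by (auto simp: image_image \<alpha> \<beta>)
  then have "measure lborel (L ` K) = measure lborel (?M ` ?K)"
    using emeasure_from_coords_image[OF \<beta>, of "?M ` ?K"] MK by (simp add: measure_def borel_compact)
  also have "\<dots> = measure lebesgue (?M ` ?K)"
    using MK by (simp add: borel_compact)
  also have "\<dots> = \<bar>det (matrix ?M)\<bar> * measure lebesgue ?K"
    by (rule measure_linear_image[OF lin]) (use K' lmeasurable_compact in blast)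
  also have "measure lebesgue ?K = measure lborel ?K"
    using K' by (simp add: borel_compact)
  also have "\<dots> = measure lborel K"
    using emeasure_from_coords_image[OF \<alpha>, of ?K] K' by (simp add: measure_def image_image \<alpha> borel_compact)
  finally show ?thesis .
qed

lemma jac_eq_det:
  fixes \<alpha> :: "'n::{finite,wellorder} \<Rightarrow> 'a::euclidean_space" and \<beta> :: "'n \<Rightarrow> 'b::euclidean_space"
  assumes "bij_betw \<alpha> UNIV Basis" "bij_betw \<beta> UNIV Basis" "linear L"
  shows "jac L = \<bar>det (matrix (to_coords \<beta> \<circ> L \<circ> from_coords \<alpha>))\<bar>"
  using measure_linear_image_compact[OF assms, of "cbox 0 One"]
  by (simp add: jac_def content_cbox_if)

lemma jac_det:
  fixes L :: "real^'n::{finite,wellorder} \<Rightarrow> real^'n::_"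
  assumes "linear L"
  shows "jac L = \<bar>det (matrix L)\<bar>"
  using measure_linear_image[OF assms, of "cbox 0 One"] compact_linear_image[OF assms, of "cbox 0 One"]
  by (simp add: jac_def borel_compact content_cbox_if)

lemma measure_linear_image_jac:
  fixes L :: "'a::euclidean_space \<Rightarrow> 'b::euclidean_space"
  assumes "DIM('a) = CARD('n::{finite,wellorder})" "DIM('b) = CARD('n)" "linear L" "compact K"
  shows "measure lborel (L ` K) = jac L * measure lborel K"
proof -
  obtain \<alpha> :: "'n \<Rightarrow> 'a" where "bij_betw \<alpha> UNIV Basis"
    using ex_basis_enumeration[OF assms(1)] .
  moreover obtain \<beta> :: "'n \<Rightarrow> 'b" where "bij_betw \<beta> UNIV Basis"
    using ex_basis_enumeration[OF assms(2)] .
  ultimately show ?thesis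
    by (simp add: measure_linear_image_compact jac_eq_det assms)
qed

lemma jac_compose:
  fixes L :: "'b::euclidean_space \<Rightarrow> 'c::euclidean_space" and S :: "'a::euclidean_space \<Rightarrow> 'b"
  assumes "DIM('a) = CARD('n::{finite,wellorder})" "DIM('b) = CARD('n)" "DIM('c) = CARD('n)"
    and "linear L" "linear S"
  shows "jac (L \<circ> S) = jac L * jac S"
proof -
  have "compact (S ` cbox 0 One)"
    by (intro compact_linear_image assms compact_cbox)
  then show ?thesis
    using measure_linear_image_jac[OF assms(2,3,4), of "S ` cbox 0 One"]
    by (simp add: jac_def image_comp)
qed

text \<open>The unit ball is mapped onto itself and has positive finite volume, so the factor by
  which volumes change is 1.\<close>

lemma jac_orthogonal:
  fixes L :: "'a::euclidean_space \<Rightarrow> 'a"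
  assumes "DIM('a) = CARD('n::{finite,wellorder})" "orthogonal_transformation L"
  shows "jac L = 1"
proof -
  have "L ` cball 0 1 = cball 0 1"
    using image_orthogonal_transformation_cball[OF assms(2), of 0 1]
    by (simp add: linear_0 assms orthogonal_transformation_linear)
  then show ?thesis
    using measure_linear_image_jac[OF assms(1,1) orthogonal_transformation_linear[OF assms(2)], of "cball 0 1"]
    using content_cball_gt_0_iff[of "0::'a" 1] by simp
qed

lemma cbox_prod_One: "cbox 0 (One :: 'a::euclidean_space \<times> 'b::euclidean_space) = cbox 0 One \<times> cbox 0 One"
proof -
  have "(One :: 'a \<times> 'b) = (One, One)"
    by (simp add: prod_eq_iff sum_Basis_prod_eq fst_sum snd_sum o_def)
  then show ?thesis
    by (simp add: zero_prod_def cbox_Pair_eq)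
qed

lemma jac_map_prod:
  fixes f :: "'a::euclidean_space \<Rightarrow> 'b::euclidean_space"
    and g :: "'c::euclidean_space \<Rightarrow> 'd::euclidean_space"
  assumes "linear f" "linear g"
  shows "jac (map_prod f g) = jac f * jac g"
proof -
  have f: "f ` cbox 0 One \<in> sets lborel" and g: "g ` cbox 0 One \<in> sets lborel"
    using assms by (simp_all add: borel_compact compact_linear_image)
  have "measure lborel (map_prod f g ` cbox 0 One) =
      measure (lborel \<Otimes>\<^sub>M lborel) (f ` cbox 0 One \<times> g ` cbox 0 One)"
    by (simp add: cbox_prod_One lborel_prod map_prod_surj_on)
  then show ?thesis
    using lborel.emeasure_pair_measure_Times[OF f g]
    by (simp add: jac_def measure_def enn2real_mult)
qed

text \<open>By Fubini: the slice of the sheared unit cube over a fixed x is a translate of the unit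
  cube.\<close>

lemma jac_shear:
  fixes h :: "'a::euclidean_space \<Rightarrow> 'b::euclidean_space"
  assumes h: "linear h"
  shows "jac (\<lambda>(x, y). (x, y + h x)) = 1"
proof -
  let ?f = "\<lambda>(x, y). (x, y + h x)"
  let ?S = "?f ` cbox 0 One :: ('a \<times> 'b) set"
  have "linear ?f"
    by (rule linearI) (auto simp: linear_add[OF h] linear_scale[OF h] scaleR_add_right)
  then have S: "?S \<in> sets (lborel \<Otimes>\<^sub>M lborel)"
    by (subst lborel_prod) (simp add: borel_compact compact_linear_image)
  have "emeasure lborel ?S = (\<integral>\<^sup>+x. emeasure lborel (Pair x -` ?S) \<partial>(lborel :: 'a measure))"
    using S by (subst lborel_prod[symmetric]) (rule lborel.emeasure_pair_measure_alt)
  also have "\<dots> = (\<integral>\<^sup>+x. indicator (cbox 0 One) x \<partial>(lborel :: 'a measure))"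
  proof (rule nn_integral_cong)
    fix x :: 'a
    have "Pair x -` ?S = (if x \<in> cbox 0 One then (+) (h x) ` cbox 0 One else {})"
      by (force simp: cbox_prod_One image_iff add.commute)
    moreover have "emeasure lborel ((+) (h x) ` cbox 0 One) = 1"
      by (simp add: emeasure_lborel_cbox_eq inner_left_distrib flip: cbox_translation)
    ultimately show "emeasure lborel (Pair x -` ?S) = indicator (cbox 0 One) x"
      by simp
  qed
  also have "\<dots> = 1"
    by (simp add: emeasure_lborel_cbox_eq)
  finally show ?thesis
    by (simp add: jac_def measure_def)
qed

section \<open>Counting measurably and the area formula\<close>

lemma finite_uniformly_separated:
  fixes P :: "'a::metric_space set"
  assumes "finite P"
  obtains d where "d > 0" "\<And>p q. p \<in> P \<Longrightarrow> q \<in> P \<Longrightarrow> p \<noteq> q \<Longrightarrow> d \<le> dist p q"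
proof -
  have "\<forall>p. \<exists>d>0. \<forall>q\<in>P. q \<noteq> p \<longrightarrow> d \<le> dist p q"
    using finite_set_avoid[OF assms] by blast
  then obtain d where d: "\<And>p. d p > 0" "\<And>p q. q \<in> P \<Longrightarrow> q \<noteq> p \<Longrightarrow> d p \<le> dist p q"
    by metis
  show ?thesis
  proof (rule that[of "Min (insert 1 (d ` P))"])
    show "Min (insert 1 (d ` P)) > 0"
      using assms d by (subst Min_gr_iff) auto
    show "Min (insert 1 (d ` P)) \<le> dist p q" if "p \<in> P" "q \<in> P" "p \<noteq> q" for p q
    proof -
      have "Min (insert 1 (d ` P)) \<le> d p"
        using assms that by (intro Min_le) auto
      then show ?thesis using d(2)[of q p] that by simp
    qed
  qed
qed

lemma of_nat_le_num_points_iff: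
  "of_nat n \<le> num_points S \<longleftrightarrow> (\<exists>P\<subseteq>S. finite P \<and> card P = n)"
proof (cases "finite S")
  case True
  then show ?thesis
    using obtain_subset_with_card_n[of n S]
    by (auto simp: card_mono)
next
  case False
  then show ?thesis
    using infinite_arbitrarily_large[of S n] by auto
qed

text \<open>Distinct points can be enclosed in disjoint small balls with centres in D and radii
  \<open>1 / Suc m\<close>; conversely, points chosen from disjoint balls are distinct. For
  countable D only countably many finite families of balls occur, so the condition is a countable
  union.\<close>

lemma of_nat_le_num_points_iff_balls:
  fixes S D :: "'k::metric_space set"
  assumes dense: "\<And>x e. e > 0 \<Longrightarrow> \<exists>q\<in>D. dist q x < e"
  shows "of_nat n \<le> num_points S \<longleftrightarrow>
    (\<exists>F\<in>{F. finite F \<and> F \<subseteq> (\<lambda>(q, m::nat). cball q (1 / Suc m)) ` (D \<times> UNIV)}.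
      card F = n \<and> disjoint F \<and> (\<forall>K\<in>F. S \<inter> K \<noteq> {}))"
  (is "_ \<longleftrightarrow> (\<exists>F\<in>{F. finite F \<and> F \<subseteq> ?\<K>}. _ F)")
proof
  assume "of_nat n \<le> num_points S"
  then obtain P where P: "P \<subseteq> S" "finite P" "card P = n"
    unfolding of_nat_le_num_points_iff by auto
  obtain d where d: "d > 0" "\<And>p q. p \<in> P \<Longrightarrow> q \<in> P \<Longrightarrow> p \<noteq> q \<Longrightarrow> d \<le> dist p q"
    using finite_uniformly_separated[OF P(2)] by blast
  \<comment> \<open>If two of the balls met, their points would be less than four radii apart, so a
    radius below \<open>d / 4\<close> makes them disjoint.\<close>
  obtain m :: nat where m: "1 / Suc m < d / 4"
    using d(1) reals_Archimedean[of "d / 4"] by (auto simp: inverse_eq_divide)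
  have pos: "0 < 1 / real (Suc m)" by simp
  have "\<exists>q. q \<in> D \<and> dist q p < 1 / Suc m" for p
    using dense[OF pos, of p] by (simp only: Bex_def)
  then have "\<forall>p. \<exists>q. q \<in> D \<and> dist q p < 1 / Suc m" ..
  then obtain q where "\<forall>p. q p \<in> D \<and> dist (q p) p < 1 / Suc m"
    by (rule choice[THEN exE])
  then have q: "q p \<in> D" "dist (q p) p < 1 / Suc m" for p
    by simp_all
  let ?B = "\<lambda>p. cball (q p) (1 / Suc m)"
  have mem: "p \<in> ?B p" for p
    using q(2)[of p] by simp
  have disj: "?B p \<inter> ?B p' = {}" if pp: "p \<in> P" "p' \<in> P" "p \<noteq> p'" for p p'
  proof (rule ccontr)
    assume "?B p \<inter> ?B p' \<noteq> {}"
    then obtain x where "dist (q p) x \<le> 1 / Suc m" "dist (q p') x \<le> 1 / Suc m"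
      by auto
    moreover have "dist p p' \<le> dist p (q p) + dist (q p) p'" "dist (q p) p' \<le> dist (q p) x + dist x p'"
        "dist x p' \<le> dist x (q p') + dist (q p') p'"
      by (rule dist_triangle)+
    ultimately have "dist p p' < d"
      using q(2)[of p] q(2)[of p'] m by (simp add: dist_commute)
    with d(2)[OF pp] show False by simp
  qed
  have inj: "inj_on ?B P"
  proof (rule inj_onI, rule ccontr)
    fix p p' assume "p \<in> P" "p' \<in> P" "?B p = ?B p'" "p \<noteq> p'"
    with disj[of p p'] mem[of p] show False by blast
  qed
  show "\<exists>F\<in>{F. finite F \<and> F \<subseteq> ?\<K>}. card F = n \<and> disjoint F \<and> (\<forall>K\<in>F. S \<inter> K \<noteq> {})"
  proof (intro bexI[of _ "?B ` P"] conjI ballI)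
    show "card (?B ` P) = n" using card_image[OF inj] P by simp
    show "disjoint (?B ` P)" unfolding disjnt_def by (rule pairwise_imageI) (rule disj)
    show "S \<inter> K \<noteq> {}" if "K \<in> ?B ` P" for K
    proof -
      from that obtain p where "p \<in> P" "K = ?B p" by (rule imageE)
      then show ?thesis using mem[of p] P(1) by blast
    qed
    show "?B ` P \<in> {F. finite F \<and> F \<subseteq> ?\<K>}"
    proof -
      have "?B p \<in> ?\<K>" for p
        by (rule image_eqI[of _ _ "(q p, m)"]) (simp_all add: q)
      then have "?B ` P \<subseteq> ?\<K>" by (rule image_subsetI)
      with P(2) show ?thesis by (simp only: mem_Collect_eq finite_imageI)
    qed
  qed
next
  assume "\<exists>F\<in>{F. finite F \<and> F \<subseteq> ?\<K>}. card F = n \<and> disjoint F \<and> (\<forall>K\<in>F. S \<inter> K \<noteq> {})"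
  then obtain F where "F \<in> {F. finite F \<and> F \<subseteq> ?\<K>}"
      "card F = n \<and> disjoint F \<and> (\<forall>K\<in>F. S \<inter> K \<noteq> {})"
    by (rule bexE)
  then have F: "finite F" "card F = n" "disjoint F" "\<And>K. K \<in> F \<Longrightarrow> S \<inter> K \<noteq> {}"
    by simp_all
  have "\<forall>K\<in>F. \<exists>x. x \<in> S \<inter> K"
    using F(4) by blast
  then obtain p where p: "\<forall>K\<in>F. p K \<in> S \<inter> K"
    by (rule bchoice[THEN exE])
  have "inj_on p F"
  proof (rule inj_onI, rule ccontr)
    fix K K' assume K: "K \<in> F" "K' \<in> F" "p K = p K'" "K \<noteq> K'"
    then have "K \<inter> K' = {}"
      using F(3) by (simp add: pairwise_def disjnt_def)
    moreover have "p K \<in> K \<inter> K'"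
      using p[rule_format, OF K(1)] p[rule_format, OF K(2)] K(3) by simp
    ultimately show False by simp
  qed
  then show "of_nat n \<le> num_points S"
    unfolding of_nat_le_num_points_iff using F p
    by (intro exI[of _ "p ` F"]) (auto simp: card_image)
qed

text \<open>Having at least n points means meeting each member of a disjoint n-element family of
  balls from a countable supply, so hitting events for compact sets suffice. The count itself is the
  supremum of n times the indicator of this event, also when it is infinite.\<close>

lemma borel_measurable_num_points:
  fixes C :: "'x \<Rightarrow> 'k::euclidean_space set"
  assumes meets: "\<And>K. compact K \<Longrightarrow> {x \<in> space M. C x \<inter> K \<noteq> {}} \<in> sets M"
  shows "(\<lambda>x. num_points (C x)) \<in> borel_measurable M"
proof -
  obtain D :: "'k set" where D: "countable D" "\<And>X. open X \<Longrightarrow> X \<noteq> {} \<Longrightarrow> \<exists>d\<in>D. d \<in> X"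
    using countable_dense_exists by blast
  have dense: "\<exists>q\<in>D. dist q x < e" if "e > 0" for x :: 'k and e
    using D(2)[of "ball x e"] that by (auto simp: dist_commute)
  let ?\<K> = "(\<lambda>(q, m::nat). cball q (1 / Suc m)) ` (D \<times> (UNIV :: nat set))"
  let ?A = "\<lambda>n. {x \<in> space M. of_nat n \<le> num_points (C x)}"
  have A: "?A n \<in> sets M" for n
  proof -
    have "{x \<in> space M. \<exists>F\<in>{F. finite F \<and> F \<subseteq> ?\<K>}. card F = n \<and> disjoint F \<and> (\<forall>K\<in>F. C x \<inter> K \<noteq> {})} \<in> sets M"
    proof (rule sets.sets_Collect_countable_Ex'[where I="{F. finite F \<and> F \<subseteq> ?\<K>}"])
      show "countable {F. finite F \<and> F \<subseteq> ?\<K>}"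
        using D(1) by (intro countable_Collect_finite_subset countable_image) auto
      fix F assume "F \<in> {F. finite F \<and> F \<subseteq> ?\<K>}"
      then have F: "finite F" "\<And>K. K \<in> F \<Longrightarrow> compact K" by (auto simp: compact_cball)
      then have "{x \<in> space M. \<forall>K\<in>F. C x \<inter> K \<noteq> {}} \<in> sets M"
        by (intro sets.sets_Collect_finite_All meets)
      then show "{x \<in> space M. card F = n \<and> disjoint F \<and> (\<forall>K\<in>F. C x \<inter> K \<noteq> {})} \<in> sets M"
        by (intro sets.sets_Collect_conj) auto
    qed
    then show ?thesis
      by (simp only: of_nat_le_num_points_iff_balls[OF dense])
  qed
  have eq: "num_points (C x) = (SUP n. of_nat n * indicator (?A n) x)" if "x \<in> space M" for x
  proof (rule antisym)
    show "(SUP n. of_nat n * indicator (?A n) x) \<le> num_points (C x)"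
      by (rule SUP_least) (auto split: split_indicator)
    show "num_points (C x) \<le> (SUP n. of_nat n * indicator (?A n) x)"
    proof (cases "finite (C x)")
      case True
      then show ?thesis
        using that by (intro SUP_upper2[of "card (C x)"]) auto
    next
      case False
      then have "x \<in> ?A n" for n using that by simp
      then have "of_nat n \<le> (SUP n. of_nat n * indicator (?A n) x :: ennreal)" for n
        by (intro SUP_upper2[of n]) auto
      then have "(SUP n. of_nat n * indicator (?A n) x :: ennreal) = top"
        using SUP_least[of UNIV "\<lambda>n. of_nat n :: ennreal"] unfolding ennreal_SUP_of_nat_eq_top top_unique
        by blast
      then show ?thesis by (simp only: top_greatest)
    qed
  qed
  have "(\<lambda>x. SUP n. of_nat n * indicator (?A n) x :: ennreal) \<in> borel_measurable M"
    by (intro borel_measurable_SUP borel_measurable_times_ennreal borel_measurable_const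
        borel_measurable_indicator A) auto
  then show ?thesis
    by (subst measurable_cong[OF eq])
qed

text \<open>An open set is a countable union of closed boxes, so its image is a countable union of
  compact sets.\<close>

lemma borel_continuous_image_open:
  fixes f :: "'a::euclidean_space \<Rightarrow> 'b::t2_space"
  assumes f: "continuous_on UNIV f" and S: "open S"
  shows "f ` S \<in> sets borel"
proof -
  obtain \<D> where \<D>: "countable \<D>" "\<And>X. X \<in> \<D> \<Longrightarrow> \<exists>a b. X = cbox a b" "\<Union>\<D> = S"
    using open_countable_Union_open_cbox[OF S] by metis
  have "f ` X \<in> sets borel" if "X \<in> \<D>" for X
    using \<D>(2)[OF that] f
    by (metis borel_compact compact_cbox compact_continuous_image continuous_on_subset subset_UNIV)
  moreover have "f ` S = (\<Union>X\<in>\<D>. f ` X)"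
    using \<D>(3) by blast
  ultimately show ?thesis
    using \<D>(1) by auto
qed

lemma num_points_disjoint_UN:
  assumes disj: "disjoint_family A"
  shows "num_points (\<Union>n::nat. A n) = (\<Sum>n. num_points (A n))"
  by (rule suminf_emeasure[symmetric]) (auto simp: disj)

text \<open>Boundedness of S places the image inside a compact set; its measure is therefore finite
  and the real-valued change of variables applies.\<close>

lemma emeasure_injective_image:
  fixes f :: "real^'n::{finite,wellorder} \<Rightarrow> real^'n::_"
  assumes der: "\<And>x. (f has_derivative f' x) (at x)" and S: "S \<in> sets borel" "bounded S"
    and inj: "inj_on f S" and fS: "f ` S \<in> sets borel"
  shows "emeasure lborel (f ` S) = (\<integral>\<^sup>+x. ennreal \<bar>det (matrix (f' x))\<bar> * indicator S x \<partial>lborel)"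
proof -
  have "continuous_on UNIV f"
    using der by (auto simp: continuous_on_eq_continuous_within intro: has_derivative_continuous)
  then have "compact (f ` closure S)"
    using S compact_closure[of S] by (metis compact_continuous_image continuous_on_subset subset_UNIV)
  then have "bounded (f ` S)"
    by (meson bounded_subset closure_subset compact_imp_bounded image_mono)
  then have m: "f ` S \<in> lmeasurable"
    using fS by (intro bounded_set_imp_lmeasurable) auto
  have der': "(f has_derivative f' x) (at x within S)" for x
    using der has_derivative_at_withinI by blast
  have "((\<lambda>x. \<bar>det (matrix (f' x))\<bar>) has_integral measure lebesgue (f ` S)) S"
    using has_measure_differentiable_image[OF _ der' inj, of "measure lebesgue (f ` S)"] m S by auto
  then have "(\<integral>\<^sup>+x. ennreal \<bar>det (matrix (f' x))\<bar> * indicator S x \<partial>lborel) = ennreal (measure lebesgue (f ` S))"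
    by (intro nn_integral_has_integral_lebesgue') auto
  also have "\<dots> = emeasure lebesgue (f ` S)"
    using m by (simp add: emeasure_eq_measure2 fmeasurableD2)
  also have "\<dots> = emeasure lborel (f ` S)"
    using fS by (simp add: emeasure_completion)
  finally show ?thesis by simp
qed

text \<open>Near a noncritical point f is injective, so the open set \<Omega> of noncritical points
  splits into countably many disjoint Borel pieces on which f is injective. The number of preimages
  is the sum of the indicators of the images of these pieces, except at critical values, which form
  a null set by Sard; critical points contribute nothing to the right side.\<close>

theorem area_formula_cart:
  fixes f :: "real^'n::{finite,wellorder} \<Rightarrow> real^'n::_"
  assumes der: "\<And>x. (f has_derivative f' x) (at x)"
    and cont: "continuous_on UNIV (\<lambda>x. matrix (f' x))"
    and B: "B \<in> sets borel"
  shows "(\<integral>\<^sup>+z. indicator B z * num_points {x. f x = z} \<partial>lborel) =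
    (\<integral>\<^sup>+x. indicator B (f x) * ennreal \<bar>det (matrix (f' x))\<bar> \<partial>lborel)"
proof -
  let ?d = "\<lambda>x. det (matrix (f' x))"
  define \<Omega> where "\<Omega> = {x. ?d x \<noteq> 0}"
  have cf: "continuous_on UNIV f"
    using der by (auto simp: continuous_on_eq_continuous_within intro: has_derivative_continuous)
  have lin: "linear (f' x)" for x
    using der has_derivative_linear by blast
  have cd: "continuous_on UNIV ?d"
    unfolding det_def by (intro continuous_intros cont)
  have [measurable]: "f \<in> borel_measurable borel" "?d \<in> borel_measurable borel"
    using cf cd by (auto intro: borel_measurable_continuous_onI)
  note [measurable] = B
  have open\<Omega>: "open \<Omega>"
    unfolding \<Omega>_def using open_Collect_neq[OF cd continuous_on_const] by simp
  have loc: "\<exists>r>0. inj_on f (ball x r) \<and> ball x r \<subseteq> \<Omega>" if x: "x \<in> \<Omega>" for x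
  proof -
    have "inj (f' x)"
      using x det_nz_iff_inj[OF lin] by (simp add: \<Omega>_def)
    then obtain g where g: "linear g" "g \<circ> f' x = id"
      using linear_injective_left_inverse[OF lin] by blast
    \<comment> \<open>Local injectivity needs the derivative to be continuous in operator norm. A
      bound of \<open>e / (2 * ?n * ?n)\<close> on each of the \<open>?n * ?n\<close> entries gives
      at most \<open>e / 2\<close>.\<close>
    have "\<exists>d>0. \<forall>y. dist x y < d \<longrightarrow> onorm (\<lambda>v. f' y v - f' x v) < e" if e: "e > 0" for e
    proof -
      let ?n = "real CARD('n)"
      have "e / (2 * ?n * ?n) > 0" using e by simp
      then obtain d where d: "d > 0" "\<And>y. dist y x < d \<Longrightarrow> dist (matrix (f' y)) (matrix (f' x)) < e / (2 * ?n * ?n)"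
        using cont[unfolded continuous_on_iff, rule_format, of x "e / (2 * ?n * ?n)"] by auto
      have "onorm (\<lambda>v. f' y v - f' x v) < e" if y: "dist x y < d" for y
      proof -
        have "(\<lambda>v. f' y v - f' x v) = (*v) (matrix (f' y) - matrix (f' x))"
          by (simp add: fun_eq_iff matrix_vector_mult_diff_rdistrib matrix_works[OF linear_imp_scaleR] lin
              linear_matrix_vector_mul_eq matrix_vector_mul(1))
        moreover have "\<bar>(matrix (f' y) - matrix (f' x)) $ i $ j\<bar> \<le> e / (2 * ?n * ?n)" for i j
        proof -
          have "\<bar>(matrix (f' y) - matrix (f' x)) $ i $ j\<bar> \<le> norm ((matrix (f' y) - matrix (f' x)) $ i)"
            by (rule component_le_norm_cart)
          also have "\<dots> \<le> norm (matrix (f' y) - matrix (f' x))"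
            by (rule Finite_Cartesian_Product.norm_nth_le)
          also have "\<dots> \<le> e / (2 * ?n * ?n)"
            using d(2)[of y] y by (simp add: dist_norm norm_minus_commute)
          finally show ?thesis .
        qed
        ultimately have "onorm (\<lambda>v. f' y v - f' x v) \<le> ?n * ?n * (e / (2 * ?n * ?n))"
          using onorm_le_matrix_component[of "matrix (f' y) - matrix (f' x)"] by metis
        also have "\<dots> < e" using e by simp
        finally show ?thesis .
      qed
      with d(1) show ?thesis by blast
    qed
    moreover have "bounded_linear g"
      using g by (simp add: linear_conv_bounded_linear)
    ultimately obtain r where "r > 0" "ball x r \<subseteq> \<Omega>" "inj_on f (ball x r)"
      using has_derivative_locally_injective[OF x open\<Omega> _ g(2) der] by blast
    then show ?thesis by blast
  qed
  define \<F> where "\<F> = {ball x r | x r. inj_on f (ball x r) \<and> ball x r \<subseteq> \<Omega>}"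
  have "\<Union>\<F> = \<Omega>"
    using loc by (auto simp: \<F>_def) (metis centre_in_ball)
  moreover have "open S" if "S \<in> \<F>" for S
    using that by (auto simp: \<F>_def)
  ultimately obtain \<F>' where \<F>': "\<F>' \<subseteq> \<F>" "countable \<F>'" "\<Union>\<F>' = \<Omega>"
    using Lindelof[of \<F>] by auto
  \<comment> \<open>The empty set, a ball of radius 0, is added so that an enumeration exists even
    if \<Omega> is empty.\<close>
  define G where "G = from_nat_into (insert {} \<F>')"
  have "{} \<in> \<F>"
    unfolding \<F>_def by (rule CollectI, rule exI[of _ 0], rule exI[of _ 0]) simp
  then have G\<F>: "G n \<in> \<F>" for n
    using from_nat_into[of "insert {} \<F>'" n] \<F>'(1) by (auto simp: G_def)
  have rG: "range G = insert {} \<F>'"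
    unfolding G_def using \<F>'(2) by (intro range_from_nat_into) auto
  define A where "A = disjointed G"
  have UA: "(\<Union>n. A n) = \<Omega>"
    using \<F>'(3) by (simp add: A_def UN_disjointed_eq rG)
  have disjA: "disjoint_family A"
    by (simp add: A_def disjoint_family_disjointed)
  have AG: "A n \<subseteq> G n" for n
    by (simp add: A_def disjointed_subset)
  have injG: "inj_on f (G n)" and openG: "open (G n)" and bG: "bounded (G n)" for n
    using G\<F>[of n] by (auto simp: \<F>_def)
  have Ameas [measurable]: "A n \<in> sets borel" for n
    unfolding A_def disjointed_def using openG by (intro sets.Diff sets.countable_UN') auto
  have fA [measurable]: "f ` A n \<in> sets borel" for n
  proof -
    \<comment> \<open>Injectivity on the ball turns the image of a difference into a difference of
      images, and both of these are images of open sets.\<close>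
    have "f ` A n = f ` G n - f ` (G n \<inter> (\<Union>i\<in>{0..<n}. G i))"
      using injG[of n] unfolding A_def disjointed_def by (auto dest: inj_onD)
    then show ?thesis
      using openG by (auto intro!: sets.Diff borel_continuous_image_open[OF cf] open_Int open_UN)
  qed
  have int1: "(\<integral>\<^sup>+z. indicator B z * indicator (f ` A n) z \<partial>lborel) =
      (\<integral>\<^sup>+x. indicator B (f x) * ennreal \<bar>?d x\<bar> * indicator (A n) x \<partial>lborel)" for n
  proof -
    let ?S = "A n \<inter> f -` B"
    have fS: "f ` ?S = B \<inter> f ` A n" by auto
    have "(\<integral>\<^sup>+z. indicator B z * indicator (f ` A n) z \<partial>lborel) = emeasure lborel (f ` ?S)"
      by (simp add: fS indicator_inter_arith[symmetric])
    also have "\<dots> = (\<integral>\<^sup>+x. ennreal \<bar>?d x\<bar> * indicator ?S x \<partial>lborel)"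
    proof (rule emeasure_injective_image[OF der])
      show "?S \<in> sets borel" using measurable_sets[of f borel borel B] B by auto
      show "bounded ?S" using bG AG by (meson bounded_subset inf.coboundedI1)
      show "inj_on f ?S" using injG AG by (meson inj_on_subset inf.coboundedI1)
      show "f ` ?S \<in> sets borel" unfolding fS by measurable
    qed
    also have "\<dots> = (\<integral>\<^sup>+x. indicator B (f x) * ennreal \<bar>?d x\<bar> * indicator (A n) x \<partial>lborel)"
      by (intro nn_integral_cong) (auto split: split_indicator)
    finally show ?thesis .
  qed
  have "negligible (f ` (- \<Omega>))"
  proof (rule baby_Sard[where f'=f'])
    show "(f has_derivative f' x) (at x within - \<Omega>)" for x
      by (rule has_derivative_at_withinI[OF der])
    show "rank (matrix (f' x)) < CARD('n)" if "x \<in> - \<Omega>" for x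
      using that by (auto simp: \<Omega>_def det_nz_iff_inj lin less_rank_noninjective)
  qed simp
  then have "AE z in lebesgue. z \<notin> f ` (- \<Omega>)"
    by (intro AE_not_in) (simp only: negligible_iff_null_sets)
  then have AE: "AE z in lborel. z \<notin> f ` (- \<Omega>)"
    by (simp only: AE_completion_iff)
  have count: "num_points {x. f x = z} = (\<Sum>n. indicator (f ` A n) z)" if "z \<notin> f ` (- \<Omega>)" for z
  proof -
    have "{x. f x = z} = (\<Union>n. {x \<in> A n. f x = z})"
      using that UA by auto
    then have "num_points {x. f x = z} = (\<Sum>n. num_points {x \<in> A n. f x = z})"
      using disjA by (subst num_points_disjoint_UN[symmetric]) (auto simp: disjoint_family_on_def)
    moreover have "num_points {x \<in> A n. f x = z} = indicator (f ` A n) z" for n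
    proof (cases "z \<in> f ` A n")
      case True
      then obtain x where "x \<in> A n" "f x = z" by auto
      then have "{x \<in> A n. f x = z} = {x}"
        using injG[of n] AG[of n] by (auto dest: inj_onD)
      then show ?thesis using True by simp
    next
      case False
      then have "{x \<in> A n. f x = z} = {}" by auto
      then show ?thesis using False by (simp only: emeasure_empty indicator_simps not_False_eq_True)
    qed
    ultimately show ?thesis by simp
  qed
  have "(\<integral>\<^sup>+z. indicator B z * num_points {x. f x = z} \<partial>lborel) =
      (\<integral>\<^sup>+z. (\<Sum>n. indicator B z * indicator (f ` A n) z) \<partial>lborel)"
    using AE by (intro nn_integral_cong_AE) (auto simp: count)
  also have "\<dots> = (\<Sum>n. \<integral>\<^sup>+z. indicator B z * indicator (f ` A n) z \<partial>lborel)"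
    by (rule nn_integral_suminf) measurable
  also have "\<dots> = (\<Sum>n. \<integral>\<^sup>+x. indicator B (f x) * ennreal \<bar>?d x\<bar> * indicator (A n) x \<partial>lborel)"
    by (simp add: int1)
  also have "\<dots> = (\<integral>\<^sup>+x. (\<Sum>n. indicator B (f x) * ennreal \<bar>?d x\<bar> * indicator (A n) x) \<partial>lborel)"
    by (rule nn_integral_suminf[symmetric]) measurable
  also have "\<dots> = (\<integral>\<^sup>+x. indicator B (f x) * ennreal \<bar>?d x\<bar> \<partial>lborel)"
  proof (rule nn_integral_cong)
    fix x
    have "(\<Sum>n. indicator (A n) x :: ennreal) = indicator \<Omega> x"
      using suminf_indicator[OF disjA, of x] UA by simp
    then show "(\<Sum>n. indicator B (f x) * ennreal \<bar>?d x\<bar> * indicator (A n) x) =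
        indicator B (f x) * ennreal \<bar>?d x\<bar>"
      by (auto simp: \<Omega>_def split: split_indicator)
  qed
  finally show ?thesis .
qed

lemma num_points_image:
  assumes "inj_on f S"
  shows "num_points (f ` S) = num_points S"
  using assms by (simp add: emeasure_count_space card_image finite_image_iff)

lemma borel_measurable_num_points_fibre:
  fixes f :: "'a::euclidean_space \<Rightarrow> 'b::t2_space"
  assumes "continuous_on UNIV f"
  shows "(\<lambda>z. num_points {x. f x = z}) \<in> borel_measurable borel"
proof (rule borel_measurable_num_points)
  fix K :: "'a set" assume "compact K"
  moreover have "{z \<in> space borel. {x. f x = z} \<inter> K \<noteq> {}} = f ` K"
    by auto
  ultimately show "{z \<in> space borel. {x. f x = z} \<inter> K \<noteq> {}} \<in> sets borel"
    using assms by (metis borel_compact compact_continuous_image continuous_on_subset subset_UNIV)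
qed

text \<open>Coordinates in orthonormal bases preserve Lebesgue measure, the number of solutions and
  the Jacobian, so the formula carries over from \<open>real^'n\<close>. The type \<open>'n\<close>
  only indexes the bases.\<close>

theorem area_formula:
  fixes f :: "'a::euclidean_space \<Rightarrow> 'b::euclidean_space"
  assumes dim: "DIM('a) = CARD('n::{finite,wellorder})" "DIM('b) = CARD('n)"
    and der: "\<And>x. (f has_derivative f' x) (at x)"
    and cont: "\<And>v. continuous_on UNIV (\<lambda>x. f' x v)"
    and B: "B \<in> sets borel"
  shows "(\<integral>\<^sup>+z. indicator B z * num_points {x. f x = z} \<partial>lborel) =
    (\<integral>\<^sup>+x. indicator B (f x) * ennreal (jac (f' x)) \<partial>lborel)"
proof -
  obtain \<alpha> :: "'n \<Rightarrow> 'a" where \<alpha>: "bij_betw \<alpha> UNIV Basis"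
    using ex_basis_enumeration[OF dim(1)] .
  obtain \<beta> :: "'n \<Rightarrow> 'b" where \<beta>: "bij_betw \<beta> UNIV Basis"
    using ex_basis_enumeration[OF dim(2)] .
  let ?a = "from_coords \<alpha>" and ?b = "to_coords \<beta>" and ?b' = "from_coords \<beta>"
  define g where "g v = ?b (f (?a v))" for v
  define g' where "g' v = ?b \<circ> f' (?a v) \<circ> ?a" for v
  have lin: "linear (f' x)" for x
    using der has_derivative_linear by blast
  have cf: "continuous_on UNIV f"
    using der by (auto simp: continuous_on_eq_continuous_within intro: has_derivative_continuous)
  have [measurable]: "?a \<in> borel_measurable borel" "?b' \<in> borel_measurable borel"
    by (intro borel_measurable_continuous_onI continuous_from_coords \<alpha> \<beta>)+
  have [measurable]: "f \<in> borel_measurable borel"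
    using cf by (intro borel_measurable_continuous_onI)
  note [measurable] = B borel_measurable_num_points_fibre[OF cf]
  have matrix: "matrix (g' v) = (\<chi> i j. f' (?a v) (\<alpha> j) \<bullet> \<beta> i)" for v
    unfolding g'_def by (rule det_matrix_coords[OF \<alpha> \<beta>])
  have cmat: "continuous_on UNIV (\<lambda>v. matrix (g' v))"
    unfolding matrix
    by (intro continuous_on_vec_lambda continuous_on_inner continuous_on_const
        continuous_on_compose2[OF cont continuous_from_coords[OF \<alpha>]]) auto
  have derg: "(g has_derivative g' v) (at v)" for v
  proof -
    have a: "(?a has_derivative ?a) (at v)" and b: "(?b has_derivative ?b) (at (f (?a v)))"
      using linear_from_coords[OF \<alpha>] linear_to_coords[OF \<beta>] by (auto intro: linear_imp_has_derivative)
    show ?thesis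
      using diff_chain_at[OF a diff_chain_at[OF der b]]
      by (simp add: g_def[abs_def] g'_def o_def)
  qed
  have jac: "jac (f' (?a v)) = \<bar>det (matrix (g' v))\<bar>" for v
    unfolding g'_def by (rule jac_eq_det[OF \<alpha> \<beta> lin])
  have [measurable]: "(\<lambda>x. jac (f' x)) \<in> borel_measurable borel"
  proof -
    have "continuous_on UNIV (\<lambda>x. \<bar>det (\<chi> i j. f' x (\<alpha> j) \<bullet> \<beta> i)\<bar>)"
      unfolding det_def by (intro continuous_intros cont)
    moreover have "jac (f' x) = \<bar>det (\<chi> i j. f' x (\<alpha> j) \<bullet> \<beta> i)\<bar>" for x
      using jac_eq_det[OF \<alpha> \<beta> lin] by (simp add: det_matrix_coords \<alpha> \<beta>)
    ultimately show ?thesis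
      by (simp add: borel_measurable_continuous_onI)
  qed
  have fibre: "num_points {x. f x = ?b' w} = num_points {v. g v = w}" for w
  proof -
    have "{x. f x = ?b' w} = ?a ` {v. g v = w}"
      by (auto simp: g_def image_iff) (metis \<alpha> \<beta> from_to_coords to_from_coords)+
    moreover have "inj ?a"
      by (rule inj_on_inverseI[of _ "to_coords \<alpha>"]) (simp add: \<alpha>)
    ultimately show ?thesis
      by (simp add: num_points_image inj_on_subset[of _ UNIV])
  qed
  have "(\<integral>\<^sup>+z. indicator B z * num_points {x. f x = z} \<partial>lborel) =
      (\<integral>\<^sup>+z. indicator B z * num_points {x. f x = z} \<partial>distr lborel borel ?b')"
    by (simp add: distr_lborel_from_coords \<beta>)
  also have "\<dots> = (\<integral>\<^sup>+w. indicator (?b' -` B) w * num_points {v. g v = w} \<partial>lborel)"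
    by (subst nn_integral_distr) (simp_all add: fibre indicator_def)
  also have "\<dots> = (\<integral>\<^sup>+v. indicator (?b' -` B) (g v) * ennreal \<bar>det (matrix (g' v))\<bar> \<partial>lborel)"
    by (rule area_formula_cart[OF derg cmat]) (rule measurable_sets_borel[OF _ B], measurable)
  also have "\<dots> = (\<integral>\<^sup>+v. indicator B (f (?a v)) * ennreal (jac (f' (?a v))) \<partial>lborel)"
    by (simp add: jac g_def indicator_def \<beta>)
  also have "\<dots> = (\<integral>\<^sup>+x. indicator B (f x) * ennreal (jac (f' x)) \<partial>distr lborel borel ?a)"
    by (subst nn_integral_distr) simp_all
  also have "\<dots> = (\<integral>\<^sup>+x. indicator B (f x) * ennreal (jac (f' x)) \<partial>lborel)"
    by (simp add: distr_lborel_from_coords \<alpha>)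
  finally show ?thesis .
qed

section \<open>The orthogonal group and its Haar measure\<close>

lemma orthonormal_expansion:
  fixes B :: "'a::euclidean_space set"
  assumes "finite B" and orth: "pairwise orthogonal B" and norm: "\<And>b. b \<in> B \<Longrightarrow> norm b = 1"
    and x: "x \<in> span B"
  shows "(\<Sum>b\<in>B. (x \<bullet> b) *\<^sub>R b) = x"
proof -
  obtain u where u: "x = (\<Sum>b\<in>B. u b *\<^sub>R b)"
    using x by (auto simp: span_finite[OF \<open>finite B\<close>])
  have "x \<bullet> c = u c" if "c \<in> B" for c
  proof -
    have "x \<bullet> c = (\<Sum>b\<in>B. u b * (b \<bullet> c))"
      by (simp add: u inner_sum_left)
    also have "\<dots> = (\<Sum>b\<in>B. if b = c then u b else 0)"
      using orth norm that
      by (intro sum.cong refl) (auto simp: pairwise_def orthogonal_def norm_eq_1)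
    also have "\<dots> = u c"
      using \<open>finite B\<close> that by simp
    finally show ?thesis .
  qed
  then show ?thesis
    by (subst (2) u) (simp cong: sum.cong)
qed

lemma extend_orthonormal_basis:
  fixes S :: "'a::euclidean_space set"
  assumes S: "subspace S"
  obtains B B' where "B \<subseteq> S" "span B = S" "finite B" "card B = dim S"
    "finite B'" "B \<inter> B' = {}" "card B' + dim S = DIM('a)"
    "pairwise orthogonal (B \<union> B')" "\<forall>b\<in>B \<union> B'. norm b = 1" "span (B \<union> B') = UNIV"
proof -
  let ?T = "{y \<in> UNIV. \<forall>x\<in>S. orthogonal x y}"
  have T: "subspace ?T"
    using subspace_orthogonal_to_vectors[of S] by simp
  obtain B where B: "B \<subseteq> S" "pairwise orthogonal B" "\<And>x. x \<in> B \<Longrightarrow> norm x = 1"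
      "independent B" "card B = dim S" "span B = S"
    by (rule orthonormal_basis_subspace[OF S]) (rule that; blast)
  obtain C where C: "C \<subseteq> ?T" "pairwise orthogonal C" "\<And>x. x \<in> C \<Longrightarrow> norm x = 1"
      "independent C" "card C = dim ?T" "span C = ?T"
    by (rule orthonormal_basis_subspace[OF T]) (rule that; blast)
  have fin: "finite B" "finite C"
    using B(4) C(4) independent_imp_finite by auto
  have dimT: "dim ?T + dim S = DIM('a)"
    using dim_subspace_orthogonal_to_vectors[OF S subspace_UNIV] by simp
  have BC: "orthogonal b c" if "b \<in> B" "c \<in> C" for b c
    using that B(1) C(1) by blast
  have disj: "B \<inter> C = {}"
  proof (rule equals0I)
    fix b assume "b \<in> B \<inter> C"
    then have "orthogonal b b" "norm b = 1" using BC B(3) by auto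
    then show False by (simp add: orthogonal_def norm_eq_1)
  qed
  have orth: "pairwise orthogonal (B \<union> C)"
    using B(2) C(2) BC by (auto simp: pairwise_def intro: orthogonal_commute[THEN iffD1])
  have nrm: "norm b = 1" if "b \<in> B \<union> C" for b
    using that B(3) C(3) by blast
  have ind: "independent (B \<union> C)"
    using orth nrm[of 0] by (intro pairwise_orthogonal_independent) auto
  have "card (B \<union> C) = DIM('a)"
    using card_Un_disjoint[OF fin disj] B(5) C(5) dimT by simp
  then have "span (B \<union> C) = UNIV"
    using card_ge_dim_independent[of "B \<union> C" UNIV] ind by auto
  with that[of B C] B C fin disj dimT orth nrm show ?thesis by simp
qed

text \<open>Orthonormal bases adapted to S and T and to their orthogonal complements are matched by
  a bijection, whose linear extension is an isometry. This transitivity makes the choice of a base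
  point of the Grassmannian immaterial.\<close>

lemma orthogonal_transformation_subspaces:
  fixes S T :: "'a::euclidean_space set"
  assumes S: "subspace S" and T: "subspace T" and dim: "dim S = dim T"
  obtains f where "orthogonal_transformation f" "f ` S = T"
proof -
  obtain B B' where B: "B \<subseteq> S" "span B = S" "finite B" "card B = dim S"
      "finite B'" "B \<inter> B' = {}" "card B' + dim S = DIM('a)"
      "pairwise orthogonal (B \<union> B')" "\<forall>b\<in>B \<union> B'. norm b = 1" "span (B \<union> B') = UNIV"
    using extend_orthonormal_basis[OF S] .
  obtain C C' where C: "C \<subseteq> T" "span C = T" "finite C" "card C = dim T"
      "finite C'" "C \<inter> C' = {}" "card C' + dim T = DIM('a)"
      "pairwise orthogonal (C \<union> C')" "\<forall>b\<in>C \<union> C'. norm b = 1" "span (C \<union> C') = UNIV"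
    using extend_orthonormal_basis[OF T] .
  obtain p where p: "bij_betw p B C"
    using finite_same_card_bij[of B C] B C dim by auto
  obtain p' where p': "bij_betw p' B' C'"
    using finite_same_card_bij[of B' C'] B C dim by auto
  define \<phi> where "\<phi> b = (if b \<in> B then p b else p' b)" for b
  have \<phi>B: "bij_betw \<phi> B C"
    using p by (rule bij_betw_cong[THEN iffD1, rotated]) (simp add: \<phi>_def)
  have \<phi>B': "bij_betw \<phi> B' C'"
    using p' by (rule bij_betw_cong[THEN iffD1, rotated]) (use B(6) in \<open>auto simp: \<phi>_def\<close>)
  have \<phi>: "bij_betw \<phi> (B \<union> B') (C \<union> C')"
    using \<phi>B \<phi>B' C(6) by (rule bij_betw_combine)
  define f where "f x = (\<Sum>b\<in>B \<union> B'. (x \<bullet> b) *\<^sub>R \<phi> b)" for x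
  have lin: "linear f"
    by (rule linearI) (simp_all add: f_def inner_add_left scaleR_add_left sum.distrib scaleR_sum_right)
  have expand: "(\<Sum>b\<in>B \<union> B'. (x \<bullet> b) *\<^sub>R b) = x" for x
    using B by (intro orthonormal_expansion) auto
  have \<phi>inner: "\<phi> b \<bullet> \<phi> c = b \<bullet> c" if "b \<in> B \<union> B'" "c \<in> B \<union> B'" for b c
  proof (cases "b = c")
    case True
    have "\<phi> b \<in> C \<union> C'" using \<phi> that(1) by (auto simp: bij_betw_def)
    then show ?thesis
      using True B(9)[rule_format, OF that(1)] C(9) by (simp add: norm_eq_1)
  next
    case False
    then have "\<phi> b \<noteq> \<phi> c" "\<phi> b \<in> C \<union> C'" "\<phi> c \<in> C \<union> C'"
      using \<phi> that by (auto simp: bij_betw_def inj_on_eq_iff)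
    then have "\<phi> b \<bullet> \<phi> c = 0"
      using C(8) by (simp add: pairwise_def orthogonal_def)
    moreover have "b \<bullet> c = 0"
      using B(8) False that by (simp add: pairwise_def orthogonal_def)
    ultimately show ?thesis by simp
  qed
  have inner_sums: "(\<Sum>b\<in>B \<union> B'. a b *\<^sub>R x b) \<bullet> (\<Sum>c\<in>B \<union> B'. d c *\<^sub>R x c) =
      (\<Sum>b\<in>B \<union> B'. \<Sum>c\<in>B \<union> B'. a b * (d c * (x b \<bullet> x c)))" for a d and x :: "'a \<Rightarrow> 'a"
    by (simp only: inner_sum_left) (simp only: inner_sum_right inner_scaleR_left inner_scaleR_right sum_distrib_left mult.left_commute)
  have "f v \<bullet> f w = v \<bullet> w" for v w
  proof -
    have "f v \<bullet> f w = (\<Sum>b\<in>B \<union> B'. \<Sum>c\<in>B \<union> B'. (v \<bullet> b) * ((w \<bullet> c) * (\<phi> b \<bullet> \<phi> c)))"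
      by (simp only: f_def inner_sums)
    also have "\<dots> = (\<Sum>b\<in>B \<union> B'. \<Sum>c\<in>B \<union> B'. (v \<bullet> b) * ((w \<bullet> c) * (b \<bullet> c)))"
      by (intro sum.cong refl) (simp only: \<phi>inner)
    also have "\<dots> = (\<Sum>b\<in>B \<union> B'. (v \<bullet> b) *\<^sub>R b) \<bullet> (\<Sum>b\<in>B \<union> B'. (w \<bullet> b) *\<^sub>R b)"
      by (simp only: inner_sums)
    also have "\<dots> = v \<bullet> w" by (simp only: expand)
    finally show ?thesis .
  qed
  then have orth: "orthogonal_transformation f"
    using lin by (simp add: orthogonal_transformation_def)
  have fb: "f b = \<phi> b" if "b \<in> B" for b
  proof -
    have "f b = (\<Sum>c\<in>B \<union> B'. if c = b then \<phi> c else 0)"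
      unfolding f_def
    proof (intro sum.cong refl)
      fix c assume c: "c \<in> B \<union> B'"
      show "(b \<bullet> c) *\<^sub>R \<phi> c = (if c = b then \<phi> c else 0)"
        using B(8,9) c that by (auto simp: pairwise_def orthogonal_def norm_eq_1)
    qed
    also have "\<dots> = \<phi> b" using B(3,5) that by simp
    finally show ?thesis .
  qed
  have "f ` S = span (f ` B)"
    using B(2) linear_span_image[OF lin, of B] by simp
  also have "f ` B = C"
    using \<phi>B fb by (auto simp: bij_betw_def)
  finally have "f ` S = T" using C(2) by simp
  with orth that show ?thesis by blast
qed

section \<open>The action of the orthogonal group on matrices and on subspaces\<close>

lemma mat_of_vec_of_mat [simp]: "mat_of_vec (vec_of_mat A) = A"
  by (simp add: mat_of_vec_def vec_of_mat_def vec_eq_iff)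

lemma vec_of_mat_of_vec [simp]: "vec_of_mat (mat_of_vec v) = v"
  by (simp add: mat_of_vec_def vec_of_mat_def vec_eq_iff)

lemma linear_vec_of_mat: "linear vec_of_mat"
  by (rule linearI) (simp_all add: vec_of_mat_def vec_eq_iff)

lemma linear_mat_of_vec: "linear mat_of_vec"
  by (rule linearI) (simp_all add: mat_of_vec_def vec_eq_iff)

lemma inner_vec_of_mat: "vec_of_mat A \<bullet> vec_of_mat B = A \<bullet> B"
  by (simp add: vec_of_mat_def inner_vec_def sum.cartesian_product case_prod_beta flip: UNIV_Times_UNIV)

lemma inner_mat_of_vec: "mat_of_vec v \<bullet> mat_of_vec w = v \<bullet> w"
  using inner_vec_of_mat[of "mat_of_vec v" "mat_of_vec w"] by simp

lemma act_matrix_mul: "act (U ** V) A = act U (act V A)"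
  by (simp add: act_def matrix_vector_mul_assoc)

lemma act_mat_1 [simp]: "act (mat 1) A = A"
  by (simp add: act_def)

lemma linear_act: "linear (act U)"
  unfolding act_def[abs_def]
  using linear_compose[OF linear_compose[OF linear_vec_of_mat matrix_vector_mul_linear] linear_mat_of_vec]
  by (simp add: o_def)

lemma orthogonal_group_mul: "U \<in> orthogonal_group \<Longrightarrow> V \<in> orthogonal_group \<Longrightarrow> U ** V \<in> orthogonal_group"
  by (simp add: orthogonal_group_def orthogonal_matrix_mul)

lemma orthogonal_group_transpose: "U \<in> orthogonal_group \<Longrightarrow> transpose U \<in> orthogonal_group"
  by (simp add: orthogonal_group_def)

lemma orthogonal_group_cancel:
  assumes "U \<in> orthogonal_group"
  shows "transpose U ** U = mat 1" "U ** transpose U = mat 1"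
  using assms by (simp_all add: orthogonal_group_def orthogonal_matrix_def)

lemma orthogonal_transformation_act:
  assumes "U \<in> orthogonal_group"
  shows "orthogonal_transformation (act U)"
proof -
  have "orthogonal_transformation ((*v) U)"
    using assms by (simp add: orthogonal_group_def orthogonal_transformation_matrix)
  then show ?thesis
    by (simp add: orthogonal_transformation_def linear_act)
      (simp add: act_def inner_mat_of_vec inner_vec_of_mat)
qed

lemma act_transpose_cancel:
  assumes "U \<in> orthogonal_group"
  shows "act (transpose U) (act U A) = A" "act U (act (transpose U) A) = A"
  using assms by (simp_all add: orthogonal_group_cancel flip: act_matrix_mul)

text \<open>Flattening matrices to vectors is an isometry. Isometries of the matrix space that are
  built geometrically, such as two-sided rotations and reflections, thereby become group elements
  that Haar invariance can absorb.\<close>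

lemma orthogonal_transformation_eq_act:
  fixes L :: "real^'n^'m \<Rightarrow> real^'n^'m"
  assumes L: "orthogonal_transformation L"
  obtains V where "V \<in> orthogonal_group" "act V = L"
proof -
  let ?L = "vec_of_mat \<circ> L \<circ> mat_of_vec"
  have lin: "linear L"
    using L by (rule orthogonal_transformation_linear)
  have linL: "linear ?L"
    by (intro linear_compose linear_vec_of_mat linear_mat_of_vec lin)
  have "orthogonal_transformation ?L"
    using L linL by (simp add: orthogonal_transformation_def inner_mat_of_vec inner_vec_of_mat)
  then have "matrix ?L \<in> orthogonal_group"
    by (simp add: orthogonal_group_def orthogonal_transformation_matrix)
  moreover have "act (matrix ?L) A = L A" for A
  proof -
    have "matrix ?L *v vec_of_mat A = ?L (vec_of_mat A)"
      using linL by (simp add: matrix_works linear_matrix_vector_mul_eq)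
    then show ?thesis by (simp add: act_def)
  qed
  ultimately show ?thesis
    using that by blast
qed

lemma continuous_on_act [continuous_intros]:
  assumes "continuous_on S f" "continuous_on S g"
  shows "continuous_on S (\<lambda>x. act (f x) (g x))"
  unfolding act_def mat_of_vec_def vec_of_mat_def matrix_vector_mult_def
  by (simp, intro continuous_intros assms)

lemma act_projectivization:
  assumes "U \<in> orthogonal_group"
  shows "act_subspace U (projectivization W) = projectivization (act U ` W)"
proof -
  have lin: "linear (act U)" by (rule linear_act)
  have inj: "inj (act U)"
    by (rule orthogonal_transformation_inj[OF orthogonal_transformation_act[OF assms]])
  have "act U ` span {x} = span {act U x}" for x
    using linear_span_image[OF lin, of "{x}"] by simp
  moreover have "act U ` (W - {0}) = act U ` W - {0}"
    using inj linear_0[OF lin] by (auto simp: inj_eq) (metis inj_eq)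
  ultimately show ?thesis
    unfolding act_subspace_def projectivization_def
    by (metis (mono_tags, lifting) image_cong image_image)
qed

lemma act_subspace_in_grassmannian:
  assumes U: "U \<in> orthogonal_group" and L: "L \<in> grassmannian k"
  shows "act_subspace U L \<in> grassmannian k"
proof -
  obtain W where W: "L = projectivization W" "subspace W" "dim W = k + 1"
    using L by (auto simp: grassmannian_def)
  have "dim (act U ` W) = dim W"
    using orthogonal_transformation_inj[OF orthogonal_transformation_act[OF U]]
    by (intro dim_image_eq linear_act) (auto intro: inj_on_subset)
  moreover have "subspace (act U ` W)"
    using W(2) linear_act by (rule linear_subspace_image[rotated])
  ultimately show ?thesis
    using W act_projectivization[OF U, of W] unfolding grassmannian_def by auto
qed

section \<open>Invariance of Haar integrals\<close>

context
  fixes \<mu> :: "(real^'n^'n) measure"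
  assumes haar: "normalized_haar \<mu>"
begin

lemma prob_space_haar: "prob_space \<mu>"
  using haar by (simp add: normalized_haar_def)

lemma sets_haar: "sets \<mu> = sets (restrict_space borel orthogonal_group)"
  using haar by (simp add: normalized_haar_def)

lemma space_haar: "space \<mu> = orthogonal_group"
  using sets_eq_imp_space_eq[OF sets_haar] by (simp add: space_restrict_space)

lemma measurable_haar_ident: "(\<lambda>U. U) \<in> borel_measurable \<mu>"
  using borel_measurable_continuous_on_restrict[OF continuous_on_id, of orthogonal_group]
  by (simp add: measurable_cong_sets[OF sets_haar refl])

lemma measurable_to_haar:
  assumes "f \<in> borel_measurable M" "\<And>x. x \<in> space M \<Longrightarrow> f x \<in> orthogonal_group"
  shows "f \<in> measurable M \<mu>"
  unfolding measurable_cong_sets[OF refl sets_haar]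
  using assms by (intro measurable_restrict_space2) auto

lemma measurable_haar_mul_left:
  assumes "Q \<in> orthogonal_group"
  shows "(\<lambda>U. Q ** U) \<in> measurable \<mu> \<mu>"
proof (rule measurable_to_haar)
  show "(\<lambda>U. Q ** U) \<in> borel_measurable \<mu>"
    by (intro borel_measurable_continuous_on[OF _ measurable_haar_ident])
      (simp add: matrix_matrix_mult_def, intro continuous_intros)
qed (use assms in \<open>simp add: space_haar orthogonal_group_mul\<close>)

lemma measurable_haar_mul_right:
  assumes "Q \<in> orthogonal_group"
  shows "(\<lambda>U. U ** Q) \<in> measurable \<mu> \<mu>"
proof (rule measurable_to_haar)
  show "(\<lambda>U. U ** Q) \<in> borel_measurable \<mu>"
    by (intro borel_measurable_continuous_on[OF _ measurable_haar_ident])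
      (simp add: matrix_matrix_mult_def, intro continuous_intros)
qed (use assms in \<open>simp add: space_haar orthogonal_group_mul\<close>)

lemma measurable_haar_transpose: "transpose \<in> measurable \<mu> \<mu>"
proof (rule measurable_to_haar)
  show "transpose \<in> borel_measurable \<mu>"
    by (intro borel_measurable_continuous_on[OF _ measurable_haar_ident])
      (simp add: transpose_def, intro continuous_intros)
qed (simp add: space_haar orthogonal_group_transpose)

lemma nn_integral_haar_left:
  assumes h: "h \<in> borel_measurable \<mu>" and Q: "Q \<in> orthogonal_group"
  shows "(\<integral>\<^sup>+U. h (Q ** U) \<partial>\<mu>) = (\<integral>\<^sup>+U. h U \<partial>\<mu>)"
proof -
  have "(\<integral>\<^sup>+U. h U \<partial>\<mu>) = (\<integral>\<^sup>+U. h U \<partial>distr \<mu> \<mu> (\<lambda>U. Q ** U))"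
    using haar Q by (simp add: normalized_haar_def)
  also have "\<dots> = (\<integral>\<^sup>+U. h (Q ** U) \<partial>\<mu>)"
    using measurable_haar_mul_left[OF Q] h by (intro nn_integral_distr) auto
  finally show ?thesis by simp
qed

text \<open>Averaging \<open>h (U\<^sup>T V)\<close> over both variables, left invariance applies to either of them.\<close>

lemma nn_integral_haar_transpose:
  assumes h: "h \<in> borel_measurable \<mu>"
  shows "(\<integral>\<^sup>+U. h (transpose U) \<partial>\<mu>) = (\<integral>\<^sup>+U. h U \<partial>\<mu>)"
proof -
  interpret prob_space \<mu> by (rule prob_space_haar)
  interpret pair_sigma_finite \<mu> \<mu> ..
  have f: "(\<lambda>(U, V). transpose U ** V) \<in> measurable (\<mu> \<Otimes>\<^sub>M \<mu>) \<mu>"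
  proof (rule measurable_to_haar)
    have "fst \<in> borel_measurable (\<mu> \<Otimes>\<^sub>M \<mu>)" "snd \<in> borel_measurable (\<mu> \<Otimes>\<^sub>M \<mu>)"
      using measurable_compose[OF measurable_fst measurable_haar_ident]
        measurable_compose[OF measurable_snd measurable_haar_ident] by auto
    then have "(\<lambda>x. transpose (fst x) ** snd x) \<in> borel_measurable (\<mu> \<Otimes>\<^sub>M \<mu>)"
      by (rule borel_measurable_continuous_Pair)
        (simp add: matrix_matrix_mult_def transpose_def, intro continuous_intros)
    then show "(\<lambda>(U, V). transpose U ** V) \<in> borel_measurable (\<mu> \<Otimes>\<^sub>M \<mu>)"
      by (simp add: case_prod_beta')
  qed (auto simp: space_pair_measure space_haar orthogonal_group_mul orthogonal_group_transpose)
  have meas: "case_prod (\<lambda>U V. h (transpose U ** V)) \<in> borel_measurable (\<mu> \<Otimes>\<^sub>M \<mu>)"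
    using measurable_compose[OF f h] by (simp add: case_prod_beta')
  have ht: "(\<lambda>U. h (transpose U)) \<in> borel_measurable \<mu>"
    using measurable_compose[OF measurable_haar_transpose h] .
  have "(\<integral>\<^sup>+U. h U \<partial>\<mu>) = (\<integral>\<^sup>+U. (\<integral>\<^sup>+V. h (transpose U ** V) \<partial>\<mu>) \<partial>\<mu>)"
  proof -
    have "(\<integral>\<^sup>+U. (\<integral>\<^sup>+V. h (transpose U ** V) \<partial>\<mu>) \<partial>\<mu>) = (\<integral>\<^sup>+U. (\<integral>\<^sup>+V. h V \<partial>\<mu>) \<partial>\<mu>)"
      using nn_integral_haar_left[OF h orthogonal_group_transpose]
      by (rule nn_integral_cong) (simp only: space_haar)
    then show ?thesis by (simp add: emeasure_space_1)
  qed
  also have "\<dots> = (\<integral>\<^sup>+V. (\<integral>\<^sup>+U. h (transpose U ** V) \<partial>\<mu>) \<partial>\<mu>)"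
    by (rule Fubini'[OF meas, symmetric])
  also have "\<dots> = (\<integral>\<^sup>+V. (\<integral>\<^sup>+U. h (transpose U) \<partial>\<mu>) \<partial>\<mu>)"
  proof (rule nn_integral_cong)
    fix V assume "V \<in> space \<mu>"
    then have V: "V \<in> orthogonal_group" by (simp add: space_haar)
    have m: "(\<lambda>U. h (transpose U ** V)) \<in> borel_measurable \<mu>"
      using measurable_compose[OF measurable_compose[OF measurable_haar_transpose
          measurable_haar_mul_right[OF V]] h] .
    have "(\<integral>\<^sup>+U. h (transpose U ** V) \<partial>\<mu>) = (\<integral>\<^sup>+U. h (transpose (V ** U) ** V) \<partial>\<mu>)"
      using nn_integral_haar_left[OF m V] by simp
    also have "\<dots> = (\<integral>\<^sup>+U. h (transpose U) \<partial>\<mu>)"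
      by (simp add: matrix_transpose_mul orthogonal_group_cancel[OF V] flip: matrix_mul_assoc)
    finally show "(\<integral>\<^sup>+U. h (transpose U ** V) \<partial>\<mu>) = (\<integral>\<^sup>+U. h (transpose U) \<partial>\<mu>)" .
  qed
  also have "\<dots> = (\<integral>\<^sup>+U. h (transpose U) \<partial>\<mu>)"
    by (simp add: emeasure_space_1)
  finally show ?thesis by simp
qed

text \<open>On the orthogonal group transposition is inversion, so it exchanges left and right
  translations; right invariance thus follows from left invariance and invariance under
  transposition.\<close>

lemma nn_integral_haar_right:
  assumes h: "h \<in> borel_measurable \<mu>" and Q: "Q \<in> orthogonal_group"
  shows "(\<integral>\<^sup>+U. h (U ** Q) \<partial>\<mu>) = (\<integral>\<^sup>+U. h U \<partial>\<mu>)"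
proof -
  have ht: "(\<lambda>U. h (transpose U)) \<in> borel_measurable \<mu>"
    using measurable_compose[OF measurable_haar_transpose h] .
  have hr: "(\<lambda>U. h (U ** Q)) \<in> borel_measurable \<mu>"
    using measurable_compose[OF measurable_haar_mul_right[OF Q] h] .
  have "(\<integral>\<^sup>+U. h (U ** Q) \<partial>\<mu>) = (\<integral>\<^sup>+U. h (transpose U ** Q) \<partial>\<mu>)"
    using nn_integral_haar_transpose[OF hr] by simp
  also have "\<dots> = (\<integral>\<^sup>+U. h (transpose (transpose Q ** U)) \<partial>\<mu>)"
    by (simp add: matrix_transpose_mul)
  also have "\<dots> = (\<integral>\<^sup>+U. h (transpose U) \<partial>\<mu>)"
    by (rule nn_integral_haar_left[OF ht orthogonal_group_transpose[OF Q]])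
  also have "\<dots> = (\<integral>\<^sup>+U. h U \<partial>\<mu>)"
    by (rule nn_integral_haar_transpose[OF h])
  finally show ?thesis .
qed

end

text \<open>The generators of \<open>grassmannian_borel\<close> have relatively open preimages under
  every orbit map, in particular under the one at \<open>L0\<close>, and relatively open sets are
  measurable for \<mu>.\<close>

lemma measurable_orbit_map:
  fixes \<mu> :: "(real^('m::finite \<times> 'n::finite)^('m \<times> 'n)) measure" and L0 :: "(real^'n^'m) set set"
  assumes haar: "normalized_haar \<mu>" and L0: "L0 \<in> grassmannian k"
  shows "(\<lambda>U. act_subspace U L0) \<in> measurable \<mu> (grassmannian_borel k)"
  unfolding grassmannian_borel_def
proof (rule measurable_measure_of)
  show "(\<lambda>U. act_subspace U L0) \<in> space \<mu> \<rightarrow> grassmannian k"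
    using act_subspace_in_grassmannian[OF _ L0] by (auto simp: space_haar[OF haar])
  fix A :: "(real^'n^'m) set set set" assume "A \<in> {A. A \<subseteq> grassmannian k \<and>
         (\<forall>L0\<in>grassmannian k.
            openin (top_of_set orthogonal_group) {U \<in> orthogonal_group. act_subspace U L0 \<in> A})}"
  then have "openin (top_of_set orthogonal_group) {U \<in> orthogonal_group. act_subspace U L0 \<in> A}"
    using L0 by blast
  then obtain T where "open T" "{U \<in> orthogonal_group. act_subspace U L0 \<in> A} = orthogonal_group \<inter> T"
    unfolding openin_open by blast
  moreover have "(\<lambda>U. act_subspace U L0) -` A \<inter> space \<mu> = {U \<in> orthogonal_group. act_subspace U L0 \<in> A}"
    by (auto simp: space_haar[OF haar])
  ultimately show "(\<lambda>U. act_subspace U L0) -` A \<inter> space \<mu> \<in> sets \<mu>"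
    by (auto simp: sets_haar[OF haar] sets_restrict_space)
qed auto

section \<open>Radial integrals\<close>

text \<open>Polar coordinates for radial functions. It suffices to compare both measures on
  half-lines, where the volume of a ball is the integral of the area of its spheres.\<close>

lemma distr_norm_lborel:
  "distr (lborel :: 'a::euclidean_space measure) borel norm =
    density lborel (\<lambda>r. ennreal (DIM('a) * unit_ball_vol DIM('a) * r ^ (DIM('a) - 1)) * indicator {0..} r)"
  (is "?M = ?N")
proof (rule measure_eqI_generator_eq)
  let ?n = "DIM('a)" and ?E = "range (\<lambda>r::real. {..r})"
  let ?d = "\<lambda>r. real ?n * unit_ball_vol ?n * r ^ (?n - 1)"
  show "Int_stable ?E"
    by (auto simp: Int_stable_def Int_atMost)
  show "?E \<subseteq> Pow UNIV" by simp
  show "sets ?M = sigma_sets UNIV ?E" "sets ?N = sigma_sets UNIV ?E"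
    by (simp_all add: borel_eq_atMost)
  show "range (\<lambda>i::nat. {..real i}) \<subseteq> ?E" by auto
  show "(\<Union>i::nat. {..real i}) = UNIV"
    using real_arch_simple by (auto simp: set_eq_iff)
  have M: "emeasure ?M {..r} = (if r \<ge> 0 then ennreal (unit_ball_vol ?n * r ^ ?n) else 0)" for r
  proof -
    have "norm -` {..r} = (cball 0 r :: 'a set)" by (auto simp: dist_norm)
    then have "emeasure ?M {..r} = emeasure lborel (cball 0 r :: 'a set)"
      by (simp add: emeasure_distr)
    then show ?thesis by (simp add: emeasure_cball)
  qed
  show "emeasure ?M {..real i} \<noteq> \<infinity>" for i
    by (simp add: M)
  fix X assume "X \<in> ?E"
  then obtain r where X: "X = {..r}" by auto
  have N: "emeasure ?N {..r} = (\<integral>\<^sup>+x. ennreal (?d x) * indicator {0..r} x \<partial>lborel)"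
    by (subst emeasure_density) (auto intro!: nn_integral_cong split: split_indicator)
  show "emeasure ?M X = emeasure ?N X"
  proof (cases "r \<ge> 0")
    case True
    have "(\<integral>\<^sup>+x. ennreal (?d x) * indicator {0..r} x \<partial>lborel) =
        unit_ball_vol ?n * r ^ ?n - unit_ball_vol ?n * 0 ^ ?n"
    proof (rule nn_integral_FTC_Icc[OF _ _ _ True])
      show "((\<lambda>x. unit_ball_vol ?n * x ^ ?n) has_real_derivative ?d x) (at x)" for x
        by (auto intro!: derivative_eq_intros)
    qed simp_all
    then show ?thesis using True unfolding X N by (simp add: M)
  next
    case False
    then show ?thesis unfolding X N by (simp add: M)
  qed
qed

lemma nn_integral_radial:
  fixes h :: "real \<Rightarrow> ennreal"
  assumes [measurable]: "h \<in> borel_measurable borel"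
  shows "(\<integral>\<^sup>+x. h (norm (x :: 'a::euclidean_space)) \<partial>lborel) =
    (\<integral>\<^sup>+r. ennreal (DIM('a) * unit_ball_vol DIM('a) * r ^ (DIM('a) - 1)) * indicator {0..} r * h r \<partial>lborel)"
proof -
  have "(\<integral>\<^sup>+x. h (norm (x :: 'a)) \<partial>lborel) = (\<integral>\<^sup>+r. h r \<partial>distr (lborel :: 'a measure) borel norm)"
    by (subst nn_integral_distr) simp_all
  then show ?thesis
    by (simp add: distr_norm_lborel nn_integral_density)
qed

text \<open>The integrand is the Jacobian of the angular velocity in Cayley coordinates, and
  \<open>8 * pi ^ 2\<close> is the volume of the rotation group when length is measured by the
  rotation angle.\<close>

lemma nn_integral_rotation_volume:
  "(\<integral>\<^sup>+a. ennreal (8 / (1 + (norm (a :: real^3))\<^sup>2)\<^sup>2) \<partial>lborel) = ennreal (8 * pi\<^sup>2)"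
proof -
  \<comment> \<open>An antiderivative of \<open>32 * pi * r ^ 2 / (1 + r ^ 2) ^ 2\<close>, the
    integrand times the sphere area \<open>4 * pi * r ^ 2\<close>.\<close>
  let ?F = "\<lambda>r. 16 * pi * (arctan r - r / (1 + r\<^sup>2))"
  have "(\<integral>\<^sup>+a. ennreal (8 / (1 + (norm (a :: real^3))\<^sup>2)\<^sup>2) \<partial>lborel) =
      (\<integral>\<^sup>+r. ennreal (32 * pi * r\<^sup>2 / (1 + r\<^sup>2)\<^sup>2) * indicator {0..} r \<partial>lborel)"
    by (subst nn_integral_radial[where h="\<lambda>r. ennreal (8 / (1 + r\<^sup>2)\<^sup>2)"])
      (auto intro!: nn_integral_cong simp: unit_ball_vol_3 ennreal_mult'[symmetric] split: split_indicator)
  also have "\<dots> = 8 * pi\<^sup>2 - ?F 0"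
  proof (rule nn_integral_FTC_atLeast)
    fix x :: real
    have pos: "1 + x\<^sup>2 > 0" by (simp add: add_pos_nonneg)
    have "1 / (1 + x\<^sup>2) - ((1 + x\<^sup>2) - x * (2 * x)) / ((1 + x\<^sup>2) * (1 + x\<^sup>2)) = 2 * x\<^sup>2 / (1 + x\<^sup>2)\<^sup>2"
      using pos by (simp add: divide_simps) (simp add: power2_eq_square algebra_simps)
    then have eq: "32 * pi * x\<^sup>2 / (1 + x\<^sup>2)\<^sup>2 =
        16 * pi * (1 / (1 + x\<^sup>2) - ((1 + x\<^sup>2) - x * (2 * x)) / ((1 + x\<^sup>2) * (1 + x\<^sup>2)))"
      by simp
    show "(?F has_real_derivative 32 * pi * x\<^sup>2 / (1 + x\<^sup>2)\<^sup>2) (at x)"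
      unfolding eq using pos by (auto intro!: derivative_eq_intros simp: inverse_eq_divide)
  next
    show "(?F \<longlongrightarrow> 8 * pi\<^sup>2) at_top"
      by (real_asymp simp: power2_eq_square)
  qed simp_all
  finally show ?thesis by simp
qed

text \<open>Both sides are multiples of the integral \<open>?I\<close> of \<open>r ^ 5\<close> times
  \<open>k r\<close>. On the right the sphere area gives \<open>pi ^ 3\<close>. On the left the
  sphere area gives \<open>8 * pi\<close> times the same integral with
  \<open>k (sqrt 2 * s)\<close>, and the substitution of \<open>sqrt 2 * s\<close> for r divides by
  \<open>sqrt 2 ^ 6 = 8\<close>, which leaves pi.\<close>

lemma nn_integral_radial_3_6:
  assumes [measurable]: "k \<in> borel_measurable borel"
  shows "(\<integral>\<^sup>+t. ennreal (2 * norm (t :: real^3) ^ 3) * k (sqrt 2 * norm t) \<partial>lborel) =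
    ennreal (1 / pi\<^sup>2) * (\<integral>\<^sup>+x. k (norm (x :: (real^3) \<times> (real^3))) \<partial>lborel)"
proof -
  let ?I = "\<integral>\<^sup>+r. ennreal (r ^ 5) * indicator {0..} r * k r \<partial>lborel"
  have ubv: "6 * unit_ball_vol 6 = pi ^ 3"
    by (simp add: eval_unit_ball_vol)
  have "(\<integral>\<^sup>+x. k (norm (x :: (real^3) \<times> (real^3))) \<partial>lborel) =
      (\<integral>\<^sup>+r. ennreal (pi ^ 3) * (ennreal (r ^ 5) * indicator {0..} r * k r) \<partial>lborel)"
    by (subst nn_integral_radial)
      (auto intro!: nn_integral_cong simp: ubv ennreal_mult' mult_ac split: split_indicator)
  also have "\<dots> = ennreal (pi ^ 3) * ?I"
    by (rule nn_integral_cmult) measurable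
  finally have six: "(\<integral>\<^sup>+x. k (norm (x :: (real^3) \<times> (real^3))) \<partial>lborel) = ennreal (pi ^ 3) * ?I" .
  have "?I = ennreal \<bar>sqrt 2\<bar> * (\<integral>\<^sup>+s. ennreal ((0 + sqrt 2 * s) ^ 5) * indicator {0..} (0 + sqrt 2 * s) * k (0 + sqrt 2 * s) \<partial>lborel)"
    by (rule nn_integral_real_affine) simp_all
  also have "\<dots> = (\<integral>\<^sup>+s. ennreal (sqrt 2) * (ennreal ((sqrt 2 * s) ^ 5) * indicator {0..} (sqrt 2 * s) * k (sqrt 2 * s)) \<partial>lborel)"
    by (subst nn_integral_cmult) simp_all
  also have "\<dots> = (\<integral>\<^sup>+s. 8 * (ennreal (s ^ 5) * indicator {0..} s * k (sqrt 2 * s)) \<partial>lborel)"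
  proof (rule nn_integral_cong)
    fix s :: real
    have "(sqrt 2) ^ 6 = ((sqrt 2)\<^sup>2) ^ 3"
      by (simp only: power_mult[symmetric]) simp
    then have "sqrt 2 ^ 6 = 8" by simp
    moreover have "sqrt 2 * (sqrt 2 * s) ^ 5 = sqrt 2 ^ 6 * s ^ 5"
      by (simp only: power_mult_distrib) (simp add: eval_nat_numeral)
    ultimately have eq: "sqrt 2 * (sqrt 2 * s) ^ 5 = 8 * s ^ 5" by simp
    have "ennreal (sqrt 2) * ennreal ((sqrt 2 * s) ^ 5) = ennreal (sqrt 2 * (sqrt 2 * s) ^ 5)"
      by (rule ennreal_mult'[symmetric]) simp
    also have "\<dots> = 8 * ennreal (s ^ 5)"
      unfolding eq by (subst ennreal_mult') simp_all
    finally have "ennreal (sqrt 2) * ennreal ((sqrt 2 * s) ^ 5) = 8 * ennreal (s ^ 5)" .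
    then show "ennreal (sqrt 2) * (ennreal ((sqrt 2 * s) ^ 5) * indicator {0..} (sqrt 2 * s) * k (sqrt 2 * s)) =
        8 * (ennreal (s ^ 5) * indicator {0..} s * k (sqrt 2 * s))"
      by (auto simp: mult.assoc[symmetric] zero_le_mult_iff split: split_indicator)
  qed
  also have "\<dots> = 8 * (\<integral>\<^sup>+s. ennreal (s ^ 5) * indicator {0..} s * k (sqrt 2 * s) \<partial>lborel)"
    by (rule nn_integral_cmult) measurable
  finally have I: "?I = 8 * (\<integral>\<^sup>+s. ennreal (s ^ 5) * indicator {0..} s * k (sqrt 2 * s) \<partial>lborel)" .
  have "(\<integral>\<^sup>+t. ennreal (2 * norm (t :: real^3) ^ 3) * k (sqrt 2 * norm t) \<partial>lborel) =
      (\<integral>\<^sup>+s. ennreal (8 * pi) * (ennreal (s ^ 5) * indicator {0..} s * k (sqrt 2 * s)) \<partial>lborel)"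
  proof (subst nn_integral_radial[where h="\<lambda>s. ennreal (2 * s ^ 3) * k (sqrt 2 * s)"], measurable,
      rule nn_integral_cong)
    fix s :: real
    show "ennreal (DIM(real^3) * unit_ball_vol DIM(real^3) * s ^ (DIM(real^3) - 1)) * indicator {0..} s *
        (ennreal (2 * s ^ 3) * k (sqrt 2 * s)) =
      ennreal (8 * pi) * (ennreal (s ^ 5) * indicator {0..} s * k (sqrt 2 * s))"
    proof (cases "s \<ge> 0")
      case True
      have "ennreal (3 * (4 / 3 * pi) * s\<^sup>2) * ennreal (2 * s ^ 3) = ennreal (3 * (4 / 3 * pi) * s\<^sup>2 * (2 * s ^ 3))"
        using True by (intro ennreal_mult[symmetric]) auto
      also have "3 * (4 / 3 * pi) * s\<^sup>2 * (2 * s ^ 3) = 8 * pi * s ^ 5"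
        by (simp add: eval_nat_numeral)
      also have "ennreal (8 * pi * s ^ 5) = ennreal (8 * pi) * ennreal (s ^ 5)"
        using True by (intro ennreal_mult) auto
      finally show ?thesis
        using True by (simp add: unit_ball_vol_3 mult.assoc[symmetric])
    qed simp
  qed
  also have "\<dots> = ennreal (8 * pi) * (\<integral>\<^sup>+s. ennreal (s ^ 5) * indicator {0..} s * k (sqrt 2 * s) \<partial>lborel)"
    by (rule nn_integral_cmult) measurable
  also have "\<dots> = ennreal pi * ?I"
    unfolding I by (simp add: ennreal_mult' mult_ac)
  also have "\<dots> = ennreal (1 / pi\<^sup>2) * (ennreal (pi ^ 3) * ?I)"
    by (simp add: mult.assoc[symmetric] ennreal_mult'[symmetric] power2_eq_square power3_eq_cube)
  finally show ?thesis by (simp add: six)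
qed

section \<open>The Cayley chart of the essential variety\<close>

lemma skew_matrix_entries:
  "skew_matrix t = vector [vector [0, - t $ 3, t $ 2], vector [t $ 3, 0, - t $ 1], vector [- t $ 2, t $ 1, 0]]"
  by (simp add: skew_matrix_def matrix_def vec_eq_iff forall_3 cross3_def axis_def)

lemma skew_matrix_mult: "skew_matrix t *v x = cross3 t x"
  by (simp add: skew_matrix_entries vec_eq_iff forall_3 matrix_vector_mult_def sum_3 cross3_def)

lemma linear_skew_matrix: "linear skew_matrix"
  by (rule linearI) (simp_all add: skew_matrix_entries vec_eq_iff forall_3)

lemma transpose_skew_matrix: "transpose (skew_matrix t) = - skew_matrix t"
  by (simp add: skew_matrix_entries transpose_def vec_eq_iff forall_3)

section \<open>Rotations as half turns or Cayley rotations\<close>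

definition outer_square :: "real^3 \<Rightarrow> real^3^3" where
  "outer_square v = (\<chi> i j. v $ i * v $ j)"

text \<open>For a unit vector v this is the rotation by the angle pi about v. These are exactly the
  rotations that the Cayley transform misses.\<close>

definition half_turn :: "real^3 \<Rightarrow> real^3^3" where
  "half_turn v = 2 *\<^sub>R outer_square v - mat 1"

definition cayley_numerator :: "real^3 \<Rightarrow> real^3^3" where
  "cayley_numerator a = (1 - a \<bullet> a) *\<^sub>R mat 1 + 2 *\<^sub>R outer_square a + 2 *\<^sub>R skew_matrix a"

text \<open>The Cayley transform of \<open>skew_matrix a\<close>, that is, the rotation given by the
  quaternion with real part 1 and imaginary part a. The vector a points along the axis, and its
  length is the tangent of half the angle.\<close>

definition cayley :: "real^3 \<Rightarrow> real^3^3" where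
  "cayley a = (1 / (1 + a \<bullet> a)) *\<^sub>R cayley_numerator a"

lemma one_plus_inner_pos: "1 + a \<bullet> a > (0::real)" for a :: "'a::real_inner"
  by (simp add: add_pos_nonneg)

lemma outer_square_mult: "outer_square v *v x = (v \<bullet> x) *\<^sub>R v"
  by (simp add: outer_square_def vec_eq_iff matrix_vector_mult_def inner_vec_def sum_distrib_left
      sum_distrib_right mult_ac)

lemma half_turn_mult: "half_turn v *v x = (2 * (v \<bullet> x)) *\<^sub>R v - x"
  by (simp add: half_turn_def matrix_vector_mult_diff_rdistrib outer_square_mult
      flip: scaleR_matrix_vector_assoc)

lemma inner_matrix_vector: "(A *v x) \<bullet> y = x \<bullet> (transpose A *v y)" for A :: "real^'n^'m"
  by (metis dot_lmul_matrix inner_commute transpose_matrix_vector)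

lemma rotation_matrix_cancel:
  fixes Q :: "real^'n^'n"
  assumes "rotation_matrix Q"
  shows "Q ** transpose Q = mat 1" "transpose Q ** Q = mat 1"
  using assms by (simp_all add: rotation_matrix_def orthogonal_matrix_def)

lemma rotation_matrix_mult_cancel:
  fixes Q :: "real^'n^'n"
  assumes "rotation_matrix Q"
  shows "Q *v (transpose Q *v x) = x" "transpose Q *v (Q *v x) = x"
  by (simp_all only: matrix_vector_mul_assoc rotation_matrix_cancel[OF assms] matrix_vector_mul_lid)

lemma rotation_matrix_mul: "rotation_matrix A \<Longrightarrow> rotation_matrix B \<Longrightarrow> rotation_matrix (A ** B)"
  for A :: "real^'n^'n"
  by (simp add: rotation_matrix_def orthogonal_matrix_mul det_mul)

lemma rotation_matrix_transpose: "rotation_matrix A \<Longrightarrow> rotation_matrix (transpose A)"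
  for A :: "real^'n^'n"
  by (simp add: rotation_matrix_def det_transpose)

lemma skew_matrix_rotate:
  assumes Q: "rotation_matrix Q"
  shows "skew_matrix (Q *v v) = Q ** skew_matrix v ** transpose Q"
proof (subst matrix_eq, intro allI)
  fix x
  have "x = Q *v (transpose Q *v x)"
    by (simp only: rotation_matrix_mult_cancel[OF Q])
  then have "cross3 (Q *v v) x = cross3 (Q *v v) (Q *v (transpose Q *v x))" by simp
  also have "\<dots> = Q *v cross3 v (transpose Q *v x)"
    by (rule cross_rotation_matrix[OF Q])
  finally show "skew_matrix (Q *v v) *v x = Q ** skew_matrix v ** transpose Q *v x"
    by (simp add: skew_matrix_mult del: transpose_matrix_vector flip: matrix_vector_mul_assoc)
qed

lemma outer_square_rotate: "outer_square (Q *v v) = Q ** outer_square v ** transpose Q"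
  by (subst matrix_eq)
    (simp add: outer_square_mult inner_matrix_vector matrix_vector_mult_scaleR
      del: transpose_matrix_vector flip: matrix_vector_mul_assoc)

lemma half_turn_rotate:
  assumes "rotation_matrix Q"
  shows "half_turn (Q *v v) = Q ** half_turn v ** transpose Q"
  by (subst matrix_eq)
    (simp add: half_turn_mult inner_matrix_vector matrix_vector_mult_scaleR matrix_vector_mult_diff_distrib
      rotation_matrix_mult_cancel[OF assms] del: transpose_matrix_vector flip: matrix_vector_mul_assoc)

lemma inner_rotate:
  fixes Q :: "real^'n^'n"
  assumes "rotation_matrix Q"
  shows "(Q *v x) \<bullet> (Q *v y) = x \<bullet> y"
  by (simp only: inner_matrix_vector rotation_matrix_mult_cancel[OF assms])

text \<open>Each of the three terms of the numerator is equivariant. This allows a rotation to be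
  analysed in coordinates whose first axis is its own axis.\<close>

lemma cayley_rotate:
  assumes Q: "rotation_matrix Q"
  shows "cayley (Q *v a) = Q ** cayley a ** transpose Q"
proof (subst matrix_eq, intro allI)
  fix x
  show "cayley (Q *v a) *v x = Q ** cayley a ** transpose Q *v x"
    by (simp add: cayley_def cayley_numerator_def inner_rotate[OF Q] skew_matrix_rotate[OF Q]
        outer_square_rotate matrix_vector_mult_add_rdistrib matrix_vector_mult_scaleR
        matrix_vector_right_distrib rotation_matrix_mult_cancel[OF Q] del: transpose_matrix_vector
        flip: matrix_vector_mul_assoc scaleR_matrix_vector_assoc)
qed

text \<open>After clearing the denominator \<open>?s\<close> orthogonality and orientation are
  polynomial identities: the numerator has Gram matrix \<open>?s * ?s\<close> times the identity and
  determinant \<open>?s ^ 3\<close>.\<close>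

lemma rotation_matrix_cayley: "rotation_matrix (cayley a)"
proof -
  let ?s = "1 + a \<bullet> a" and ?N = "cayley_numerator a"
  have s: "?s > 0" by (rule one_plus_inner_pos)
  have aa: "a \<bullet> a = a $ 1 * a $ 1 + a $ 2 * a $ 2 + a $ 3 * a $ 3"
    by (simp add: inner_vec_def sum_3)
  have NN: "transpose ?N ** ?N = (?s * ?s) *\<^sub>R mat 1"
    unfolding cayley_numerator_def aa
    by (simp add: vec_eq_iff forall_3 matrix_matrix_mult_def sum_3 transpose_def outer_square_def
        skew_matrix_entries mat_def) (simp add: algebra_simps)
  have "transpose (cayley a) ** cayley a = mat 1"
  proof -
    have "transpose (cayley a) ** cayley a = (1 / ?s * (1 / ?s)) *\<^sub>R (transpose ?N ** ?N)"
      by (simp add: cayley_def vec_eq_iff matrix_matrix_mult_def transpose_def sum_3)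
        (simp add: algebra_simps add_divide_distrib)
    then show ?thesis using s by (simp add: NN)
  qed
  then have orth: "orthogonal_matrix (cayley a)"
    by (simp add: orthogonal_matrix)
  have "det ?N = ?s ^ 3"
    unfolding cayley_numerator_def aa
    by (simp add: det_3 outer_square_def skew_matrix_entries mat_def)
      (simp add: algebra_simps power3_eq_cube)
  moreover have "det (cayley a) = (1 / ?s) ^ 3 * det ?N"
    by (simp add: cayley_def det_3 power3_eq_cube algebra_simps)
  ultimately have "det (cayley a) = 1"
    using s by (simp add: power_one_over)
  with orth show ?thesis by (simp add: rotation_matrix_def)
qed

lemma half_turn_involution:
  assumes v: "norm v = 1"
  shows "half_turn v ** half_turn v = mat 1"
proof (subst matrix_eq, intro allI)
  fix x
  have "v \<bullet> (half_turn v *v x) = v \<bullet> x"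
    using v by (simp add: half_turn_mult inner_diff_right norm_eq_1)
  then have "half_turn v *v (half_turn v *v x) = x"
    by (subst half_turn_mult) (simp add: half_turn_mult)
  then show "half_turn v ** half_turn v *v x = mat 1 *v x"
    by (simp flip: matrix_vector_mul_assoc)
qed

lemma rotation_matrix_half_turn:
  assumes v: "norm v = 1"
  shows "rotation_matrix (half_turn v)"
proof -
  have vv: "v $ 1 * v $ 1 + v $ 2 * v $ 2 + v $ 3 * v $ 3 = 1"
    using v by (simp add: norm_eq_1 inner_vec_def sum_3)
  have "transpose (half_turn v) = half_turn v"
    by (simp add: half_turn_def outer_square_def transpose_def vec_eq_iff mat_def mult.commute)
  with half_turn_involution[OF v] have orth: "orthogonal_matrix (half_turn v)"
    by (simp add: orthogonal_matrix)
  have "det (half_turn v) = 2 * (v $ 1 * v $ 1 + v $ 2 * v $ 2 + v $ 3 * v $ 3) - 1"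
    by (simp add: half_turn_def det_3 outer_square_def mat_def) (simp add: algebra_simps)
  with vv orth show ?thesis by (simp add: rotation_matrix_def)
qed

text \<open>Odd dimension forces the eigenvalue 1: the matrix \<open>R - mat 1\<close> equals R
  times the transpose of \<open>mat 1 - R\<close>, so its determinant equals that of its negative
  and hence vanishes.\<close>

lemma rotation_axis:
  fixes R :: "real^3^3"
  assumes R: "rotation_matrix R"
  obtains v where "norm v = 1" "R *v v = v"
proof -
  have "(R - mat 1) = R ** transpose (mat 1 - R)"
  proof (subst matrix_eq, intro allI)
    fix x
    have "transpose (mat 1 - R) = mat 1 - transpose R"
      by (simp add: transpose_def vec_eq_iff mat_def)
    then show "(R - mat 1) *v x = R ** transpose (mat 1 - R) *v x"
      by (simp add: matrix_vector_mult_diff_rdistrib matrix_vector_mult_diff_distrib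
          rotation_matrix_mult_cancel[OF R] del: transpose_matrix_vector flip: matrix_vector_mul_assoc)
  qed
  then have "det (R - mat 1) = det (mat 1 - R)"
    using R by (simp only: det_mul det_transpose rotation_matrix_def)
  also have "\<dots> = - det (R - mat 1)"
    by (simp add: det_3 algebra_simps)
  finally have "det (R - mat 1) = 0" by simp
  then have "\<not> inj ((*v) (R - mat 1))"
    using det_nz_iff_inj[OF matrix_vector_mul_linear, of "R - mat 1"] by simp
  then obtain x where x: "x \<noteq> 0" "(R - mat 1) *v x = 0"
    using linear_injective_0[OF matrix_vector_mul_linear, of "R - mat 1"] by auto
  then have "R *v x = x" by (simp add: matrix_vector_mult_diff_rdistrib)
  then have "R *v (x /\<^sub>R norm x) = x /\<^sub>R norm x"
    by (simp add: matrix_vector_mult_scaleR)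
  moreover have "norm (x /\<^sub>R norm x) = 1" using x by simp
  ultimately show ?thesis using that by blast
qed

text \<open>With the axis moved to the first coordinate vector, R becomes a plane rotation with
  cosine c and sine s. The value \<open>c = -1\<close> gives a half turn, every other value a Cayley
  rotation.\<close>

lemma rotation_matrix_cayley_or_half_turn:
  assumes R: "rotation_matrix R"
  shows "(\<exists>a. R = cayley a) \<or> (\<exists>v. norm v = 1 \<and> R = half_turn v)"
proof -
  obtain v where v: "norm v = 1" "R *v v = v"
    by (rule rotation_axis[OF R])
  obtain Q where Q: "rotation_matrix Q" "Q *v axis 1 1 = v"
    by (rule rotation_matrix_exists_basis[where a=v and k=1]) (use v in auto)
  define S where "S = transpose Q ** R ** Q"
  have S: "rotation_matrix S"
    unfolding S_def by (intro rotation_matrix_mul rotation_matrix_transpose R Q)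
  have RS: "R = Q ** S ** transpose Q"
    by (simp add: S_def matrix_mul_assoc rotation_matrix_cancel[OF Q(1)])
      (simp add: rotation_matrix_cancel[OF Q(1)] flip: matrix_mul_assoc)
  have Se: "S *v axis 1 1 = axis 1 1"
  proof -
    have "S *v axis 1 1 = transpose Q *v (R *v (Q *v axis 1 1))"
      by (simp add: S_def matrix_mul_assoc matrix_vector_mul_assoc)
    also have "\<dots> = transpose Q *v (Q *v axis 1 1)"
      by (simp add: Q v)
    finally show ?thesis
      by (simp add: matrix_vector_mul_assoc rotation_matrix_cancel[OF Q(1)])
  qed
  then have S1: "S $ 1 $ 1 = 1" "S $ 2 $ 1 = 0" "S $ 3 $ 1 = 0"
    by (simp_all add: vec_eq_iff forall_3 matrix_vector_mult_def sum_3 axis_def)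
  have "S ** transpose S = mat 1" "transpose S ** S = mat 1"
    using rotation_matrix_cancel[OF S] by auto
  then have "S $ 1 $ 1 * S $ 1 $ 1 + S $ 1 $ 2 * S $ 1 $ 2 + S $ 1 $ 3 * S $ 1 $ 3 = 1"
    and col2: "S $ 1 $ 2 * S $ 1 $ 2 + S $ 2 $ 2 * S $ 2 $ 2 + S $ 3 $ 2 * S $ 3 $ 2 = 1"
    and col23: "S $ 1 $ 2 * S $ 1 $ 3 + S $ 2 $ 2 * S $ 2 $ 3 + S $ 3 $ 2 * S $ 3 $ 3 = 0"
    by (simp_all add: vec_eq_iff forall_3 matrix_matrix_mult_def sum_3 transpose_def mat_def)
  then have "S $ 1 $ 2 * S $ 1 $ 2 + S $ 1 $ 3 * S $ 1 $ 3 = 0"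
    by (simp add: S1)
  then have S12: "S $ 1 $ 2 = 0" "S $ 1 $ 3 = 0"
    by (simp_all add: sum_squares_eq_zero_iff)
  have "det S = 1" using S by (simp add: rotation_matrix_def)
  then have d: "S $ 2 $ 2 * S $ 3 $ 3 - S $ 2 $ 3 * S $ 3 $ 2 = 1"
    by (simp add: det_3 S1 S12)
  define c s where "c = S $ 2 $ 2" and "s = S $ 3 $ 2"
  have cs: "c * c + s * s = 1"
    using col2 by (simp add: S12 c_def s_def)
  have ds: "c * S $ 3 $ 3 - S $ 2 $ 3 * s = 1" "c * S $ 2 $ 3 + s * S $ 3 $ 3 = 0"
    using d col23 by (simp_all add: S12 c_def s_def)
  have S33: "S $ 3 $ 3 = c"
    using cs ds by algebra
  have S23: "S $ 2 $ 3 = - s"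
    using cs ds by algebra
  show ?thesis
  proof (cases "c = -1")
    case True
    then have "s = 0" using cs by simp
    then have "S = half_turn (axis 1 1)"
      using True S1 S12 S33 S23
      by (simp add: vec_eq_iff forall_3 half_turn_def outer_square_def mat_def axis_def
          flip: c_def s_def)
    then have "R = half_turn v"
      using RS Q half_turn_rotate[OF Q(1), of "axis 1 1"] by simp
    with v show ?thesis by blast
  next
    case False
    \<comment> \<open>The factor \<open>s / (1 + c)\<close> is the tangent of half the
      angle.\<close>
    define a where "a = (s / (1 + c)) *\<^sub>R (axis 1 1 :: real^3)"
    have c1: "1 + c \<noteq> 0" using False by simp
    have sq: "(s / (1 + c)) * (s / (1 + c)) = (1 - c) / (1 + c)"
    proof -
      have "(s / (1 + c)) * (s / (1 + c)) = (s * s) / ((1 + c) * (1 + c))" by simp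
      also have "s * s = (1 - c) * (1 + c)" using cs by (simp add: algebra_simps)
      also have "(1 - c) * (1 + c) / ((1 + c) * (1 + c)) = (1 - c) / (1 + c)"
        by (rule mult_divide_mult_cancel_right[OF c1])
      finally show ?thesis .
    qed
    have "a \<bullet> a = (s / (1 + c)) * (s / (1 + c))"
      unfolding a_def by (simp add: inner_axis_axis)
    with sq have aa: "a \<bullet> a = (1 - c) / (1 + c)" by (simp only:)
    have p: "1 / (1 + a \<bullet> a) = (1 + c) / 2" "1 - a \<bullet> a = 2 * c / (1 + c)"
      using c1 by (simp_all add: aa field_simps)
    define u w where "u = s / (1 + c)" and "w = 2 * c / (1 + c)"
    have a123: "a $ 1 = u" "a $ 2 = 0" "a $ 3 = 0"
      by (simp_all add: a_def u_def axis_def)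
    have k: "u + c * u = s" "u * u + c * (u * u) = 1 - c" "w + c * w = 2 * c"
    proof -
      show "u + c * u = s" "w + c * w = 2 * c"
      proof -
        have "(1 + c) * u = s" "(1 + c) * w = 2 * c" using c1 by (simp_all add: u_def w_def)
        then show "u + c * u = s" "w + c * w = 2 * c" by (simp_all add: algebra_simps)
      qed
      have "(1 + c) * (u * u) = 1 - c"
        using sq c1 by (simp only: u_def) simp
      then show "u * u + c * (u * u) = 1 - c" by (simp add: algebra_simps)
    qed
    have cay: "cayley a $ i $ j = (1 + c) / 2 * (w * mat 1 $ i $ j + 2 * (a $ i * a $ j) +
        2 * skew_matrix a $ i $ j)" for i j
      by (simp add: cayley_def cayley_numerator_def p outer_square_def w_def)
    have S22: "S $ 2 $ 2 = c" "S $ 3 $ 2 = s"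
      by (simp_all add: c_def s_def)
    have "S = cayley a"
      unfolding vec_eq_iff forall_3 cay
      using k by (simp add: S1 S12 S22 S33 S23 a123 mat_def skew_matrix_entries) (simp add: algebra_simps)
    then have "R = cayley (Q *v a)"
      using RS cayley_rotate[OF Q(1), of a] by simp
    then show ?thesis by blast
  qed
qed

lemma trace_cayley: "trace (cayley a) * (1 + a \<bullet> a) = 3 - a \<bullet> a"
proof -
  have "trace (cayley_numerator a) = 3 - a \<bullet> a"
    by (simp add: trace_def sum_3 cayley_numerator_def outer_square_def skew_matrix_entries mat_def
        inner_vec_def)
  moreover have "trace (cayley a) = (1 / (1 + a \<bullet> a)) * trace (cayley_numerator a)"
    by (simp add: trace_def cayley_def sum_3 add_divide_distrib)
  ultimately show ?thesis
    using one_plus_inner_pos[of a] by simp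
qed

text \<open>The trace determines \<open>a \<bullet> a\<close> and so the denominator; the
  antisymmetric part of the numerator is \<open>2 *\<^sub>R skew_matrix a\<close>.\<close>

lemma inj_cayley: "inj cayley"
proof (rule injI)
  fix a b assume eq: "cayley a = cayley b"
  have "(3 - a \<bullet> a) * (1 + b \<bullet> b) = (3 - b \<bullet> b) * (1 + a \<bullet> a)"
    using trace_cayley[of a] trace_cayley[of b] eq by (simp flip: trace_cayley)
  then have ab: "a \<bullet> a = b \<bullet> b" by (simp add: algebra_simps)
  then have "cayley_numerator a = cayley_numerator b"
    using eq one_plus_inner_pos[of b] by (simp add: cayley_def)
  then have "cayley_numerator a $ i $ j - cayley_numerator a $ j $ i =
      cayley_numerator b $ i $ j - cayley_numerator b $ j $ i" for i j
    by simp
  from this[of 3 2] this[of 1 3] this[of 2 1] show "a = b"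
    by (simp add: cayley_numerator_def outer_square_def skew_matrix_entries mat_def vec_eq_iff forall_3 mult.commute)
qed

section \<open>The two factorisations of an essential matrix\<close>

lemma matrix_mul_neg:
  fixes A :: "real^'n^'m" and B :: "real^'k^'n"
  shows "(- A) ** B = - (A ** B)" "A ** (- B) = - (A ** B)"
  by (simp_all add: matrix_matrix_mult_def vec_eq_iff sum_negf)

text \<open>The rotation \<open>transpose A\<close> fixes all vectors \<open>cross3 t x\<close>,
  hence the plane orthogonal to t. As a rotation it respects cross products and therefore also fixes
  t, which is a multiple of the cross product of two vectors of that plane.\<close>

lemma skew_mult_eq_imp:
  assumes R: "rotation_matrix R" "rotation_matrix R'" and t: "t \<noteq> 0"
    and eq: "skew_matrix t ** R = skew_matrix t ** R'"
  shows "R = R'"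
proof -
  define A where "A = R ** transpose R'"
  have A: "rotation_matrix A"
    unfolding A_def by (intro rotation_matrix_mul rotation_matrix_transpose R)
  have "skew_matrix t ** A = skew_matrix t"
    unfolding A_def using eq rotation_matrix_cancel[OF R(2)]
    by (simp add: matrix_mul_assoc) (simp flip: matrix_mul_assoc)
  then have "transpose (skew_matrix t ** A) = transpose (skew_matrix t)" by simp
  then have AS: "transpose A ** skew_matrix t = skew_matrix t"
    by (simp only: matrix_transpose_mul transpose_skew_matrix matrix_mul_neg neg_equal_iff_equal)
  have fixA: "transpose A *v cross3 t x = cross3 t x" for x
  proof -
    have "transpose A *v (skew_matrix t *v x) = skew_matrix t *v x"
      by (simp only: matrix_vector_mul_assoc AS)
    then show ?thesis by (simp only: skew_matrix_mult)
  qed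
  have A': "rotation_matrix (transpose A)"
    by (rule rotation_matrix_transpose[OF A])
  have fixt: "transpose A *v t = t"
  proof -
    obtain x where x: "cross3 t x \<noteq> 0"
      using cross_basis_nonzero[OF t] by blast
    let ?w = "cross3 t x"
    have w: "cross3 ?w (cross3 t ?w) = (?w \<bullet> ?w) *\<^sub>R t"
      by (simp add: cross3_def vec_eq_iff forall_3 inner_vec_def sum_3 algebra_simps)
    have "transpose A *v cross3 ?w (cross3 t ?w) = cross3 (transpose A *v ?w) (transpose A *v cross3 t ?w)"
      using cross_rotation_matrix[OF A'] by simp
    then have "(?w \<bullet> ?w) *\<^sub>R (transpose A *v t) = (?w \<bullet> ?w) *\<^sub>R t"
      by (simp add: fixA w del: transpose_matrix_vector flip: matrix_vector_mult_scaleR)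
    then show ?thesis using x by simp
  qed
  have "transpose A *v x = x" for x
  proof -
    have x: "(t \<bullet> t) *\<^sub>R x = (t \<bullet> x) *\<^sub>R t - cross3 t (cross3 t x)"
      by (simp add: cross3_def vec_eq_iff forall_3 inner_vec_def sum_3 algebra_simps)
    have "(t \<bullet> t) *\<^sub>R (transpose A *v x) = transpose A *v ((t \<bullet> t) *\<^sub>R x)"
      by (simp add: matrix_vector_mult_scaleR)
    also have "\<dots> = (t \<bullet> t) *\<^sub>R x"
      by (simp add: x matrix_vector_mult_diff_distrib matrix_vector_mult_scaleR fixA fixt del: transpose_matrix_vector)
    finally show ?thesis using t by simp
  qed
  then have "transpose A = mat 1"
    by (simp add: matrix_eq)
  then have "A = mat 1"
    using transpose_transpose[of A] by simp
  then have "A ** R' = R'" by simp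
  then show ?thesis
    using rotation_matrix_cancel[OF R(2)] by (simp add: A_def flip: matrix_mul_assoc)
qed

text \<open>A half turn about t negates the plane orthogonal to t, and the cross product with t
  ignores the component along t.\<close>

lemma skew_mult_half_turn:
  assumes "t \<noteq> 0"
  shows "skew_matrix t ** half_turn (t /\<^sub>R norm t) = skew_matrix (- t)"
proof (subst matrix_eq, intro allI)
  fix x
  have "cross3 t (t /\<^sub>R norm t) = 0"
    by (simp add: cross_mult_right)
  then show "skew_matrix t ** half_turn (t /\<^sub>R norm t) *v x = skew_matrix (- t) *v x"
    by (simp add: half_turn_mult skew_matrix_mult Cross3.right_diff_distrib cross_mult_right
        flip: matrix_vector_mul_assoc)
qed

text \<open>The product of the matrix with its transpose is minus the square of
  \<open>skew_matrix t\<close> and determines t up to sign; the sign of t then determines the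
  rotation. The second solution is the twisted pair of epipolar geometry.\<close>

lemma skew_mult_eq_cases:
  assumes R: "rotation_matrix R" "rotation_matrix R'" and t: "t \<noteq> 0"
    and eq: "skew_matrix t' ** R' = skew_matrix t ** R"
  shows "(t', R') = (t, R) \<or> (t', R') = (- t, half_turn (t /\<^sub>R norm t) ** R)"
proof -
  have gram: "skew_matrix t ** R ** transpose (skew_matrix t ** R) = - (skew_matrix t ** skew_matrix t)"
    if "rotation_matrix R" for t R
  proof -
    have "skew_matrix t ** R ** transpose (skew_matrix t ** R) =
        - (skew_matrix t ** R ** (transpose R ** skew_matrix t))"
      by (simp only: matrix_transpose_mul transpose_skew_matrix matrix_mul_neg)
    also have "skew_matrix t ** R ** (transpose R ** skew_matrix t) =
        skew_matrix t ** (R ** transpose R) ** skew_matrix t"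
      by (simp only: matrix_mul_assoc)
    finally show ?thesis by (simp add: rotation_matrix_cancel[OF that])
  qed
  have "skew_matrix t' ** R' ** transpose (skew_matrix t' ** R') =
      skew_matrix t ** R ** transpose (skew_matrix t ** R)"
    by (simp add: eq)
  then have SS: "skew_matrix t' ** skew_matrix t' = skew_matrix t ** skew_matrix t"
    by (simp only: gram[OF R(1)] gram[OF R(2)] neg_equal_iff_equal)
  have sq: "cross3 t' (cross3 t' x) = cross3 t (cross3 t x)" for x
  proof -
    have "skew_matrix t' *v (skew_matrix t' *v x) = skew_matrix t *v (skew_matrix t *v x)"
      by (simp only: matrix_vector_mul_assoc SS)
    then show ?thesis by (simp only: skew_matrix_mult)
  qed
  \<comment> \<open>At \<open>x = t\<close> the right side of \<open>sq\<close> vanishes, while the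
    inner product of the left side with t is minus the squared norm of \<open>cross3 t' t\<close>.
    Hence t' is parallel to t.\<close>
  have "cross3 t' (cross3 t' t) \<bullet> t = 0"
    by (simp add: sq)
  then have "cross3 t' t \<bullet> cross3 t' t = 0"
    by (simp add: cross3_def inner_vec_def sum_3 algebra_simps)
  then have t't: "cross3 t' t = 0" by simp
  have "(t \<bullet> t) *\<^sub>R t' = (t \<bullet> t') *\<^sub>R t - cross3 t (cross3 t t')"
    by (simp add: cross3_def vec_eq_iff forall_3 inner_vec_def sum_3 algebra_simps)
  also have "cross3 t t' = 0" using t't cross_skew[of t' t] by simp
  finally have "(t \<bullet> t) *\<^sub>R t' = (t \<bullet> t') *\<^sub>R t" by simp
  then have t'c: "t' = ((t \<bullet> t') / (t \<bullet> t)) *\<^sub>R t"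
  proof -
    have "t' = (1 / (t \<bullet> t)) *\<^sub>R ((t \<bullet> t) *\<^sub>R t')" using t by simp
    also have "(t \<bullet> t) *\<^sub>R t' = (t \<bullet> t') *\<^sub>R t" by fact
    finally show ?thesis by simp
  qed
  define c where "c = (t \<bullet> t') / (t \<bullet> t)"
  have t': "t' = c *\<^sub>R t" using t'c by (simp add: c_def)
  obtain x where x: "cross3 t x \<noteq> 0"
    using cross_basis_nonzero[OF t] by blast
  have "cross3 t (cross3 t x) \<noteq> 0"
  proof
    assume "cross3 t (cross3 t x) = 0"
    moreover have "cross3 t (cross3 t x) \<bullet> x = - (cross3 t x \<bullet> cross3 t x)"
      by (simp add: cross3_def inner_vec_def sum_3 algebra_simps)
    ultimately show False using x by simp
  qed
  moreover have "(c * c) *\<^sub>R cross3 t (cross3 t x) = cross3 t (cross3 t x)"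
    using sq[of x] by (simp add: t' cross_mult_left cross_mult_right)
  ultimately have "c * c = 1"
    using scaleR_right_imp_eq[of "cross3 t (cross3 t x)" "c * c" 1] by simp
  then have "c = 1 \<or> c = -1" by (simp add: square_eq_1_iff)
  then show ?thesis
  proof
    assume "c = 1"
    then show ?thesis
      using skew_mult_eq_imp[OF R(2,1) t] eq t' by simp
  next
    assume c: "c = -1"
    let ?H = "half_turn (t /\<^sub>R norm t)"
    have n: "norm (t /\<^sub>R norm t) = 1" using t by simp
    have H: "rotation_matrix (?H ** R')"
      by (intro rotation_matrix_mul rotation_matrix_half_turn n R)
    have "skew_matrix t ** (?H ** R') = skew_matrix t ** R"
      using eq c t' by (simp add: matrix_mul_assoc skew_mult_half_turn[OF t])
    then have "?H ** R' = R"
      using skew_mult_eq_imp[OF H R(1) t] by simp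
    then have "?H ** R = R'"
      using half_turn_involution[OF n] by (simp add: matrix_mul_assoc[of ?H ?H] flip: \<open>?H ** R' = R\<close>)
    then show ?thesis using c t' by simp
  qed
qed

text \<open>The exceptional cone: its parameters are a vector and a unit vector, so it has at most
  five dimensions, against six for the whole cone.\<close>

definition half_turn_cone :: "(real^3^3) set" where
  "half_turn_cone = {skew_matrix t ** half_turn v | t v. norm v = 1}"

definition essential_chart :: "real^3 \<Rightarrow> real^3 \<Rightarrow> real^3^3" where
  "essential_chart t a = skew_matrix t ** cayley a"

lemma essential_matrices_eq:
  "essential_matrices = range (\<lambda>(t, a). essential_chart t a) \<union> half_turn_cone"
proof -
  have "skew_matrix t ** R \<in> range (\<lambda>(t, a). essential_chart t a) \<union> half_turn_cone"
    if "rotation_matrix R" for t R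
    using rotation_matrix_cayley_or_half_turn[OF that]
    by (auto simp: essential_chart_def half_turn_cone_def)
  then show ?thesis
    by (auto simp: essential_matrices_def essential_chart_def half_turn_cone_def
        intro: rotation_matrix_cayley rotation_matrix_half_turn)
qed

text \<open>Of the two factorisations of y one comes from the chart. The rotation of its twisted
  partner is again a Cayley rotation, since a half turn there would put y into
  \<open>half_turn_cone\<close>.\<close>

lemma essential_chart_two_to_one:
  assumes y: "y \<in> essential_matrices" "y \<noteq> 0" "y \<notin> half_turn_cone"
  shows "card {(t, a). essential_chart t a = y} = 2"
proof -
  obtain t a where ta: "y = essential_chart t a"
    using y by (auto simp: essential_matrices_eq)
  have "skew_matrix 0 = 0"
    using linear_0[OF linear_skew_matrix] .
  then have t: "t \<noteq> 0"
    using y(2) ta by (auto simp: essential_chart_def)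
  let ?H = "half_turn (t /\<^sub>R norm t)"
  have n: "norm (t /\<^sub>R norm t) = 1" using t by simp
  have H: "rotation_matrix (?H ** cayley a)"
    by (intro rotation_matrix_mul rotation_matrix_half_turn n rotation_matrix_cayley)
  have flip: "skew_matrix (- t) ** (?H ** cayley a) = y"
  proof -
    have "skew_matrix (- t) ** ?H = skew_matrix t"
      using skew_mult_half_turn[of "- t"] t
      by (simp add: half_turn_def outer_square_def)
    then show ?thesis by (simp add: ta essential_chart_def matrix_mul_assoc)
  qed
  have "\<exists>a'. ?H ** cayley a = cayley a'"
    using rotation_matrix_cayley_or_half_turn[OF H] flip y(3)
    by (auto simp: half_turn_cone_def)
  then obtain a' where a': "?H ** cayley a = cayley a'" ..
  have "{(t, a). essential_chart t a = y} = {(t, a), (- t, a')}"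
  proof (intro set_eqI iffI)
    fix p assume "p \<in> {(t, a). essential_chart t a = y}"
    then obtain u b where p: "p = (u, b)" "skew_matrix u ** cayley b = skew_matrix t ** cayley a"
      by (auto simp: ta essential_chart_def)
    have "(u, cayley b) = (t, cayley a) \<or> (u, cayley b) = (- t, cayley a')"
      using skew_mult_eq_cases[OF rotation_matrix_cayley rotation_matrix_cayley t p(2)]
      unfolding a' .
    then show "p \<in> {(t, a), (- t, a')}"
      using injD[OF inj_cayley] by (auto simp: p(1))
  next
    fix p assume "p \<in> {(t, a), (- t, a')}"
    then show "p \<in> {(t, a). essential_chart t a = y}"
      using flip by (auto simp: ta essential_chart_def a')
  qed
  moreover have "t \<noteq> - t"
  proof
    assume "t = - t"
    then have "t + t = 0" using add.right_inverse[of t] by simp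
    then have "2 *\<^sub>R t = 0" by (simp only: scaleR_2)
    with t show False by simp
  qed
  ultimately show ?thesis by simp
qed

section \<open>Tangent spaces of the essential variety\<close>

lemma has_derivative_matrix_componentwise:
  fixes f :: "'a::real_normed_vector \<Rightarrow> real^'n^'m"
  assumes "\<And>i j. ((\<lambda>x. f x $ i $ j) has_derivative (\<lambda>h. f' h $ i $ j)) (at x)"
  shows "(f has_derivative f') (at x)"
  unfolding has_derivative_componentwise_within[of f]
proof
  fix b :: "real^'n^'m" assume "b \<in> Basis"
  then obtain i j where "b = axis i (axis j 1)"
    by (auto simp: Basis_vec_def)
  then show "((\<lambda>x. f x \<bullet> b) has_derivative (\<lambda>h. f' h \<bullet> b)) (at x)"
    using assms[of i j] by (simp add: inner_axis)
qed

lemma has_derivative_matrix_nth: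
  fixes f :: "'a::real_normed_vector \<Rightarrow> real^'n^'m"
  assumes "(f has_derivative f') F"
  shows "((\<lambda>x. f x $ i $ j) has_derivative (\<lambda>h. f' h $ i $ j)) F"
  by (intro bounded_linear.has_derivative[OF bounded_linear_vec_nth] assms)

lemma has_derivative_matrix_mul:
  fixes f :: "'a::real_normed_vector \<Rightarrow> real^'n^'m" and g :: "'a \<Rightarrow> real^'k^'n"
  assumes f: "(f has_derivative f') (at x)" and g: "(g has_derivative g') (at x)"
  shows "((\<lambda>x. f x ** g x) has_derivative (\<lambda>h. f x ** g' h + f' h ** g x)) (at x)"
proof (rule has_derivative_matrix_componentwise)
  fix i j
  have "((\<lambda>x. \<Sum>k\<in>UNIV. f x $ i $ k * g x $ k $ j) has_derivative
      (\<lambda>h. \<Sum>k\<in>UNIV. f x $ i $ k * g' h $ k $ j + f' h $ i $ k * g x $ k $ j)) (at x)"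
    by (intro has_derivative_sum has_derivative_mult has_derivative_matrix_nth f g)
  then show "((\<lambda>x. (f x ** g x) $ i $ j) has_derivative (\<lambda>h. (f x ** g' h + f' h ** g x) $ i $ j)) (at x)"
    by (simp add: matrix_matrix_mult_def sum.distrib)
qed

text \<open>The angular velocity of \<open>cayley a\<close> when a moves with velocity h.\<close>

definition cayley_velocity :: "real^3 \<Rightarrow> real^3 \<Rightarrow> real^3" where
  "cayley_velocity a h = (2 / (1 + a \<bullet> a)) *\<^sub>R (h + cross3 a h)"

lemma linear_cayley_velocity: "linear (cayley_velocity a)"
  by (rule linearI) (simp_all add: cayley_velocity_def cross_add_right cross_mult_right algebra_simps)

lemma has_derivative_skew_matrix:
  assumes "(f has_derivative f') F"
  shows "((\<lambda>x. skew_matrix (f x)) has_derivative (\<lambda>h. skew_matrix (f' h))) F"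
  using linear_skew_matrix by (intro bounded_linear.has_derivative[OF _ assms])
    (simp add: linear_conv_bounded_linear)

lemma has_derivative_cayley_numerator:
  "(cayley_numerator has_derivative (\<lambda>h. (- 2 * (a \<bullet> h)) *\<^sub>R mat 1 +
      2 *\<^sub>R (\<chi> i j. a $ i * h $ j + h $ i * a $ j) + 2 *\<^sub>R skew_matrix h)) (at a)"
proof (rule has_derivative_matrix_componentwise)
  fix i j :: 3
  have nth: "((\<lambda>x. x $ k) has_derivative (\<lambda>h. h $ k)) (at a)" for k :: 3
    by (intro bounded_linear_imp_has_derivative bounded_linear_vec_nth)
  have sk: "((\<lambda>x. skew_matrix x $ i $ j) has_derivative (\<lambda>h. skew_matrix h $ i $ j)) (at a)"
    by (intro has_derivative_matrix_nth has_derivative_skew_matrix has_derivative_ident)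
  have "((\<lambda>x. (1 - x \<bullet> x) * mat 1 $ i $ j + 2 * (x $ i * x $ j) + 2 * skew_matrix x $ i $ j) has_derivative
      (\<lambda>h. (0 - (a \<bullet> h + h \<bullet> a)) * mat 1 $ i $ j + 2 * (a $ i * h $ j + h $ i * a $ j) +
        2 * skew_matrix h $ i $ j)) (at a)"
    by (intro has_derivative_add has_derivative_mult_right has_derivative_mult_left has_derivative_mult
        has_derivative_diff has_derivative_const has_derivative_inner has_derivative_ident nth sk)
  then show "((\<lambda>x. cayley_numerator x $ i $ j) has_derivative
      (\<lambda>h. ((- 2 * (a \<bullet> h)) *\<^sub>R mat 1 + 2 *\<^sub>R (\<chi> i j. a $ i * h $ j + h $ i * a $ j) +
        2 *\<^sub>R skew_matrix h) $ i $ j)) (at a)"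
    by (simp add: cayley_numerator_def outer_square_def inner_commute[of _ a])
qed

lemma has_derivative_cayley:
  "(cayley has_derivative (\<lambda>h. skew_matrix (cayley_velocity a h) ** cayley a)) (at a)"
proof -
  let ?s = "1 + a \<bullet> a" and ?N = "cayley_numerator a"
  let ?N' = "\<lambda>h. (- 2 * (a \<bullet> h)) *\<^sub>R mat 1 + 2 *\<^sub>R (\<chi> i j. a $ i * h $ j + h $ i * a $ j) + 2 *\<^sub>R skew_matrix h"
  have s: "?s > 0" by (rule one_plus_inner_pos)
  have "((\<lambda>a. inverse (1 + a \<bullet> a)) has_derivative (\<lambda>h. - (inverse ?s * (0 + (a \<bullet> h + h \<bullet> a)) * inverse ?s))) (at a)"
  proof (rule Deriv.has_derivative_inverse)
    show "?s \<noteq> 0" using s by simp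
    show "((\<lambda>a. 1 + a \<bullet> a) has_derivative (\<lambda>h. 0 + (a \<bullet> h + h \<bullet> a))) (at a)"
      by (intro has_derivative_add has_derivative_const has_derivative_inner has_derivative_ident)
  qed
  from has_derivative_scaleR[OF this has_derivative_cayley_numerator]
  have "(cayley has_derivative
      (\<lambda>h. inverse ?s *\<^sub>R ?N' h + (- (inverse ?s * (0 + (a \<bullet> h + h \<bullet> a)) * inverse ?s)) *\<^sub>R ?N)) (at a)"
    by (simp add: cayley_def[abs_def] inverse_eq_divide)
  moreover have "inverse ?s *\<^sub>R ?N' h + (- (inverse ?s * (0 + (a \<bullet> h + h \<bullet> a)) * inverse ?s)) *\<^sub>R ?N =
      skew_matrix (cayley_velocity a h) ** cayley a" for h
  proof -
    have aa: "a \<bullet> a = a $ 1 * a $ 1 + a $ 2 * a $ 2 + a $ 3 * a $ 3"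
      "a \<bullet> h = a $ 1 * h $ 1 + a $ 2 * h $ 2 + a $ 3 * h $ 3"
      by (simp_all add: inner_vec_def sum_3)
    \<comment> \<open>The quotient rule multiplied by the square of the denominator, which leaves a
      polynomial identity in the coordinates of a and h.\<close>
    have key: "?s *\<^sub>R ?N' h - (2 * (a \<bullet> h)) *\<^sub>R ?N = 2 *\<^sub>R (skew_matrix (h + cross3 a h) ** ?N)"
      unfolding cayley_numerator_def aa
      by (simp add: vec_eq_iff forall_3 matrix_matrix_mult_def sum_3 outer_square_def
          skew_matrix_entries mat_def cross3_def) (simp add: algebra_simps)
    have "inverse ?s *\<^sub>R ?N' h + (- (inverse ?s * (0 + (a \<bullet> h + h \<bullet> a)) * inverse ?s)) *\<^sub>R ?N =
        (inverse ?s * inverse ?s) *\<^sub>R (?s *\<^sub>R ?N' h - (2 * (a \<bullet> h)) *\<^sub>R ?N)"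
      using s by (simp add: scaleR_diff_right inner_commute[of h a] mult_ac)
    also have "\<dots> = (inverse ?s * inverse ?s) *\<^sub>R (2 *\<^sub>R (skew_matrix (h + cross3 a h) ** ?N))"
      by (simp only: key)
    also have "\<dots> = skew_matrix (cayley_velocity a h) ** cayley a"
      unfolding cayley_velocity_def cayley_def linear_scale[OF linear_skew_matrix]
      by (simp add: vec_eq_iff matrix_matrix_mult_def sum_3 inverse_eq_divide)
        (simp add: algebra_simps add_divide_distrib)
    finally show ?thesis .
  qed
  ultimately show ?thesis by simp
qed

lemma matrix_add_mul: "(A + B) ** C = A ** C + B ** C" for A B :: "real^'n^'m" and C :: "real^'k^'n"
  by (simp add: matrix_matrix_mult_def vec_eq_iff distrib_right sum.distrib)

text \<open>The product rule for the chart. The rotation is kept as a right factor because right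
  multiplication by it is an isometry of the matrix space and can be split off.\<close>

definition essential_velocity :: "real^3 \<Rightarrow> real^3 \<Rightarrow> (real^3) \<times> (real^3) \<Rightarrow> real^3^3" where
  "essential_velocity t a h =
     (skew_matrix (fst h) + skew_matrix t ** skew_matrix (cayley_velocity a (snd h))) ** cayley a"

lemma has_derivative_essential_chart:
  "((\<lambda>p. essential_chart (fst p) (snd p)) has_derivative essential_velocity (fst p) (snd p)) (at p)"
proof -
  have 1: "((\<lambda>p :: (real^3) \<times> (real^3). skew_matrix (fst p)) has_derivative (\<lambda>h. skew_matrix (fst h))) (at p)"
    by (intro has_derivative_skew_matrix has_derivative_fst has_derivative_ident)
  have 2: "((\<lambda>p :: (real^3) \<times> (real^3). cayley (snd p)) has_derivative
      (\<lambda>h. skew_matrix (cayley_velocity (snd p) (snd h)) ** cayley (snd p))) (at p)"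
    using diff_chain_at[OF has_derivative_snd[OF has_derivative_ident] has_derivative_cayley, of p]
    by (simp add: o_def)
  show ?thesis
    using has_derivative_matrix_mul[OF 1 2]
    by (simp add: essential_chart_def essential_velocity_def[abs_def] matrix_mul_assoc
        matrix_add_mul add.commute)
qed

lemma continuous_on_cayley:
  assumes "continuous_on S f"
  shows "continuous_on S (\<lambda>x. cayley (f x))"
proof -
  have "continuous_on UNIV cayley"
    using has_derivative_cayley by (auto simp: continuous_on_eq_continuous_within intro: has_derivative_continuous)
  then show ?thesis
    using assms by (rule continuous_on_compose2) auto
qed

lemma continuous_on_skew_matrix:
  assumes "continuous_on S f"
  shows "continuous_on S (\<lambda>x. skew_matrix (f x))"
  using linear_skew_matrix by (intro continuous_on_compose2[OF linear_continuous_on assms, of _ UNIV])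
    (simp_all add: linear_conv_bounded_linear)

lemma continuous_on_matrix_mul:
  fixes f :: "'a::topological_space \<Rightarrow> real^'n^'m" and g :: "'a \<Rightarrow> real^'k^'n"
  assumes "continuous_on S f" "continuous_on S g"
  shows "continuous_on S (\<lambda>x. f x ** g x)"
  unfolding matrix_matrix_mult_def by (intro continuous_intros assms)

lemma continuous_on_essential_chart:
  assumes "continuous_on S f" "continuous_on S g"
  shows "continuous_on S (\<lambda>x. essential_chart (f x) (g x))"
  unfolding essential_chart_def
  by (intro continuous_on_matrix_mul continuous_on_skew_matrix continuous_on_cayley assms)

lemma continuous_on_essential_velocity:
  fixes f g :: "'a::t2_space \<Rightarrow> real^3"
  assumes f: "continuous_on S f" and g: "continuous_on S g"
  shows "continuous_on S (\<lambda>x. essential_velocity (f x) (g x) h)"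
proof -
  have "1 + g x \<bullet> g x \<noteq> 0" for x
    using one_plus_inner_pos[of "g x"] by simp
  then have "continuous_on S (\<lambda>x. cayley_velocity (g x) (snd h))"
    unfolding cayley_velocity_def
    by (intro continuous_intros continuous_on_cross g) auto
  then show ?thesis
    unfolding essential_velocity_def
    by (intro continuous_on_matrix_mul continuous_on_skew_matrix continuous_on_cayley continuous_on_add
        continuous_on_const f g)
qed

text \<open>An isometric parametrisation of the tangent space of the essential cone at nonzero
  multiples of \<open>skew_matrix (axis 1 1)\<close>: matrices whose lower right block is a scaled
  plane rotation and whose upper left entry is 0. The factors \<open>1 / sqrt 2\<close> normalise
  coordinates that occupy two entries.\<close>

definition frame :: "(real^3) \<times> (real^3) \<Rightarrow> real^3^3" where
  "frame x = vector
     [vector [0, - fst x $ 3, fst x $ 2],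
      vector [snd x $ 2, - snd x $ 1 / sqrt 2, - fst x $ 1 / sqrt 2],
      vector [snd x $ 3, fst x $ 1 / sqrt 2, - snd x $ 1 / sqrt 2]]"

lemma linear_frame: "linear frame"
  by (rule linearI) (simp_all add: frame_def vec_eq_iff forall_3 add_divide_distrib diff_divide_distrib)

lemma inner_frame: "frame x \<bullet> frame y = x \<bullet> y"
  by (cases x, cases y) (simp add: frame_def inner_vec_def sum_3 inner_prod_def)

text \<open>The \<open>frame\<close> coordinates of the tangent vector with translational velocity
  \<tau> and angular velocity \<omega> at the base point of length s, written as a diagonal map
  followed by a shear so that the Jacobian can be read off.\<close>

definition stretch :: "real \<Rightarrow> (real^3) \<times> (real^3) \<Rightarrow> (real^3) \<times> (real^3)" where
  "stretch s = (\<lambda>(x, y). (x, y + vector [0, x $ 3, - x $ 2])) \<circ>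
     map_prod (\<lambda>x. vector [sqrt 2 * x $ 1, x $ 2, x $ 3])
       (\<lambda>y. vector [sqrt 2 * s * y $ 1, s * y $ 2, s * y $ 3])"

lemma linear_map_prod: "linear f \<Longrightarrow> linear g \<Longrightarrow> linear (map_prod f g)"
  unfolding linear_iff by auto

text \<open>The diagonal entries contribute \<open>sqrt 2\<close> from the translation and
  \<open>sqrt 2 * s ^ 3\<close> from the rotation; the shear contributes 1.\<close>

lemma jac_stretch:
  assumes s: "s \<ge> 0"
  shows "jac (stretch s) = 2 * s ^ 3" "linear (stretch s)"
proof -
  let ?h = "\<lambda>x :: real^3. vector [0, x $ 3, - x $ 2] :: real^3"
  let ?f = "\<lambda>x :: real^3. vector [sqrt 2 * x $ 1, x $ 2, x $ 3] :: real^3"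
  let ?g = "\<lambda>y :: real^3. vector [sqrt 2 * s * y $ 1, s * y $ 2, s * y $ 3] :: real^3"
  have h: "linear ?h" and f: "linear ?f" and g: "linear ?g"
    by (rule linearI; simp add: vec_eq_iff forall_3 algebra_simps)+
  have sh: "linear (\<lambda>(x, y). (x, y + ?h x))"
    by (rule linearI) (auto simp: vec_eq_iff forall_3 algebra_simps)
  have jf: "jac ?f = sqrt 2"
    unfolding jac_det[OF f] by (simp add: matrix_def det_3 axis_def)
  have jg: "jac ?g = sqrt 2 * s ^ 3"
    unfolding jac_det[OF g] using s
    by (simp add: matrix_def det_3 axis_def abs_mult power3_eq_cube)
  have "jac (stretch s) = jac (\<lambda>(x, y). (x, y + ?h x)) * jac (map_prod ?f ?g)"
    unfolding stretch_def
    by (rule jac_compose[where 'n=6]) (simp_all add: sh linear_map_prod f g)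
  also have "\<dots> = 2 * s ^ 3"
    by (simp add: jac_shear[OF h] jac_map_prod[OF f g] jf jg)
  finally show "jac (stretch s) = 2 * s ^ 3" .
  show "linear (stretch s)"
    unfolding stretch_def by (intro linear_compose linear_map_prod f g sh)
qed

lemma stretch_frame:
  "skew_matrix \<tau> + s *\<^sub>R (skew_matrix (axis 1 1) ** skew_matrix \<omega>) = frame (stretch s (\<tau>, \<omega>))"
  by (simp add: stretch_def frame_def vec_eq_iff forall_3 matrix_matrix_mult_def sum_3
      skew_matrix_entries axis_def)

text \<open>The inner product of matrices is the sum over columns and also the sum over rows; left
  multiplication rotates every column, right multiplication every row.\<close>

lemma orthogonal_transformation_matrix_mul:
  fixes Q :: "real^3^3"
  assumes "rotation_matrix Q"
  shows "orthogonal_transformation (\<lambda>M :: real^3^3. Q ** M)" "orthogonal_transformation (\<lambda>M :: real^3^3. M ** Q)"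
proof -
  have inner: "A \<bullet> B = (\<Sum>j\<in>UNIV. column j A \<bullet> column j B)" "A \<bullet> B = (\<Sum>i\<in>UNIV. row i A \<bullet> row i B)"
    for A B :: "real^3^3"
    by (simp_all add: inner_vec_def column_def row_def sum_3)
  have col: "column j (Q ** M) = Q *v column j M" for j and M :: "real^3^3"
    by (simp add: column_def vec_eq_iff matrix_matrix_mult_def matrix_vector_mult_def)
  have row: "row i (M ** Q) = transpose Q *v row i M" for i and M :: "real^3^3"
    by (simp add: row_def vec_eq_iff matrix_matrix_mult_def matrix_vector_mult_def transpose_def mult.commute
        del: transpose_matrix_vector)
  show "orthogonal_transformation (\<lambda>M :: real^3^3. Q ** M)"
    unfolding orthogonal_transformation_def
  proof (intro conjI allI)
    show "linear (\<lambda>M :: real^3^3. Q ** M)"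
      by (rule linearI) (simp_all add: matrix_add_ldistrib matrix_scalar_ac scalar_matrix_assoc)
    show "(Q ** A) \<bullet> (Q ** B) = A \<bullet> B" for A B :: "real^3^3"
    proof -
      have "(Q ** A) \<bullet> (Q ** B) = (\<Sum>j\<in>UNIV. column j (Q ** A) \<bullet> column j (Q ** B))"
        by (rule inner(1))
      also have "\<dots> = (\<Sum>j\<in>UNIV. column j A \<bullet> column j B)"
        by (simp only: col inner_rotate[OF assms])
      also have "\<dots> = A \<bullet> B" by (rule inner(1)[symmetric])
      finally show ?thesis .
    qed
  qed
  show "orthogonal_transformation (\<lambda>M :: real^3^3. M ** Q)"
    unfolding orthogonal_transformation_def
  proof (intro conjI allI)
    show "linear (\<lambda>M :: real^3^3. M ** Q)"
      by (rule linearI) (simp_all add: matrix_add_mul matrix_scalar_ac scalar_matrix_assoc)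
    show "(A ** Q) \<bullet> (B ** Q) = A \<bullet> B" for A B :: "real^3^3"
    proof -
      have "(A ** Q) \<bullet> (B ** Q) = (\<Sum>j\<in>UNIV. row j (A ** Q) \<bullet> row j (B ** Q))"
        by (rule inner(2))
      also have "\<dots> = (\<Sum>j\<in>UNIV. row j A \<bullet> row j B)"
        by (simp only: row inner_rotate[OF rotation_matrix_transpose[OF assms]])
      also have "\<dots> = A \<bullet> B" by (rule inner(2)[symmetric])
      finally show ?thesis .
    qed
  qed
qed

text \<open>The map sending h to \<open>h + cross3 a h\<close> has determinant
  \<open>1 + a \<bullet> a\<close>, and the scalar in front enters with its cube.\<close>

lemma jac_cayley_velocity: "jac (cayley_velocity a) = 8 / (1 + (norm a)\<^sup>2)\<^sup>2"
proof -
  let ?s = "1 + a \<bullet> a" and ?A = "matrix (cayley_velocity a)" and ?B = "matrix (\<lambda>h. h + cross3 a h)"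
  have s: "?s > 0" by (rule one_plus_inner_pos)
  have "det ?B = ?s"
    by (simp add: det_3 matrix_def axis_def cross3_def inner_vec_def sum_3)
  moreover have "det ?A = (2 / ?s) ^ 3 * det ?B"
  proof -
    have "?A = (2 / ?s) *\<^sub>R ?B"
      by (simp add: matrix_def vec_eq_iff cayley_velocity_def)
    moreover have "det (c *\<^sub>R B) = c ^ 3 * det B" for c and B :: "real^3^3"
      by (simp add: det_3 power3_eq_cube algebra_simps)
    ultimately show ?thesis by (simp only:)
  qed
  ultimately have "det ?A = (2 / ?s) ^ 3 * ?s" by simp
  also have "\<dots> = 8 / ?s\<^sup>2"
  proof -
    have "(2 / x) ^ 3 * x = 8 / x\<^sup>2" if "x \<noteq> 0" for x :: real
      using that by (simp add: power_divide power3_eq_cube power2_eq_square)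
    then show ?thesis using s by simp
  qed
  finally have "jac (cayley_velocity a) = 8 / ?s\<^sup>2"
    unfolding jac_det[OF linear_cayley_velocity] by simp
  then show ?thesis by (simp add: power2_norm_eq_inner)
qed

text \<open>Rotating the coordinates so that \<open>t\<close> points along the first axis brings every tangent space
  to the six-dimensional range of \<open>frame\<close>.\<close>

lemma essential_frame:
  obtains V S where "orthogonal_transformation V" "linear S"
    "jac S = 2 * norm t ^ 3 * (8 / (1 + (norm a)\<^sup>2)\<^sup>2)"
    "essential_chart t a = V (frame (axis 1 (sqrt 2 * norm t), 0))" 
    "\<forall>h. essential_velocity t a h = V (frame (S h))"
proof -
  obtain Q where Q: "rotation_matrix Q" "Q *v axis 1 (norm t) = t"
  proof (cases "t = 0")
    case True
    have "rotation_matrix (mat 1 :: real^3^3)"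
      by (simp add: rotation_matrix_def orthogonal_matrix_id)
    with True that[of "mat 1"] show ?thesis by (simp add: axis_eq_0_iff)
  next
    case False
    obtain Q where Q: "rotation_matrix Q" "Q *v axis 1 1 = t /\<^sub>R norm t"
      by (rule rotation_matrix_exists_basis[where a="t /\<^sub>R norm t" and k=1]) (use False in auto)
    have "axis 1 (norm t) = norm t *\<^sub>R (axis 1 1 :: real^3)"
      by (simp add: vec_eq_iff axis_def)
    then have "Q *v axis 1 (norm t) = t"
      using Q False by (simp add: matrix_vector_mult_scaleR)
    with Q that show ?thesis by blast
  qed
  let ?s = "norm t" and ?C = "cayley a"
  \<comment> \<open>Conjugation by Q turns the first axis back to the direction of t, and the right
    factor restores the rotation of the chart.\<close>
  define V where "V M = Q ** M ** (transpose Q ** ?C)" for M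
  \<comment> \<open>Both velocities are expressed in the coordinates in which t points along the
    first axis.\<close>
  define S where "S = stretch ?s \<circ> map_prod ((*v) (transpose Q)) ((*v) (transpose Q) \<circ> cayley_velocity a)"
  have QT: "rotation_matrix (transpose Q)"
    by (rule rotation_matrix_transpose[OF Q(1)])
  have V: "orthogonal_transformation V"
    using orthogonal_transformation_compose[OF
        orthogonal_transformation_matrix_mul(2)[OF rotation_matrix_mul[OF QT rotation_matrix_cayley[of a]]]
        orthogonal_transformation_matrix_mul(1)[OF Q(1)]]
    by (simp add: V_def[abs_def] o_def)
  have lQ: "linear ((*v) (transpose Q))"
    by (rule matrix_vector_mul_linear)
  have lQv: "linear ((*v) (transpose Q) \<circ> cayley_velocity a)"
    by (intro linear_compose linear_cayley_velocity lQ)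
  have lS: "linear S"
    unfolding S_def by (intro linear_compose[OF linear_map_prod] jac_stretch lQ lQv) simp
  have jQ: "jac ((*v) (transpose Q)) = 1"
    using QT by (simp only: jac_det[OF lQ] matrix_of_matrix_vector_mul) (simp add: rotation_matrix_def)
  have "jac S = jac (stretch ?s) * jac (map_prod ((*v) (transpose Q)) ((*v) (transpose Q) \<circ> cayley_velocity a))"
    unfolding S_def
    by (rule jac_compose[where 'n=6]) (simp_all add: jac_stretch linear_map_prod lQ lQv del: transpose_matrix_vector)
  also have "jac (map_prod ((*v) (transpose Q)) ((*v) (transpose Q) \<circ> cayley_velocity a)) =
      jac ((*v) (transpose Q)) * jac ((*v) (transpose Q) \<circ> cayley_velocity a)"
    by (rule jac_map_prod[OF lQ lQv])
  also have "jac ((*v) (transpose Q) \<circ> cayley_velocity a) = jac ((*v) (transpose Q)) * jac (cayley_velocity a)"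
    by (rule jac_compose[where 'n=3]) (simp_all only: DIM_cart DIM_real lQ linear_cayley_velocity card_num1 mult_1_right)
  finally have jS: "jac S = 2 * norm t ^ 3 * (8 / (1 + (norm a)\<^sup>2)\<^sup>2)"
    by (simp only: jQ jac_cayley_velocity jac_stretch(1)[OF norm_ge_zero] mult_1_left)
  have skew: "skew_matrix v = Q ** skew_matrix (transpose Q *v v) ** transpose Q" for v
    using skew_matrix_rotate[OF Q(1), of "transpose Q *v v"]
    by (simp only: rotation_matrix_mult_cancel[OF Q(1)])
  have skewt: "skew_matrix t = Q ** skew_matrix (axis 1 ?s) ** transpose Q"
    using skew_matrix_rotate[OF Q(1), of "axis 1 ?s"] by (simp only: Q(2))
  have chart: "essential_chart t a = V (frame (axis 1 (sqrt 2 * ?s), 0))"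
  proof -
    \<comment> \<open>As on every cone, the base point lies in its own tangent space, so value and
      derivative are both described by \<open>frame\<close>.\<close>
    have "frame (axis 1 (sqrt 2 * ?s), 0) = skew_matrix (axis 1 ?s)"
      by (simp add: frame_def skew_matrix_entries vec_eq_iff forall_3 axis_def)
    then show ?thesis
      by (simp only: essential_chart_def V_def skewt matrix_mul_assoc)
  qed
  have vel: "essential_velocity t a h = V (frame (S h))" for h
  proof -
    let ?\<tau> = "transpose Q *v fst h" and ?\<omega> = "transpose Q *v cayley_velocity a (snd h)"
    have Sh: "S h = stretch ?s (?\<tau>, ?\<omega>)"
      by (simp add: S_def map_prod_def split_beta del: transpose_matrix_vector)
    have e: "skew_matrix (axis 1 ?s) = ?s *\<^sub>R skew_matrix (axis 1 1)"
      by (simp add: skew_matrix_entries vec_eq_iff forall_3 axis_def)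
    have core: "frame (S h) = skew_matrix ?\<tau> + skew_matrix (axis 1 ?s) ** skew_matrix ?\<omega>"
      unfolding Sh stretch_frame[symmetric] e
      by (simp only: scalar_matrix_assoc)
    have "skew_matrix t ** skew_matrix (cayley_velocity a (snd h)) =
        Q ** skew_matrix (axis 1 ?s) ** (transpose Q ** Q) ** skew_matrix ?\<omega> ** transpose Q"
      unfolding skewt skew[of "cayley_velocity a (snd h)"] by (simp only: matrix_mul_assoc)
    also have "\<dots> = Q ** (skew_matrix (axis 1 ?s) ** skew_matrix ?\<omega>) ** transpose Q"
      unfolding rotation_matrix_cancel[OF Q(1)] by (simp only: matrix_mul_assoc matrix_mul_rid)
    finally have "skew_matrix (fst h) + skew_matrix t ** skew_matrix (cayley_velocity a (snd h)) =
        Q ** frame (S h) ** transpose Q"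
      unfolding core skew[of "fst h"] by (simp only: matrix_add_ldistrib matrix_add_mul)
    then show ?thesis
      by (simp only: essential_velocity_def V_def matrix_mul_assoc)
  qed
  show ?thesis
    by (rule that[OF V lS jS chart allI[OF vel]])
qed

section \<open>Measurability on the Grassmannian\<close>

lemma num_points_two_to_one:
  assumes fibre: "\<And>y. y \<in> Y \<Longrightarrow> card {x \<in> X. g x = y} = 2" and gX: "g ` X \<subseteq> Y"
  shows "num_points X = 2 * num_points Y"
proof (cases "finite Y")
  case True
  have fin: "finite {x \<in> X. g x = y}" if "y \<in> Y" for y
    using fibre[OF that] by (intro card_ge_0_finite) simp
  have X: "X = (\<Union>y\<in>Y. {x \<in> X. g x = y})"
    using gX by auto
  have "finite (\<Union>y\<in>Y. {x \<in> X. g x = y})"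
    using True fin by (intro finite_UN_I)
  then have "finite X" using X by simp
  have "card (\<Union>y\<in>Y. {x \<in> X. g x = y}) = (\<Sum>y\<in>Y. card {x \<in> X. g x = y})"
    using True fin by (intro card_UN_disjoint) auto
  also have "\<dots> = 2 * card Y" by (simp add: fibre)
  finally have "card X = 2 * card Y" using X by simp
  then show ?thesis
    using True \<open>finite X\<close> by (simp add: of_nat_mult)
next
  case False
  have "Y \<subseteq> g ` X"
  proof
    fix y assume "y \<in> Y"
    then have "{x \<in> X. g x = y} \<noteq> {}" using fibre[of y] by force
    then show "y \<in> g ` X" by blast
  qed
  with False have "infinite X" using finite_surj by blast
  with False show ?thesis by (simp add: ennreal_mult_top)
qed

lemma span_singleton_eqD:
  assumes "span {x} = span {y :: 'a::real_vector}"
  obtains c where "x = c *\<^sub>R y"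
proof -
  have "x \<in> span {y}" using assms span_base[of x "{x}"] by simp
  then show ?thesis using that by (auto simp: span_singleton)
qed

lemma span_singleton_scaleR:
  assumes "c \<noteq> 0"
  shows "span {c *\<^sub>R x} = span {x :: 'a::real_vector}"
proof
  show "span {c *\<^sub>R x} \<subseteq> span {x}"
    by (rule span_minimal) (auto intro: span_scale span_base)
  have "x = (1 / c) *\<^sub>R (c *\<^sub>R x)" using assms by simp
  then have "x \<in> span {c *\<^sub>R x}" by (metis insertI1 span_base span_scale)
  then show "span {x} \<subseteq> span {c *\<^sub>R x}" by (intro span_minimal) auto
qed

lemma span_in_projectivization_iff:
  assumes V: "subspace V" and x: "x \<noteq> 0"
  shows "span {x} \<in> projectivization V \<longleftrightarrow> x \<in> V"
proof
  assume "span {x} \<in> projectivization V"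
  then obtain y where "y \<in> V" "span {x} = span {y}"
    by (auto simp: projectivization_def)
  then show "x \<in> V"
    using V by (metis span_singleton_eqD subspace_scale)
qed (use x in \<open>auto simp: projectivization_def\<close>)

lemma essential_matrices_scaleR:
  assumes "x \<in> essential_matrices"
  shows "c *\<^sub>R x \<in> essential_matrices"
proof -
  obtain R t where "rotation_matrix R" "x = skew_matrix t ** R"
    using assms by (auto simp: essential_matrices_def)
  moreover have "c *\<^sub>R (skew_matrix t ** R) = skew_matrix (c *\<^sub>R t) ** R" for R
    by (simp add: linear_scale[OF linear_skew_matrix] scalar_matrix_assoc)
  ultimately show ?thesis
    by (auto simp: essential_matrices_def)
qed

lemma half_turn_cone_scaleR:
  assumes "x \<in> half_turn_cone"
  shows "c *\<^sub>R x \<in> half_turn_cone"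
proof -
  obtain v t where "norm v = 1" "x = skew_matrix t ** half_turn v"
    using assms by (auto simp: half_turn_cone_def)
  moreover have "c *\<^sub>R (skew_matrix t ** R) = skew_matrix (c *\<^sub>R t) ** R" for R
    by (simp add: linear_scale[OF linear_skew_matrix] scalar_matrix_assoc)
  ultimately show ?thesis
    by (auto simp: half_turn_cone_def)
qed

lemma norm_skew_mult_rotation:
  assumes "rotation_matrix R"
  shows "norm (skew_matrix t ** R) = sqrt 2 * norm t"
proof -
  have "norm (skew_matrix t ** R) = norm (skew_matrix t)"
    using orthogonal_transformation_matrix_mul(2)[OF assms] by (rule orthogonal_transformation_norm)
  also have "\<dots> = sqrt (2 * (t \<bullet> t))"
    by (simp add: norm_eq_sqrt_inner inner_vec_def sum_3 skew_matrix_entries)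
  finally show ?thesis by (simp add: real_sqrt_mult norm_eq_sqrt_inner)
qed

lemma compact_rotation_matrices: "compact {R :: real^3^3. rotation_matrix R}"
proof -
  have "bounded {R :: real^3^3. rotation_matrix R}"
    unfolding bounded_iff
  proof (intro exI ballI)
    fix R :: "real^3^3" assume "R \<in> {R. rotation_matrix R}"
    then have "norm (R ** mat 1) = norm (mat 1 :: real^3^3)"
      using orthogonal_transformation_matrix_mul(1)[of R] by (intro orthogonal_transformation_norm) auto
    then show "norm R \<le> norm (mat 1 :: real^3^3)" by simp
  qed
  moreover have "closed {R :: real^3^3. rotation_matrix R}"
  proof -
    have c: "continuous_on UNIV (\<lambda>R :: real^3^3. transpose R ** R)"
      by (intro continuous_on_matrix_mul continuous_on_id) (simp add: transpose_def, intro continuous_intros)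
    have d: "continuous_on UNIV (\<lambda>R :: real^3^3. det R)"
      unfolding det_def by (intro continuous_intros)
    have "{R :: real^3^3. rotation_matrix R} = {R. transpose R ** R = mat 1} \<inter> {R. det R = 1}"
      by (auto simp: rotation_matrix_def orthogonal_matrix)
    then show ?thesis
      by (simp add: closed_Int closed_Collect_eq c d)
  qed
  ultimately show ?thesis by (simp add: compact_eq_bounded_closed)
qed

text \<open>Unit norm of \<open>skew_matrix t ** R\<close> means that t has norm
  \<open>1 / sqrt 2\<close>, so this set is the image of a sphere times the rotation group, both
  compact.\<close>

lemma compact_essential_sphere: "compact (essential_matrices \<inter> sphere 0 1)"
proof -
  have "essential_matrices \<inter> sphere 0 1 =
      (\<lambda>p. skew_matrix (fst p) ** snd p) ` (sphere 0 (1 / sqrt 2) \<times> {R. rotation_matrix R})"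
  proof (intro set_eqI iffI)
    fix x assume x: "x \<in> essential_matrices \<inter> sphere 0 1"
    then obtain R t where R: "rotation_matrix R" "x = skew_matrix t ** R"
      by (auto simp: essential_matrices_def)
    then have "norm t = 1 / sqrt 2"
      using x by (simp add: norm_skew_mult_rotation field_simps)
    then show "x \<in> (\<lambda>p. skew_matrix (fst p) ** snd p) ` (sphere 0 (1 / sqrt 2) \<times> {R. rotation_matrix R})"
      using R by (intro image_eqI[of _ _ "(t, R)"]) auto
  next
    fix x assume "x \<in> (\<lambda>p. skew_matrix (fst p) ** snd p) ` (sphere 0 (1 / sqrt 2) \<times> {R. rotation_matrix R})"
    then obtain t R where "norm t = 1 / sqrt 2" "rotation_matrix R" "x = skew_matrix t ** R"
      by auto
    then show "x \<in> essential_matrices \<inter> sphere 0 1"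
      by (auto simp: essential_matrices_def norm_skew_mult_rotation)
  qed
  moreover have "compact ((\<lambda>p. skew_matrix (fst p) ** snd p) ` (sphere 0 (1 / sqrt 2) \<times> {R. rotation_matrix R}))"
    by (intro compact_continuous_image compact_Times compact_sphere compact_rotation_matrices
        continuous_on_matrix_mul continuous_on_skew_matrix continuous_intros)
  ultimately show ?thesis by simp
qed

lemma continuous_on_half_turn: "continuous_on S half_turn"
  unfolding half_turn_def outer_square_def by (intro continuous_intros)

lemma compact_half_turn_sphere: "compact (half_turn_cone \<inter> sphere 0 1)"
proof -
  have "half_turn_cone \<inter> sphere 0 1 =
      (\<lambda>p. skew_matrix (fst p) ** half_turn (snd p)) ` (sphere 0 (1 / sqrt 2) \<times> sphere 0 1)"
  proof (intro set_eqI iffI)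
    fix x assume x: "x \<in> half_turn_cone \<inter> sphere 0 1"
    then obtain v t where v: "norm v = 1" "x = skew_matrix t ** half_turn v"
      by (auto simp: half_turn_cone_def)
    then have "norm t = 1 / sqrt 2"
      using x by (simp add: norm_skew_mult_rotation rotation_matrix_half_turn field_simps)
    then show "x \<in> (\<lambda>p. skew_matrix (fst p) ** half_turn (snd p)) ` (sphere 0 (1 / sqrt 2) \<times> sphere 0 1)"
      using v by (intro image_eqI[of _ _ "(t, v)"]) auto
  next
    fix x assume "x \<in> (\<lambda>p. skew_matrix (fst p) ** half_turn (snd p)) ` (sphere 0 (1 / sqrt 2) \<times> sphere 0 1)"
    then obtain t v where "norm t = 1 / sqrt 2" "norm v = 1" "x = skew_matrix t ** half_turn v"
      by auto
    then show "x \<in> half_turn_cone \<inter> sphere 0 1"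
      by (auto simp: half_turn_cone_def norm_skew_mult_rotation rotation_matrix_half_turn)
  qed
  moreover have "compact ((\<lambda>p. skew_matrix (fst p) ** half_turn (snd p)) ` (sphere 0 (1 / sqrt 2) \<times> sphere 0 1))"
    by (intro compact_continuous_image compact_Times compact_sphere
        continuous_on_matrix_mul continuous_on_skew_matrix continuous_intros
        continuous_on_compose2[OF continuous_on_half_turn[of UNIV]]) auto
  ultimately show ?thesis by simp
qed

lemma continuous_on_transpose: "continuous_on S (transpose :: real^'n^'m \<Rightarrow> real^'m^'n)"
  unfolding transpose_def by (intro continuous_intros)

lemma compact_orthogonal_group: "compact (orthogonal_group :: (real^'n^'n) set)"
proof -
  have "bounded (orthogonal_group :: (real^'n^'n) set)"
    unfolding bounded_iff
  proof (intro exI ballI)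
    fix U :: "real^'n^'n" assume "U \<in> orthogonal_group"
    then have "row i U \<bullet> row i U = 1" for i
      by (simp add: orthogonal_group_def orthogonal_matrix_orthonormal_rows norm_eq_1)
    then have "U \<bullet> U = real CARD('n)"
      by (simp add: inner_vec_def[of U U] row_def)
    then show "norm U \<le> sqrt (real CARD('n))"
      by (simp add: norm_eq_sqrt_inner)
  qed
  moreover have "closed (orthogonal_group :: (real^'n^'n) set)"
  proof -
    have "continuous_on UNIV (\<lambda>R :: real^'n^'n. transpose R ** R)"
      by (intro continuous_on_matrix_mul continuous_on_id continuous_on_transpose)
    then show ?thesis
      unfolding orthogonal_group_def orthogonal_matrix by (intro closed_Collect_eq) auto
  qed
  ultimately show ?thesis by (simp add: compact_eq_bounded_closed)
qed

text \<open>The projection to the first factor of an incidence set that is closed in a compact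
  product.\<close>

lemma closed_orthogonal_hits:
  fixes K W :: "(real^'n^'m) set"
  assumes K: "compact K" and W: "closed W"
  shows "closed {U \<in> orthogonal_group. \<exists>x\<in>K. act (transpose U) x \<in> W}"
proof -
  let ?P = "(orthogonal_group \<times> K) \<inter> (\<lambda>p. act (transpose (fst p)) (snd p)) -` W"
  have "closed ((\<lambda>p :: (real^('m \<times> 'n)^('m \<times> 'n)) \<times> (real^'n^'m). act (transpose (fst p)) (snd p)) -` W)"
    by (intro closed_vimage W continuous_on_act continuous_intros
        continuous_on_compose2[OF continuous_on_transpose[of UNIV]]) auto
  then have "compact ?P"
    by (intro compact_Int_closed compact_Times compact_orthogonal_group K)
  then have "compact (fst ` ?P)"
    by (intro compact_continuous_image continuous_on_fst continuous_on_id)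
  moreover have "fst ` ?P = {U \<in> orthogonal_group. \<exists>x\<in>K. act (transpose U) x \<in> W}"
    by force
  ultimately show ?thesis by (simp add: compact_imp_closed)
qed

lemma act_image_iff:
  assumes "U \<in> orthogonal_group"
  shows "x \<in> act U ` W \<longleftrightarrow> act (transpose U) x \<in> W"
  using act_transpose_cancel[OF assms] by (metis imageE imageI)

lemma subspace_act_image: "subspace W \<Longrightarrow> subspace (act U ` W)"
  by (rule linear_subspace_image[OF linear_act])

lemma Collect_eq_Diff_Bex:
  assumes "\<And>U. U \<in> G \<Longrightarrow> P U \<longleftrightarrow> (\<forall>x\<in>K. \<not> Q U x)"
  shows "{U \<in> G. P U} = G - {U \<in> G. \<exists>x\<in>K. Q U x}"
  using assms by auto

lemma Collect_meets_eq_Diff: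
  "{L \<in> G. {x \<in> S. P x L} \<inter> K \<noteq> {}} = G - {L \<in> G. \<forall>x\<in>S \<inter> K. \<not> P x L}"
  by auto

text \<open>Each projective point is replaced by its two unit vectors, so that the counting takes
  place in a Euclidean space and the result is halved. The subspaces that avoid a given compact set
  of unit vectors have open preimages under all orbit maps and are thus among the generators of the
  sigma-algebra.\<close>

lemma borel_measurable_num_points_essential:
  "(\<lambda>L. num_points (essential_variety \<inter> L)) \<in> borel_measurable (grassmannian_borel k)"
proof -
  let ?S = "essential_matrices \<inter> sphere 0 1"
  define C where "C L = {x \<in> ?S. span {x} \<in> L}" for L :: "(real^3^3) set set"
  have two: "num_points (C L) = 2 * num_points (essential_variety \<inter> L)" for L
  proof (rule num_points_two_to_one)
    show "(\<lambda>x. span {x}) ` C L \<subseteq> essential_variety \<inter> L"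
    proof (rule image_subsetI)
      fix x assume "x \<in> C L"
      then have x: "x \<in> essential_matrices" "norm x = 1" "span {x} \<in> L"
        by (simp_all add: C_def)
      have "x \<noteq> 0" using x(2) by auto
      with x(1) have "x \<in> essential_matrices - {0}" by simp
      then have "span {x} \<in> essential_variety"
        unfolding essential_variety_def projectivization_def by (rule imageI)
      with x(3) show "span {x} \<in> essential_variety \<inter> L" by simp
    qed
    fix l assume l: "l \<in> essential_variety \<inter> L"
    then obtain y where y: "y \<in> essential_matrices" "y \<noteq> 0" "l = span {y}"
      by (auto simp: essential_variety_def projectivization_def)
    let ?u = "y /\<^sub>R norm y"
    have u: "norm ?u = 1" "?u \<in> essential_matrices" "- ?u \<in> essential_matrices"
      using y essential_matrices_scaleR[OF y(1), of "1 / norm y"] essential_matrices_scaleR[OF y(1), of "- 1 / norm y"]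
      by (simp_all add: inverse_eq_divide)
    have su: "span {?u} = l" "span {- ?u} = l"
      using y span_singleton_scaleR[of "inverse (norm y)" y] span_singleton_scaleR[of "- inverse (norm y)" y]
      by simp_all
    have "{x \<in> C L. span {x} = l} = {?u, - ?u}"
    proof (intro set_eqI iffI)
      fix x assume x: "x \<in> {x \<in> C L. span {x} = l}"
      then have n: "norm x = 1" "span {x} = span {?u}"
        using su by (simp_all add: C_def)
      from n(2) obtain c where c: "x = c *\<^sub>R ?u" by (rule span_singleton_eqD)
      have "norm x = \<bar>c\<bar> * norm ?u" unfolding c by (rule norm_scaleR)
      then have "\<bar>c\<bar> = 1" using n(1) u(1) by simp
      then have "c = 1 \<or> c = -1" by linarith
      then show "x \<in> {?u, - ?u}" using c by auto
    next
      fix x assume "x \<in> {?u, - ?u}"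
      then show "x \<in> {x \<in> C L. span {x} = l}"
        using u su l by (auto simp: C_def)
    qed
    moreover have "?u \<noteq> - ?u"
    proof
      assume "?u = - ?u"
      then have "?u + ?u = 0" using add.right_inverse[of ?u] by simp
      then have "2 *\<^sub>R ?u = 0" by (simp only: scaleR_2)
      then show False using u(1) by simp
    qed
    ultimately show "card {x \<in> C L. span {x} = l} = 2" by simp
  qed
  have "(\<lambda>L. num_points (C L)) \<in> borel_measurable (grassmannian_borel k)"
  proof (rule borel_measurable_num_points)
    fix K :: "(real^3^3) set" assume K: "compact K"
    let ?K = "?S \<inter> K" and ?G = "grassmannian k :: (real^3^3) set set set"
    let ?A = "{L \<in> ?G. \<forall>x\<in>?K. span {x} \<notin> L}"
    have cK: "compact ?K"
      using compact_essential_sphere K by (rule compact_Int)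
    have gen: "?A \<in> {A. A \<subseteq> ?G \<and> (\<forall>L0\<in>?G.
        openin (top_of_set orthogonal_group) {U \<in> orthogonal_group. act_subspace U L0 \<in> A})}"
    proof (intro CollectI conjI ballI)
      fix L0 assume L0: "L0 \<in> ?G"
      then obtain W where W: "L0 = projectivization W" "subspace W"
        by (auto simp: grassmannian_def)
      let ?H = "{U \<in> orthogonal_group. \<exists>x\<in>?K. act (transpose U) x \<in> W}"
      have "{U \<in> orthogonal_group. act_subspace U L0 \<in> ?A} = orthogonal_group - ?H"
      proof -
        have "act_subspace U L0 \<in> ?A \<longleftrightarrow> (\<forall>x\<in>?K. act (transpose U) x \<notin> W)"
          if U: "U \<in> orthogonal_group" for U
        proof -
          have "span {x} \<in> act_subspace U L0 \<longleftrightarrow> act (transpose U) x \<in> W" if "x \<in> ?K" for x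
          proof -
            have "x \<noteq> 0" using that by auto
            show ?thesis
              unfolding W(1) act_projectivization[OF U]
                span_in_projectivization_iff[OF subspace_act_image[OF W(2)] \<open>x \<noteq> 0\<close>]
              by (rule act_image_iff[OF U])
          qed
          then have "(\<forall>x\<in>?K. span {x} \<notin> act_subspace U L0) \<longleftrightarrow> (\<forall>x\<in>?K. act (transpose U) x \<notin> W)"
            by (intro ball_cong refl) simp
          with act_subspace_in_grassmannian[OF U L0] show ?thesis
            by (simp only: mem_Collect_eq simp_thms)
        qed
        then show ?thesis by (rule Collect_eq_Diff_Bex)
      qed
      moreover have "closed ?H"
        by (intro closed_orthogonal_hits cK closed_subspace W)
      then have "openin (top_of_set orthogonal_group) (orthogonal_group - ?H)"
        unfolding Diff_eq by (intro openin_open_Int open_Compl)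
      ultimately show "openin (top_of_set orthogonal_group) {U \<in> orthogonal_group. act_subspace U L0 \<in> ?A}"
        by simp
    qed auto
    have sub: "{A. A \<subseteq> ?G \<and> (\<forall>L0\<in>?G.
        openin (top_of_set orthogonal_group) {U \<in> orthogonal_group. act_subspace U L0 \<in> A})} \<subseteq> Pow ?G"
      by blast
    have sets: "?A \<in> sets (grassmannian_borel k)"
      unfolding grassmannian_borel_def using sub gen by (rule in_measure_of)
    have space: "space (grassmannian_borel k) = ?G"
      unfolding grassmannian_borel_def using sub by (rule space_measure_of)
    have "{L \<in> space (grassmannian_borel k). C L \<inter> K \<noteq> {}} = space (grassmannian_borel k) - ?A"
      unfolding space C_def by (rule Collect_meets_eq_Diff)
    then show "{L \<in> space (grassmannian_borel k). C L \<inter> K \<noteq> {}} \<in> sets (grassmannian_borel k)"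
      using sets by auto
  qed
  then have "(\<lambda>L. num_points (C L) / 2) \<in> borel_measurable (grassmannian_borel k)"
    by measurable
  moreover have "num_points (C L) / 2 = num_points (essential_variety \<inter> L)" for L
    unfolding two by (subst mult.commute) (rule ennreal_mult_divide_eq, simp_all)
  ultimately show ?thesis by simp
qed

section \<open>Generic subspaces avoid small cones\<close>

lemma borel_measurable_pair_haar:
  fixes \<mu> :: "(real^'n^'n) measure" and g :: "(real^'n^'n) \<times> 'b::euclidean_space \<Rightarrow> 'c::topological_space"
  assumes haar: "normalized_haar \<mu>" and g: "g \<in> borel_measurable borel"
  shows "g \<in> borel_measurable (\<mu> \<Otimes>\<^sub>M lborel)"
proof -
  have "fst \<in> borel_measurable (\<mu> \<Otimes>\<^sub>M (lborel :: 'b measure))"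
    using measurable_compose[OF measurable_fst measurable_haar_ident[OF haar]] .
  moreover have "snd \<in> borel_measurable (\<mu> \<Otimes>\<^sub>M (lborel :: 'b measure))"
    using measurable_snd[of \<mu> "lborel :: 'b measure"] by simp
  ultimately have "(\<lambda>x. (fst x, snd x)) \<in> borel_measurable (\<mu> \<Otimes>\<^sub>M (lborel :: 'b measure))"
    by (rule borel_measurable_Pair)
  from measurable_compose[OF this g] show ?thesis by simp
qed

lemma closed_subset_sets_haar:
  assumes haar: "normalized_haar \<mu>" and "closed H" "H \<subseteq> orthogonal_group"
  shows "H \<in> sets \<mu>"
proof -
  have "H = orthogonal_group \<inter> H" using assms(3) by blast
  then show ?thesis
    using assms(2) by (auto simp: sets_haar[OF haar] sets_restrict_space)
qed

text \<open>The event that K meets the translate of W by U, since U is orthogonal and its transpose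
  is its inverse.\<close>

definition hits :: "(real^'n^'m) set \<Rightarrow> (real^'n^'m) set \<Rightarrow> (real^('m \<times> 'n)^('m \<times> 'n)) set" where
  "hits K W = {U \<in> orthogonal_group. \<exists>x\<in>K. act (transpose U) x \<in> W}"

lemma sets_hits:
  fixes K W :: "(real^'n::finite^'m::finite) set"
  assumes "normalized_haar \<mu>" "compact K" "subspace W"
  shows "hits K W \<in> sets \<mu>"
  unfolding hits_def
  using assms by (intro closed_subset_sets_haar closed_orthogonal_hits closed_subspace) auto

text \<open>Some orthogonal V maps \<open>W1\<close> onto \<open>W2\<close>, and right translation
  by V exchanges the two events.\<close>

lemma emeasure_hits_eq:
  fixes K W1 W2 :: "(real^'n::finite^'m::finite) set"
  assumes haar: "normalized_haar \<mu>" and K: "compact K"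
    and W: "subspace W1" "subspace W2" "dim W1 = dim W2"
  shows "emeasure \<mu> (hits K W1) = emeasure \<mu> (hits K W2)"
proof -
  obtain f where f: "orthogonal_transformation f" "f ` W1 = W2"
    by (rule orthogonal_transformation_subspaces[OF W])
  obtain V where V: "V \<in> orthogonal_group" "act V = f"
    by (rule orthogonal_transformation_eq_act[OF f(1)])
  have iff: "U ** V \<in> hits K W1 \<longleftrightarrow> U \<in> hits K W2" if U: "U \<in> orthogonal_group" for U
  proof -
    have "act (transpose (U ** V)) x \<in> W1 \<longleftrightarrow> act (transpose U) x \<in> W2" for x
      using act_image_iff[OF V(1), of "act (transpose U) x" W1] V(2) f(2)
      by (simp add: matrix_transpose_mul act_matrix_mul)
    then show ?thesis
      using U orthogonal_group_mul[OF U V(1)] by (simp add: hits_def)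
  qed
  have "emeasure \<mu> (hits K W1) = (\<integral>\<^sup>+U. indicator (hits K W1) U \<partial>\<mu>)"
    using sets_hits[OF haar K W(1)] by simp
  also have "\<dots> = (\<integral>\<^sup>+U. indicator (hits K W1) (U ** V) \<partial>\<mu>)"
    using sets_hits[OF haar K W(1)] by (intro nn_integral_haar_right[OF haar _ V(1), symmetric]) simp
  also have "\<dots> = (\<integral>\<^sup>+U. indicator (hits K W2) U \<partial>\<mu>)"
    by (intro nn_integral_cong) (simp add: space_haar[OF haar] iff indicator_def)
  also have "\<dots> = emeasure \<mu> (hits K W2)"
    using sets_hits[OF haar K W(2)] by simp
  finally show ?thesis .
qed

text \<open>Contains every z whose insertion into W can cause a hit that W alone does not have:
  solving the membership in \<open>span (insert z W)\<close> for z gives an element of this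
  form.\<close>

definition sweep :: "(real^'n^'m) set \<Rightarrow> (real^'n^'m) set \<Rightarrow> real^('m \<times> 'n)^('m \<times> 'n) \<Rightarrow> (real^'n^'m) set" where
  "sweep K W U = {c *\<^sub>R act (transpose U) x + w | c x w. x \<in> K \<and> w \<in> W}"

text \<open>Bounding c and w by n exhibits the set as a countable union of continuous images of
  compact sets.\<close>

lemma borel_sweep:
  fixes K W :: "(real^'n::finite^'m::finite) set"
  assumes K: "compact K" and W: "closed W"
  shows "{(U, z). U \<in> orthogonal_group \<and> z \<in> sweep K W U} \<in> sets borel"
proof -
  let ?f = "\<lambda>(U :: real^('m \<times> 'n)^('m \<times> 'n), c :: real, x :: real^'n^'m, w). (U, c *\<^sub>R act (transpose U) x + w)"
  let ?P = "\<lambda>n::nat. orthogonal_group \<times> {- real n..real n} \<times> K \<times> (W \<inter> cball 0 (real n))"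
  have "compact (?f ` ?P n)" for n
  proof (rule compact_continuous_image)
    show "continuous_on (?P n) ?f"
      unfolding case_prod_beta'
      by (intro continuous_intros continuous_on_compose2[OF continuous_on_transpose[of UNIV]]) auto
    show "compact (?P n)"
      by (intro compact_Times compact_orthogonal_group compact_Icc K closed_Int_compact W compact_cball)
  qed
  then have "(\<Union>n. ?f ` ?P n) \<in> sets borel"
    by (intro sets.countable_UN) (auto simp: borel_compact)
  moreover have "{(U, z). U \<in> orthogonal_group \<and> z \<in> sweep K W U} = (\<Union>n. ?f ` ?P n)"
  proof (intro set_eqI iffI)
    fix q assume "q \<in> {(U, z). U \<in> orthogonal_group \<and> z \<in> sweep K W U}"
    then obtain U c x w where q: "q = (U, c *\<^sub>R act (transpose U) x + w)"
      "U \<in> orthogonal_group" "x \<in> K" "w \<in> W"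
      by (auto simp: sweep_def)
    obtain n :: nat where "max \<bar>c\<bar> (norm w) \<le> real n"
      using real_arch_simple by blast
    then have "(U, c, x, w) \<in> ?P n" using q by auto
    moreover have "q = ?f (U, c, x, w)" using q by simp
    ultimately show "q \<in> (\<Union>n. ?f ` ?P n)" by blast
  next
    fix q assume "q \<in> (\<Union>n. ?f ` ?P n)"
    then show "q \<in> {(U, z). U \<in> orthogonal_group \<and> z \<in> sweep K W U}"
      by (auto simp: sweep_def)
  qed
  ultimately show ?thesis by simp
qed

lemma negligible_imp_lborel_null:
  fixes A :: "'a::euclidean_space set"
  assumes "negligible A" "A \<in> sets borel"
  shows "emeasure lborel A = 0"
  using assms by (simp add: negligible_iff_null_sets null_sets_completion_iff) (simp add: null_setsD1)

text \<open>A subspace of the form \<open>span (insert z W)\<close> can only be hit if \<open>W\<close> is hit or \<open>z\<close> lies in a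
  null set; as the probability of being hit depends on the dimension only, induction applies.\<close>

lemma emeasure_hits_eq_0:
  fixes K W :: "(real^'n::finite^'m::finite) set"
  assumes haar: "normalized_haar \<mu>" and K: "compact K" "0 \<notin> K"
    and neg: "\<And>W' U. subspace W' \<Longrightarrow> dim W' < N \<Longrightarrow> U \<in> orthogonal_group \<Longrightarrow> negligible (sweep K W' U)"
    and W: "subspace W" "dim W \<le> N"
  shows "emeasure \<mu> (hits K W) = 0"
  using W
proof (induction "dim W" arbitrary: W)
  case 0
  then have "W \<subseteq> {0}" by (metis dim_eq_0)
  have "hits K W = {}"
  proof (rule ccontr)
    assume "hits K W \<noteq> {}"
    then obtain U x where U: "U \<in> orthogonal_group" "x \<in> K" "act (transpose U) x \<in> W"
      by (auto simp: hits_def)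
    then have "act (transpose U) x = 0" using \<open>W \<subseteq> {0}\<close> by blast
    then have "x = act U 0" using act_transpose_cancel(2)[OF U(1), of x] by simp
    then show False using linear_0[OF linear_act, of U] U(2) K(2) by simp
  qed
  then show ?case by simp
next
  case (Suc n)
  interpret prob_space \<mu> by (rule prob_space_haar[OF haar])
  interpret pair_sigma_finite \<mu> "lborel :: (real^'n^'m) measure" ..
  obtain W' :: "(real^'n^'m) set" where W': "subspace W'" "dim W' = n"
    using choose_subspace_of_subspace[of n W] Suc.hyps(2) by auto
  have W'0: "emeasure \<mu> (hits K W') = 0"
    using Suc.hyps(1)[of W'] W' Suc.hyps(2) Suc.prems by simp
  let ?S = "{(U, z). U \<in> orthogonal_group \<and> z \<in> sweep K W' U}"
  have "(indicator ?S :: _ \<Rightarrow> real) \<in> borel_measurable (\<mu> \<Otimes>\<^sub>M lborel)"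
    using borel_sweep[OF K(1) closed_subspace[OF W'(1)]]
    by (intro borel_measurable_pair_haar[OF haar]) simp
  then have "?S \<inter> space (\<mu> \<Otimes>\<^sub>M lborel) \<in> sets (\<mu> \<Otimes>\<^sub>M lborel)"
    by (simp only: borel_measurable_indicator_iff)
  moreover have "?S \<inter> space (\<mu> \<Otimes>\<^sub>M lborel) = ?S"
    by (auto simp: space_pair_measure space_haar[OF haar])
  ultimately have S: "?S \<in> sets (\<mu> \<Otimes>\<^sub>M lborel)" by (simp only:)
  have "emeasure (\<mu> \<Otimes>\<^sub>M lborel) ?S = (\<integral>\<^sup>+U. emeasure lborel (Pair U -` ?S) \<partial>\<mu>)"
    by (rule lborel.emeasure_pair_measure_alt[OF S])
  also have "\<dots> = (\<integral>\<^sup>+U. 0 \<partial>\<mu>)"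
  proof (rule nn_integral_cong)
    fix U assume "U \<in> space \<mu>"
    then have U: "U \<in> orthogonal_group" by (simp add: space_haar[OF haar])
    then have "Pair U -` ?S = sweep K W' U" by auto
    moreover have "Pair U -` ?S \<in> sets borel"
      using sets_Pair1[OF S] by simp
    moreover have "negligible (sweep K W' U)"
      using W' Suc U by (intro neg) auto
    ultimately show "emeasure lborel (Pair U -` ?S) = 0"
      by (simp add: negligible_imp_lborel_null)
  qed
  \<comment> \<open>Fubini reverses the quantifiers: for every U almost no z is bad, so for almost
    every z almost no U is bad.\<close>
  finally have "(\<integral>\<^sup>+z. emeasure \<mu> ((\<lambda>U. (U, z)) -` ?S) \<partial>lborel) = 0"
    using emeasure_pair_measure_alt2[OF S] by simp
  then have "AE z in lborel. emeasure \<mu> ((\<lambda>U. (U, z)) -` ?S) = 0"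
    using nn_integral_0_iff_AE[OF measurable_emeasure_Pair2[OF S]] by simp
  moreover have "AE z in lborel. z \<notin> W'"
  proof -
    have "dim W' < DIM(real^'n^'m)"
      using dim_subset_UNIV[of W] Suc.hyps(2) W'(2) by simp
    then have "negligible W'" by (rule negligible_lowdim)
    then have "emeasure lborel W' = 0"
      using closed_subspace[OF W'(1)] by (intro negligible_imp_lborel_null) auto
    then show ?thesis
      using closed_subspace[OF W'(1)] by (intro AE_not_in) (auto simp: null_sets_def)
  qed
  ultimately have "AE z in lborel. emeasure \<mu> ((\<lambda>U. (U, z)) -` ?S) = 0 \<and> z \<notin> W'"
    by eventually_elim simp
  moreover have "ae_filter (lborel :: (real^'n^'m) measure) \<noteq> bot"
    by (simp add: ae_filter_eq_bot_iff)
  ultimately have "\<exists>z. emeasure \<mu> ((\<lambda>U. (U, z)) -` ?S) = 0 \<and> z \<notin> W'"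
    by (intro eventually_happens')
  then obtain z where z: "emeasure \<mu> ((\<lambda>U. (U, z)) -` ?S) = 0" "z \<notin> W'"
    by (elim exE conjE)
  let ?V = "span (insert z W')"
  have "dim ?V = Suc n"
    using z(2) W' by (simp add: dim_insert span_eq_iff[THEN iffD2])
  then have "emeasure \<mu> (hits K W) = emeasure \<mu> (hits K ?V)"
    using Suc by (intro emeasure_hits_eq[OF haar K(1)]) auto
  also have "\<dots> \<le> emeasure \<mu> (hits K W' \<union> (\<lambda>U. (U, z)) -` ?S)"
  proof (rule emeasure_mono)
    show "hits K W' \<union> (\<lambda>U. (U, z)) -` ?S \<in> sets \<mu>"
      using sets_Pair2[OF S] sets_hits[OF haar K(1) W'(1)] by simp
    show "hits K ?V \<subseteq> hits K W' \<union> (\<lambda>U. (U, z)) -` ?S"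
    proof
      fix U assume "U \<in> hits K ?V"
      then obtain x where x: "U \<in> orthogonal_group" "x \<in> K" "act (transpose U) x \<in> ?V"
        by (auto simp: hits_def)
      then obtain c where c: "act (transpose U) x - c *\<^sub>R z \<in> W'"
        using W'(1) by (auto simp: span_breakdown_eq span_eq_iff[THEN iffD2])
      show "U \<in> hits K W' \<union> (\<lambda>U. (U, z)) -` ?S"
      proof (cases "c = 0")
        case True
        then have "U \<in> hits K W'" using c x by (auto simp: hits_def)
        then show ?thesis by simp
      next
        case False
        let ?w = "act (transpose U) x - c *\<^sub>R z"
        have "z = (1 / c) *\<^sub>R act (transpose U) x + (- 1 / c) *\<^sub>R ?w"
          using False by (simp add: scaleR_diff_right)
        moreover have "(- 1 / c) *\<^sub>R ?w \<in> W'"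
          using c by (rule subspace_scale[OF W'(1)])
        ultimately have "z \<in> sweep K W' U"
          unfolding sweep_def using x(2) by blast
        then show ?thesis using x(1) by simp
      qed
    qed
  qed
  also have "\<dots> \<le> emeasure \<mu> (hits K W') + emeasure \<mu> ((\<lambda>U. (U, z)) -` ?S)"
    using sets_Pair2[OF S] sets_hits[OF haar K(1) W'(1)] by (intro emeasure_subadditive) auto
  finally show ?case using W'0 z(1) by simp
qed

text \<open>W embeds isometrically into T, and a linear left inverse of the embedding maps T onto a
  set containing W. In this way sums with W become images of maps on a Euclidean space.\<close>

lemma subspace_linear_cover:
  fixes W :: "'a::euclidean_space set" and T :: "'b::euclidean_space set"
  assumes W: "subspace W" and T: "subspace T" and dim: "dim W \<le> dim T"
  obtains j where "linear j" "W \<subseteq> j ` T"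
proof -
  obtain f :: "'a \<Rightarrow> 'b" where f: "linear f" "f ` W \<subseteq> T" "\<And>x. x \<in> W \<Longrightarrow> norm (f x) = norm x"
    by (rule isometry_subset_subspace[OF W T dim]) (rule that; auto)
  have "inj_on f W"
  proof (rule inj_onI)
    fix x y assume xy: "x \<in> W" "y \<in> W" "f x = f y"
    then have "norm (f (x - y)) = norm (x - y)"
      using W by (intro f subspace_diff)
    then show "x = y" using xy by (simp add: linear_diff[OF f(1)])
  qed
  moreover have spanW: "span W = W" using W by (simp add: span_eq_iff)
  ultimately have "inj_on f (span W)" by (simp only:)
  from linear_inj_on_left_inverse[OF f(1) this] obtain g where "linear g" "\<forall>x\<in>span W. g (f x) = x"
    by (elim exE conjE)
  then have g: "linear g" "\<And>x. x \<in> W \<Longrightarrow> g (f x) = x"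
    unfolding spanW by simp_all
  have "W \<subseteq> g ` T"
  proof
    fix x assume "x \<in> W"
    then have "f x \<in> T" "x = g (f x)" using f(2) g(2)[of x] by auto
    then show "x \<in> g ` T" by (rule image_eqI[rotated])
  qed
  with g(1) that show ?thesis by blast
qed

lemma negligible_Times:
  fixes A :: "'a::euclidean_space set" and B :: "'b::euclidean_space set"
  assumes "closed A" "closed B" "negligible A \<or> negligible B"
  shows "negligible (A \<times> B)"
proof -
  have "emeasure lborel (A \<times> B) = emeasure lborel A * emeasure lborel B"
    using assms by (simp add: lborel_prod[symmetric] lborel.emeasure_pair_measure_Times)
  moreover have "emeasure lborel A = 0 \<or> emeasure lborel B = 0"
    using assms negligible_imp_lborel_null by (metis borel_closed)
  moreover have "A \<times> B \<in> sets borel"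
    using assms by (intro borel_closed closed_Times)
  ultimately have "A \<times> B \<in> null_sets lborel"
    by (auto simp: null_sets_def)
  then show ?thesis
    by (simp add: negligible_iff_null_sets null_sets_completionI)
qed

text \<open>The set lies in the image of a null subset of a nine-dimensional space under a
  differentiable map into a nine-dimensional space, and such maps preserve null sets.\<close>

lemma negligible_sum_image:
  fixes h :: "(real^3) \<times> (real^3) \<Rightarrow> real^3^3" and L :: "real^3^3 \<Rightarrow> real^3^3"
    and T :: "(real^3) set" and W :: "(real^3^3) set"
  assumes h: "\<And>p. h differentiable (at p)" and L: "linear L" and W: "subspace W" and T: "subspace T"
    and dim: "dim W \<le> dim T" and neg: "negligible (P \<times> T)"
  shows "negligible {L (h p) + w | p w. p \<in> P \<and> w \<in> W}"
proof -
  obtain j where j: "linear j" "W \<subseteq> j ` T"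
    by (rule subspace_linear_cover[OF W T dim])
  let ?g = "\<lambda>q. L (h (fst q)) + j (snd q)"
  have "negligible (?g ` (P \<times> T))"
  proof (rule negligible_differentiable_image_negligible[OF _ neg])
    have "?g differentiable (at q)" for q
    proof (rule differentiable_add)
      obtain h' where "(h has_derivative h') (at (fst q))"
        using h[of "fst q"] by (auto simp: differentiable_def)
      from has_derivative_compose[OF has_derivative_fst[OF has_derivative_ident] this]
      have "((\<lambda>q. L (h (fst q))) has_derivative (\<lambda>v. L (h' (fst v)))) (at q)"
        using L by (intro bounded_linear.has_derivative[of L])
          (auto simp: linear_conv_bounded_linear)
      then show "(\<lambda>q. L (h (fst q))) differentiable (at q)"
        by (auto simp: differentiable_def)
      have "((\<lambda>q. j (snd q)) has_derivative (\<lambda>v. j (snd v))) (at q)"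
        using j(1) by (intro bounded_linear.has_derivative[of j] has_derivative_snd has_derivative_ident)
          (auto simp: linear_conv_bounded_linear)
      then show "(\<lambda>q. j (snd q)) differentiable (at q)"
        by (auto simp: differentiable_def)
    qed
    then show "?g differentiable_on (P \<times> T)"
      by (intro differentiable_at_imp_differentiable_on) auto
  qed simp
  moreover have "{L (h p) + w | p w. p \<in> P \<and> w \<in> W} \<subseteq> ?g ` (P \<times> T)"
    using j(2) by force
  ultimately show ?thesis by (rule negligible_subset)
qed

text \<open>The deficit lies in W: having dimension at most 2, it is covered by a plane, and planes
  are null in \<open>real^3\<close>.\<close>

lemma negligible_sum_image_UNIV:
  fixes h :: "(real^3) \<times> (real^3) \<Rightarrow> real^3^3" and L :: "real^3^3 \<Rightarrow> real^3^3"
    and W :: "(real^3^3) set"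
  assumes h: "\<And>p. h differentiable (at p)" and L: "linear L" and W: "subspace W" "dim W < 3"
  shows "negligible {L (h p) + w | p w. w \<in> W}"
proof -
  let ?a = "axis 1 1 :: real^3"
  let ?T = "{v :: real^3. ?a \<bullet> v = 0}"
  have a: "?a \<noteq> 0" by (simp add: axis_eq_0_iff)
  have "negligible ((UNIV :: ((real^3) \<times> (real^3)) set) \<times> ?T)"
    using a by (intro negligible_Times closed_hyperplane) (simp_all add: negligible_hyperplane)
  moreover have "dim W \<le> dim ?T"
    using dim_hyperplane[OF a] W(2) by simp
  ultimately have "negligible {L (h p) + w | p w. p \<in> UNIV \<and> w \<in> W}"
    using subspace_hyperplane[of ?a] by (intro negligible_sum_image h L W) auto
  then show ?thesis by simp
qed

lemma negligible_sweep_image: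
  fixes K :: "(real^3^3) set" and h :: "(real^3) \<times> (real^3) \<Rightarrow> real^3^3"
  assumes K: "\<And>c x. x \<in> K \<Longrightarrow> c *\<^sub>R x \<in> h ` P"
    and neg: "negligible {act (transpose U) (h p) + w | p w. p \<in> P \<and> w \<in> W}"
  shows "negligible (sweep K W U)"
proof (rule negligible_subset[OF neg], rule subsetI)
  fix z assume "z \<in> sweep K W U"
  then obtain c x w where z: "z = c *\<^sub>R act (transpose U) x + w" "x \<in> K" "w \<in> W"
    by (auto simp: sweep_def)
  obtain p where p: "p \<in> P" "c *\<^sub>R x = h p"
    using K[OF z(2), of c] by auto
  have "c *\<^sub>R act (transpose U) x = act (transpose U) (h p)"
    using linear_scale[OF linear_act, of "transpose U" c x] p(2) by simp
  then have "z = act (transpose U) (h p) + w" using z(1) by simp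
  then show "z \<in> {act (transpose U) (h p) + w | p w. p \<in> P \<and> w \<in> W}"
    using z(3) p(1) by (intro CollectI exI conjI)
qed

text \<open>The deficit lies in the parameters: the axes range over the unit sphere, which is null
  in \<open>real^3\<close>, so W may have dimension 3 here.\<close>

lemma negligible_sweep_half_turn:
  assumes W: "subspace W" "dim W \<le> 3"
  shows "negligible (sweep (half_turn_cone \<inter> sphere 0 1) W U)"
proof (rule negligible_sweep_image)
  let ?h = "\<lambda>p :: (real^3) \<times> (real^3). skew_matrix (fst p) ** half_turn (snd p)"
  let ?P = "(UNIV :: (real^3) set) \<times> sphere (0 :: real^3) 1"
  show "c *\<^sub>R x \<in> ?h ` ?P" if "x \<in> half_turn_cone \<inter> sphere 0 1" for c x
  proof -
    have "c *\<^sub>R x \<in> half_turn_cone" using that half_turn_cone_scaleR by blast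
    then obtain t v where "norm v = 1" "c *\<^sub>R x = skew_matrix t ** half_turn v"
      by (auto simp: half_turn_cone_def)
    then show ?thesis by (intro image_eqI[of _ _ "(t, v)"]) auto
  qed
  show "negligible {act (transpose U) (?h p) + w | p w. p \<in> ?P \<and> w \<in> W}"
  proof (rule negligible_sum_image[OF _ linear_act W(1) subspace_UNIV])
    show "dim W \<le> dim (UNIV :: (real^3) set)" using W(2) by simp
    have "negligible ?P"
      by (rule negligible_Times) (simp_all add: negligible_sphere)
    then show "negligible (?P \<times> (UNIV :: (real^3) set))"
      by (intro negligible_Times closed_Times) simp_all
    fix p :: "(real^3) \<times> (real^3)"
    have 1: "((\<lambda>p :: (real^3) \<times> (real^3). skew_matrix (fst p)) has_derivative (\<lambda>h. skew_matrix (fst h))) (at p)"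
      by (intro has_derivative_skew_matrix has_derivative_fst has_derivative_ident)
    have "(half_turn has_derivative (\<lambda>h. 2 *\<^sub>R (\<chi> i j. a $ i * h $ j + h $ i * a $ j))) (at a)" for a
    proof (rule has_derivative_matrix_componentwise)
      fix i j :: 3
      have nth: "((\<lambda>x. x $ k) has_derivative (\<lambda>h. h $ k)) (at a)" for k :: 3
        by (intro bounded_linear_imp_has_derivative bounded_linear_vec_nth)
      have "((\<lambda>x. 2 * (x $ i * x $ j) - mat 1 $ i $ j) has_derivative
          (\<lambda>h. 2 * (a $ i * h $ j + h $ i * a $ j) - 0)) (at a)"
        by (intro has_derivative_diff has_derivative_const has_derivative_mult_right has_derivative_mult nth)
      then show "((\<lambda>x. half_turn x $ i $ j) has_derivative
          (\<lambda>h. (2 *\<^sub>R (\<chi> i j. a $ i * h $ j + h $ i * a $ j)) $ i $ j)) (at a)"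
        by (simp add: half_turn_def outer_square_def)
    qed
    from has_derivative_matrix_mul[OF 1 has_derivative_compose[OF has_derivative_snd[OF has_derivative_ident] this]]
    show "?h differentiable (at p)"
      by (rule differentiableI)
  qed
qed

lemma negligible_sweep_essential:
  assumes W: "subspace W" "dim W < 3"
  shows "negligible (sweep (essential_matrices \<inter> sphere 0 1) W U)"
proof -
  let ?h = "\<lambda>p :: (real^3) \<times> (real^3). essential_chart (fst p) (snd p)"
  \<comment> \<open>A sweep contains all multiples of its vectors, so the whole line through x has
    to lie in the range of the chart.\<close>
  define K1 where "K1 = {x. \<forall>c. c *\<^sub>R x \<in> range ?h}"
  have 1: "negligible (sweep K1 W U)"
  proof (rule negligible_sweep_image[where P=UNIV])
    show "negligible {act (transpose U) (?h p) + w | p w. p \<in> UNIV \<and> w \<in> W}"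
      using negligible_sum_image_UNIV[OF _ linear_act W, of ?h]
        differentiableI[OF has_derivative_essential_chart] by (simp only: UNIV_I simp_thms)
    show "c *\<^sub>R x \<in> range ?h" if "x \<in> K1" for c x
      using that unfolding K1_def by blast
  qed
  have 2: "negligible (sweep (half_turn_cone \<inter> sphere 0 1) W U)"
    using W by (intro negligible_sweep_half_turn) auto
  have "sweep (essential_matrices \<inter> sphere 0 1) W U \<subseteq> sweep K1 W U \<union> sweep (half_turn_cone \<inter> sphere 0 1) W U"
  proof
    fix z assume "z \<in> sweep (essential_matrices \<inter> sphere 0 1) W U"
    then obtain c x w where z: "z = c *\<^sub>R act (transpose U) x + w" "x \<in> essential_matrices \<inter> sphere 0 1" "w \<in> W"
      by (auto simp: sweep_def)
    show "z \<in> sweep K1 W U \<union> sweep (half_turn_cone \<inter> sphere 0 1) W U"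
    proof (cases "x \<in> half_turn_cone")
      case True
      then have "x \<in> half_turn_cone \<inter> sphere 0 1" using z(2) by blast
      then have "z \<in> sweep (half_turn_cone \<inter> sphere 0 1) W U"
        unfolding sweep_def using z(1,3) by (intro CollectI exI conjI)
      then show ?thesis by simp
    next
      case False
      then obtain t a where x: "x = essential_chart t a"
        using z(2) by (auto simp: essential_matrices_eq)
      have "c *\<^sub>R x = ?h (c *\<^sub>R t, a)" for c
        by (simp add: x essential_chart_def linear_scale[OF linear_skew_matrix] scalar_matrix_assoc)
      then have "x \<in> K1" unfolding K1_def by blast
      then have "z \<in> sweep K1 W U"
        unfolding sweep_def using z(1,3) by (intro CollectI exI conjI)
      then show ?thesis by simp
    qed
  qed
  with negligible_Un[OF 1 2] show ?thesis by (rule negligible_subset)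
qed

lemma negligible_sweep_frame:
  assumes W: "subspace W" "dim W < 3"
  shows "negligible (sweep (range frame \<inter> sphere 0 1) W U)"
proof (rule negligible_sweep_image[where P=UNIV])
  show "c *\<^sub>R x \<in> range frame" if "x \<in> range frame \<inter> sphere 0 1" for c x
  proof -
    from that obtain p where "x = frame p" by blast
    then have "c *\<^sub>R x = frame (c *\<^sub>R p)" by (simp add: linear_scale[OF linear_frame])
    then show ?thesis by simp
  qed
  show "negligible {act (transpose U) (frame p) + w | p w. p \<in> UNIV \<and> w \<in> W}"
    using negligible_sum_image_UNIV[OF linear_imp_differentiable[OF linear_frame] linear_act W]
    by (simp only: UNIV_I simp_thms)
qed

text \<open>Generic position in terms of codimension. Among 3-by-3 matrices it serves with
  \<open>N = 3\<close> for six-dimensional cones and with \<open>N = 4\<close> for the smaller cone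
  of half turns.\<close>

lemma AE_avoid:
  fixes K W :: "(real^'n::finite^'m::finite) set"
  assumes haar: "normalized_haar \<mu>" and K: "compact K" "0 \<notin> K" and W: "subspace W" "dim W \<le> N"
    and neg: "\<And>W' U. subspace W' \<Longrightarrow> dim W' < N \<Longrightarrow> negligible (sweep K W' U)"
  shows "AE U in \<mu>. \<forall>x\<in>K. act (transpose U) x \<notin> W"
proof -
  have "hits K W \<in> null_sets \<mu>"
    using emeasure_hits_eq_0[OF haar K neg W] sets_hits[OF haar K(1) W(1)] by (simp add: null_sets_def)
  then have "AE U in \<mu>. U \<notin> hits K W" by (rule AE_not_in)
  then show ?thesis
    by (rule AE_mp) (auto intro!: AE_I2 simp: hits_def space_haar[OF haar])
qed

text \<open>A concrete choice of the fixed subspace W, given with a linear parametrisation by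
  \<open>real^3\<close>; any injective linear map would serve.\<close>

definition first_row :: "real^3 \<Rightarrow> real^3^3" where
  "first_row w = (\<chi> i j. if i = 1 then w $ j else 0)"

lemma linear_first_row: "linear first_row"
  by (rule linearI) (simp_all add: first_row_def vec_eq_iff)

lemma inj_first_row: "inj first_row"
proof (rule injI)
  fix x y assume "first_row x = first_row y"
  then have "first_row x $ 1 $ j = first_row y $ 1 $ j" for j by simp
  then show "x = y" by (simp add: first_row_def vec_eq_iff)
qed

lemma subspace_range_first_row: "subspace (range first_row)"
  by (rule linear_subspace_image[OF linear_first_row subspace_UNIV])

lemma dim_range_first_row: "dim (range first_row) = 3"
  using dim_image_eq[OF linear_first_row, of UNIV] inj_first_row by simp

text \<open>The matrices y with \<open>z - ?A y\<close> in W form an affine slice of the cone. They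
  correspond one-to-one to projective points: two proportional solutions would force z into W, and a
  point without a representative in the slice would be one excluded by E. By H none of them is a
  half-turn matrix, so the chart covers each exactly twice.\<close>

lemma num_points_chart:
  assumes U: "U \<in> orthogonal_group" and z: "z \<notin> range first_row"
    and E: "\<forall>x\<in>essential_matrices \<inter> sphere 0 1. act (transpose U) x \<notin> range first_row"
    and H: "\<forall>x\<in>half_turn_cone \<inter> sphere 0 1. act (transpose U) x \<notin> span (insert z (range first_row))"
  shows "num_points {q. act (transpose U) (essential_chart (fst (fst q)) (snd (fst q))) + first_row (snd q) = z} =
    2 * num_points (essential_variety \<inter> act_subspace U (projectivization (span (insert z (range first_row)))))"
    (is "num_points ?X = 2 * num_points ?L")
proof -
  let ?V = "span (insert z (range first_row))" and ?A = "act (transpose U)"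
  let ?Y = "{y \<in> essential_matrices. z - ?A y \<in> range first_row}"
  let ?g = "\<lambda>q :: ((real^3) \<times> (real^3)) \<times> (real^3). essential_chart (fst (fst q)) (snd (fst q))"
  have lin: "linear ?A" by (rule linear_act)
  have rowV: "w \<in> ?V" if "w \<in> range first_row" for w
    using that span_base[of w "insert z (range first_row)"] by simp
  have AV: "?A y \<in> ?V" if "y \<in> ?Y" for y
  proof -
    have "z - (z - ?A y) \<in> ?V"
      using that rowV by (intro span_diff span_base) auto
    then show ?thesis by simp
  qed
  have nz: "y \<noteq> 0" if "y \<in> ?Y" for y
    using that z linear_0[OF lin] by auto
  have nh: "y \<notin> half_turn_cone" if y: "y \<in> ?Y" for y
  proof
    assume "y \<in> half_turn_cone"
    then have "(1 / norm y) *\<^sub>R y \<in> half_turn_cone \<inter> sphere 0 1"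
      using nz[OF y] half_turn_cone_scaleR by simp
    then have "?A ((1 / norm y) *\<^sub>R y) \<notin> ?V" using H by blast
    then show False
      using AV[OF y] by (simp add: linear_scale[OF lin] span_scale)
  qed
  have "num_points ?X = 2 * num_points ?Y"
  proof (rule num_points_two_to_one[where g="?g"])
    show "?g ` ?X \<subseteq> ?Y"
    proof (rule image_subsetI)
      fix q assume "q \<in> ?X"
      then have "z - ?A (?g q) = first_row (snd q)" by (auto simp: algebra_simps)
      then have "z - ?A (?g q) \<in> range first_row" by simp
      moreover have "?g q \<in> essential_matrices"
        by (auto simp: essential_matrices_eq)
      ultimately show "?g q \<in> ?Y" by blast
    qed
    fix y assume y: "y \<in> ?Y"
    then obtain w where w: "z - ?A y = first_row w" by auto
    have "{q \<in> ?X. ?g q = y} = (\<lambda>p. (p, w)) ` {p. essential_chart (fst p) (snd p) = y}"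
    proof (intro set_eqI iffI)
      fix q assume "q \<in> {q \<in> ?X. ?g q = y}"
      then have q: "?g q = y" "?A y + first_row (snd q) = z" by auto
      then have "first_row (snd q) = first_row w" using w by (simp add: algebra_simps)
      then have "snd q = w" using injD[OF inj_first_row] by blast
      with q show "q \<in> (\<lambda>p. (p, w)) ` {p. essential_chart (fst p) (snd p) = y}"
        by (intro image_eqI[of _ _ "fst q"]) auto
    next
      fix q assume "q \<in> (\<lambda>p. (p, w)) ` {p. essential_chart (fst p) (snd p) = y}"
      then show "q \<in> {q \<in> ?X. ?g q = y}"
        using w by (auto simp: algebra_simps)
    qed
    then have "card {q \<in> ?X. ?g q = y} = card {p. essential_chart (fst p) (snd p) = y}"
      by (simp add: card_image inj_on_def)
    also have "{p. essential_chart (fst p) (snd p) = y} = {(t, a). essential_chart t a = y}"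
      by auto
    also have "card \<dots> = 2"
      using y nz[OF y] nh[OF y] by (intro essential_chart_two_to_one) auto
    finally show "card {q \<in> ?X. ?g q = y} = 2" .
  qed
  also have "num_points ?Y = num_points ((\<lambda>y. span {y}) ` ?Y)"
  proof (rule num_points_image[symmetric], rule inj_onI)
    fix y y' assume y: "y \<in> ?Y" "y' \<in> ?Y" "span {y} = span {y'}"
    obtain c where c: "y = c *\<^sub>R y'" by (rule span_singleton_eqD[OF y(3)])
    have r: "z - ?A y \<in> range first_row" "z - ?A y' \<in> range first_row"
      using y by simp_all
    have "(z - ?A y) - c *\<^sub>R (z - ?A y') \<in> range first_row"
      by (rule subspace_diff[OF subspace_range_first_row r(1) subspace_scale[OF subspace_range_first_row r(2)]])
    also have "(z - ?A y) - c *\<^sub>R (z - ?A y') = (1 - c) *\<^sub>R z"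
      by (simp add: c linear_scale[OF lin] algebra_simps)
    finally have *: "(1 - c) *\<^sub>R z \<in> range first_row" .
    have "c = 1"
    proof (rule ccontr)
      assume "c \<noteq> 1"
      then have "(1 / (1 - c)) *\<^sub>R ((1 - c) *\<^sub>R z) = z" by simp
      with subspace_scale[OF subspace_range_first_row *, of "1 / (1 - c)"] z show False by simp
    qed
    then show "y = y'" using c by simp
  qed
  also have "(\<lambda>y. span {y}) ` ?Y = ?L"
  proof (intro set_eqI iffI)
    have iff: "span {y} \<in> act_subspace U (projectivization ?V) \<longleftrightarrow> ?A y \<in> ?V" if "y \<noteq> 0" for y
      unfolding act_projectivization[OF U]
        span_in_projectivization_iff[OF subspace_act_image[OF subspace_span] that]
      by (rule act_image_iff[OF U])
    {
      fix l assume "l \<in> (\<lambda>y. span {y}) ` ?Y"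
      then obtain y where y: "l = span {y}" "y \<in> ?Y" by (rule imageE)
      then have "l \<in> essential_variety"
        using nz[OF y(2)] by (auto simp: essential_variety_def projectivization_def)
      moreover have "l \<in> act_subspace U (projectivization ?V)"
        unfolding y(1) iff[OF nz[OF y(2)]] by (rule AV[OF y(2)])
      ultimately show "l \<in> ?L" by simp
    next
      fix l assume l: "l \<in> ?L"
      then obtain x where x: "l = span {x}" "x \<in> essential_matrices" "x \<noteq> 0"
        by (auto simp: essential_variety_def projectivization_def)
      then have "?A x \<in> ?V" using l iff[of x] by simp
      then obtain c where c: "?A x - c *\<^sub>R z \<in> range first_row"
        using subspace_range_first_row by (auto simp: span_breakdown_eq span_eq_iff[THEN iffD2])
      \<comment> \<open>A vanishing coefficient would make x a point at infinity of the slice, which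
        E rules out.\<close>
      have "c \<noteq> 0"
      proof
        assume "c = 0"
        then have "?A ((1 / norm x) *\<^sub>R x) \<in> range first_row"
          unfolding linear_scale[OF lin] using c by (intro subspace_scale subspace_range_first_row) simp
        moreover have "(1 / norm x) *\<^sub>R x \<in> essential_matrices \<inter> sphere 0 1"
          using x essential_matrices_scaleR by simp
        ultimately show False using E by blast
      qed
      have "(- (1 / c)) *\<^sub>R (?A x - c *\<^sub>R z) \<in> range first_row"
        using c by (intro subspace_scale subspace_range_first_row)
      also have "(- (1 / c)) *\<^sub>R (?A x - c *\<^sub>R z) = z - ?A ((1 / c) *\<^sub>R x)"
        using \<open>c \<noteq> 0\<close> by (simp add: linear_scale[OF lin] scaleR_diff_right)
      finally have "(1 / c) *\<^sub>R x \<in> ?Y"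
        using x(2) essential_matrices_scaleR by simp
      moreover have "l = span {(1 / c) *\<^sub>R x}"
        using x(1) \<open>c \<noteq> 0\<close> by (simp add: span_singleton_scaleR)
      ultimately show "l \<in> (\<lambda>y. span {y}) ` ?Y" by (rule image_eqI[rotated])
    }
  qed
  finally show ?thesis .
qed

lemma act_subspace_mul: "act_subspace (U ** V) L = act_subspace U (act_subspace V L)"
  by (simp add: act_subspace_def image_image act_matrix_mul)

text \<open>An orthogonal V carries \<open>L0\<close> to \<open>L1\<close>, and the Haar integral is
  invariant under right translation by V.\<close>

lemma nn_integral_orbit_eq:
  fixes f :: "(real^'n^'m) set set \<Rightarrow> ennreal"
  assumes haar: "normalized_haar \<mu>" and L: "L0 \<in> grassmannian k" "L1 \<in> grassmannian k"
    and f: "f \<in> borel_measurable (grassmannian_borel k)"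
  shows "(\<integral>\<^sup>+U. f (act_subspace U L1) \<partial>\<mu>) = (\<integral>\<^sup>+U. f (act_subspace U L0) \<partial>\<mu>)"
proof -
  obtain W0 where W0: "L0 = projectivization W0" "subspace W0" "dim W0 = k + 1"
    using L by (auto simp: grassmannian_def)
  obtain W1 where W1: "L1 = projectivization W1" "subspace W1" "dim W1 = k + 1"
    using L by (auto simp: grassmannian_def)
  obtain g where g: "orthogonal_transformation g" "g ` W0 = W1"
    by (rule orthogonal_transformation_subspaces[OF W0(2) W1(2)]) (use W0 W1 in auto)
  obtain V where V: "V \<in> orthogonal_group" "act V = g"
    by (rule orthogonal_transformation_eq_act[OF g(1)])
  have "L1 = act_subspace V L0"
    using V(2) g(2) by (simp add: W0(1) W1(1) act_projectivization[OF V(1)])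
  then have "(\<integral>\<^sup>+U. f (act_subspace U L1) \<partial>\<mu>) = (\<integral>\<^sup>+U. f (act_subspace (U ** V) L0) \<partial>\<mu>)"
    by (simp add: act_subspace_mul)
  also have "\<dots> = (\<integral>\<^sup>+U. f (act_subspace U L0) \<partial>\<mu>)"
    by (rule nn_integral_haar_right[OF haar measurable_compose[OF measurable_orbit_map[OF haar L(1)] f] V(1)])
  finally show ?thesis .
qed

lemma continuous_on_jac:
  fixes L :: "'u::topological_space \<Rightarrow> 'a::euclidean_space \<Rightarrow> 'b::euclidean_space"
  assumes dim: "DIM('a) = CARD('n::{finite,wellorder})" "DIM('b) = CARD('n)"
    and lin: "\<And>u. linear (L u)" and cont: "\<And>v. continuous_on UNIV (\<lambda>u. L u v)"
  shows "continuous_on UNIV (\<lambda>u. jac (L u))"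
proof -
  obtain \<alpha> :: "'n \<Rightarrow> 'a" where \<alpha>: "bij_betw \<alpha> UNIV Basis"
    by (rule ex_basis_enumeration[OF dim(1)])
  obtain \<beta> :: "'n \<Rightarrow> 'b" where \<beta>: "bij_betw \<beta> UNIV Basis"
    by (rule ex_basis_enumeration[OF dim(2)])
  have "continuous_on UNIV (\<lambda>u. \<bar>det (\<chi> i j. L u (\<alpha> j) \<bullet> \<beta> i)\<bar>)"
    unfolding det_def by (simp, intro continuous_intros cont)
  moreover have "jac (L u) = \<bar>det (\<chi> i j. L u (\<alpha> j) \<bullet> \<beta> i)\<bar>" for u
    using jac_eq_det[OF \<alpha> \<beta> lin] by (simp add: det_matrix_coords \<alpha> \<beta>)
  ultimately show ?thesis by simp
qed

lemma orthogonal_transformation_reflection: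
  fixes u :: "'a::euclidean_space"
  assumes "u \<noteq> 0"
  shows "orthogonal_transformation (\<lambda>v. v - (2 * (v \<bullet> u) / (u \<bullet> u)) *\<^sub>R u)"
  unfolding orthogonal_transformation_def
proof (intro conjI allI)
  show "linear (\<lambda>v. v - (2 * (v \<bullet> u) / (u \<bullet> u)) *\<^sub>R u)"
    by (rule linearI) (simp_all add: inner_add_left algebra_simps add_divide_distrib)
  fix v w
  have uu: "u \<bullet> u \<noteq> 0" using assms by simp
  define a b where "a = 2 * (v \<bullet> u) / (u \<bullet> u)" and "b = 2 * (w \<bullet> u) / (u \<bullet> u)"
  have ab: "a * (u \<bullet> u) = 2 * (v \<bullet> u)" "b * (u \<bullet> u) = 2 * (w \<bullet> u)"
    using uu by (simp_all add: a_def b_def)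
  have "(v - a *\<^sub>R u) \<bullet> (w - b *\<^sub>R u) = v \<bullet> w - b * (v \<bullet> u) - a * (w \<bullet> u) + a * (b * (u \<bullet> u))"
    by (simp add: inner_diff_left inner_diff_right inner_commute algebra_simps)
  also have "a * (b * (u \<bullet> u)) = a * (w \<bullet> u) + b * (v \<bullet> u)"
  proof -
    have "2 * (a * (b * (u \<bullet> u))) = a * (b * (u \<bullet> u)) + b * (a * (u \<bullet> u))" by simp
    then show ?thesis unfolding ab by simp
  qed
  finally show "(v - a *\<^sub>R u) \<bullet> (w - b *\<^sub>R u) = v \<bullet> w" by simp
qed

text \<open>The reflection that exchanges x and y corresponds, since \<open>frame\<close> is
  isometric, to the reflection of the whole matrix space along \<open>frame (x - y)\<close>.\<close>

lemma frame_isometry: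
  assumes "norm x = norm y"
  obtains V \<rho> where "orthogonal_transformation V" "orthogonal_transformation \<rho>" "\<rho> x = y"
    "\<And>v. V (frame v) = frame (\<rho> v)"
proof (cases "x = y")
  case True
  then show ?thesis
    using that[of "\<lambda>v. v" "\<lambda>v. v"] by simp
next
  case False
  define u where "u = x - y"
  have u: "u \<noteq> 0" using False by (simp add: u_def)
  have nf: "frame u \<noteq> 0"
    using inner_frame[of u u] u by (metis inner_eq_zero_iff)
  have "2 * (x \<bullet> u) = u \<bullet> u"
    using assms by (simp add: u_def inner_diff_left inner_diff_right inner_commute norm_eq)
  then have "2 * (x \<bullet> u) / (u \<bullet> u) = 1" using u by simp
  then have "x - (2 * (x \<bullet> u) / (u \<bullet> u)) *\<^sub>R u = x - 1 *\<^sub>R u" by (simp only:)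
  then have \<rho>x: "x - (2 * (x \<bullet> u) / (u \<bullet> u)) *\<^sub>R u = y" by (simp only: u_def) simp
  show ?thesis
  proof (rule that[OF orthogonal_transformation_reflection[OF nf] orthogonal_transformation_reflection[OF u] \<rho>x])
    fix v show "frame v - (2 * (frame v \<bullet> frame u) / (frame u \<bullet> frame u)) *\<^sub>R frame u =
        frame (v - (2 * (v \<bullet> u) / (u \<bullet> u)) *\<^sub>R u)"
      by (simp add: inner_frame linear_diff[OF linear_frame] linear_scale[OF linear_frame])
  qed
qed

section \<open>The expected number of intersection points\<close>

text \<open>The linear model of \<open>chart_map\<close>: the cone is replaced by the subspace
  \<open>range frame\<close>, and the summand W raises the six parameters to nine.\<close>

definition frame_map :: "real^(3 \<times> 3)^(3 \<times> 3) \<Rightarrow> ((real^3) \<times> (real^3)) \<times> (real^3) \<Rightarrow> real^3^3" where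
  "frame_map U q = act U (frame (fst q)) + first_row (snd q)"

definition chart_map :: "real^(3 \<times> 3)^(3 \<times> 3) \<Rightarrow> ((real^3) \<times> (real^3)) \<times> (real^3) \<Rightarrow> real^3^3" where
  "chart_map U q = act U (essential_chart (fst (fst q)) (snd (fst q))) + first_row (snd q)"

definition chart_velocity ::
  "real^(3 \<times> 3)^(3 \<times> 3) \<Rightarrow> (real^3) \<times> (real^3) \<Rightarrow> ((real^3) \<times> (real^3)) \<times> (real^3) \<Rightarrow> real^3^3" where
  "chart_velocity U p v = act U (essential_velocity (fst p) (snd p) (fst v)) + first_row (snd v)"

lemma dims9: "DIM(((real^3) \<times> (real^3)) \<times> (real^3)) = CARD(9)" "DIM(real^3^3) = CARD(9)"
  by simp_all

lemma linear_frame_map: "linear (frame_map U)"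
  by (rule linearI) (simp_all add: frame_map_def linear_add[OF linear_frame] linear_scale[OF linear_frame]
      linear_add[OF linear_act] linear_scale[OF linear_act] linear_add[OF linear_first_row]
      linear_scale[OF linear_first_row] scaleR_add_right)

lemma has_derivative_linear_compose:
  fixes L :: "'a::euclidean_space \<Rightarrow> 'b::euclidean_space"
  assumes "linear L" "(f has_derivative f') F"
  shows "((\<lambda>x. L (f x)) has_derivative (\<lambda>h. L (f' h))) F"
  using assms by (intro bounded_linear.has_derivative[of L]) (simp_all add: linear_conv_bounded_linear)

lemma has_derivative_chart_map:
  "(chart_map U has_derivative chart_velocity U (fst q)) (at q)"
proof -
  have "((\<lambda>q. essential_chart (fst (fst q)) (snd (fst q))) has_derivative
      (\<lambda>v. essential_velocity (fst (fst q)) (snd (fst q)) (fst v))) (at q)"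
    by (rule has_derivative_compose[OF has_derivative_fst[OF has_derivative_ident] has_derivative_essential_chart])
  then have "((\<lambda>q. act U (essential_chart (fst (fst q)) (snd (fst q))) + first_row (snd q)) has_derivative
      (\<lambda>v. act U (essential_velocity (fst (fst q)) (snd (fst q)) (fst v)) + first_row (snd v))) (at q)"
    by (intro has_derivative_add has_derivative_linear_compose[OF linear_act]
        has_derivative_linear_compose[OF linear_first_row] has_derivative_snd has_derivative_ident)
  then show ?thesis
    by (simp add: chart_map_def[abs_def] chart_velocity_def[abs_def])
qed

lemma continuous_on_first_row:
  assumes "continuous_on S f"
  shows "continuous_on S (\<lambda>x. first_row (f x))"
  using linear_first_row by (intro continuous_on_compose2[OF linear_continuous_on assms, of _ UNIV])
    (simp_all add: linear_conv_bounded_linear)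

lemma continuous_on_frame:
  assumes "continuous_on S f"
  shows "continuous_on S (\<lambda>x. frame (f x))"
  using linear_frame by (intro continuous_on_compose2[OF linear_continuous_on assms, of _ UNIV])
    (simp_all add: linear_conv_bounded_linear)

lemma continuous_on_frame_map:
  assumes "continuous_on S f" "continuous_on S g"
  shows "continuous_on S (\<lambda>x. frame_map (f x) (g x))"
  unfolding frame_map_def
  by (intro continuous_on_add continuous_on_act continuous_on_first_row continuous_on_frame
      continuous_on_fst continuous_on_snd assms)

lemma continuous_on_chart_map:
  assumes "continuous_on S f" "continuous_on S g"
  shows "continuous_on S (\<lambda>x. chart_map (f x) (g x))"
  unfolding chart_map_def
  by (intro continuous_on_add continuous_on_act continuous_on_first_row continuous_on_essential_chart
      continuous_on_fst continuous_on_snd assms)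

lemma continuous_on_chart_velocity:
  fixes f :: "'a::t2_space \<Rightarrow> _"
  assumes "continuous_on S f" "continuous_on S g"
  shows "continuous_on S (\<lambda>x. chart_velocity (f x) (g x) v)"
  unfolding chart_velocity_def
  by (intro continuous_on_add continuous_on_act continuous_on_essential_velocity
      continuous_on_fst continuous_on_snd continuous_on_const assms)

lemma linear_chart_velocity: "linear (chart_velocity U p)"
  using has_derivative_linear[OF has_derivative_chart_map[of U "(p, 0)"]] by simp

lemma continuous_on_jac_frame_map: "continuous_on UNIV (\<lambda>U. jac (frame_map U))"
  by (rule continuous_on_jac[OF dims9 linear_frame_map])
    (intro continuous_on_frame_map continuous_on_id continuous_on_const)

lemma continuous_on_jac_chart_velocity: "continuous_on UNIV (\<lambda>x. jac (chart_velocity (fst x) (snd x)))"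
  by (rule continuous_on_jac[OF dims9 linear_chart_velocity])
    (intro continuous_on_chart_velocity continuous_on_fst continuous_on_snd continuous_on_id)

lemma frame_map_right_mul:
  assumes V: "orthogonal_transformation (act V)" and \<rho>: "linear \<rho>" and eq: "\<And>v. act V (frame v) = frame (\<rho> v)"
  shows "frame_map (U ** V) = frame_map U \<circ> map_prod \<rho> id"
  by (simp add: fun_eq_iff frame_map_def act_matrix_mul eq)

section \<open>Averages over the orthogonal group and over a set B of volume one\<close>

context
  fixes \<mu> :: "(real^(3 \<times> 3)^(3 \<times> 3)) measure" and B :: "(real^3^3) set"
  assumes haar: "normalized_haar \<mu>" and B: "B \<in> sets borel" and B1: "emeasure lborel B = 1"
begin

interpretation prob_space \<mu>
  by (rule prob_space_haar[OF haar])

interpretation pair_sigma_finite \<mu> "lborel :: (((real^3) \<times> (real^3)) \<times> (real^3)) measure" ..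

interpretation pair_M: pair_sigma_finite \<mu> "lborel :: (real^3^3) measure" ..

lemma measurable_nn_integral_haar:
  fixes f :: "_ \<times> 'b::euclidean_space \<Rightarrow> ennreal"
  assumes "f \<in> borel_measurable (\<mu> \<Otimes>\<^sub>M lborel)"
  shows "(\<lambda>q. \<integral>\<^sup>+U. f (U, q) \<partial>\<mu>) \<in> borel_measurable borel"
  using sigma_finite_measure.borel_measurable_nn_integral_fst[OF
      prob_space_imp_sigma_finite[OF prob_space_haar[OF haar]] measurable_pair_swap[OF assms]] by simp

definition frame_weight :: "((real^3) \<times> (real^3)) \<times> (real^3) \<Rightarrow> ennreal" where
  "frame_weight q = (\<integral>\<^sup>+U. indicator B (frame_map U q) * ennreal (jac (frame_map U)) \<partial>\<mu>)"

text \<open>The function of the norm from the overview, still written as a function on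
  six-space.\<close>

definition frame_density :: "(real^3) \<times> (real^3) \<Rightarrow> ennreal" where
  "frame_density x = (\<integral>\<^sup>+w. frame_weight (x, w) \<partial>lborel)"

lemma measurable_frame_integrand:
  "(\<lambda>x. indicator B (frame_map (fst x) (snd x)) * ennreal (jac (frame_map (fst x)))) \<in>
    borel_measurable (\<mu> \<Otimes>\<^sub>M lborel)"
proof (rule borel_measurable_pair_haar[OF haar])
  have [measurable]: "(\<lambda>x. frame_map (fst x) (snd x)) \<in> borel_measurable borel"
    by (intro borel_measurable_continuous_onI continuous_on_frame_map continuous_on_fst continuous_on_snd
        continuous_on_id)
  have [measurable]: "(\<lambda>x :: _ \<times> ((real^3) \<times> (real^3)) \<times> (real^3). jac (frame_map (fst x))) \<in> borel_measurable borel"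
    by (intro borel_measurable_continuous_onI continuous_on_compose2[OF continuous_on_jac_frame_map]
        continuous_on_fst continuous_on_id) auto
  note [measurable] = B
  show "(\<lambda>x. indicator B (frame_map (fst x) (snd x)) * ennreal (jac (frame_map (fst x)))) \<in> borel_measurable borel"
    by measurable
qed

lemma measurable_frame_weight: "frame_weight \<in> borel_measurable borel"
  using measurable_nn_integral_haar[OF measurable_frame_integrand]
  by (simp add: frame_weight_def[abs_def])

lemma measurable_frame_density: "frame_density \<in> borel_measurable borel"
proof -
  have "(\<lambda>x. frame_weight x) \<in> borel_measurable (lborel \<Otimes>\<^sub>M lborel)"
    using measurable_frame_weight by (simp add: lborel_prod)
  from lborel.borel_measurable_nn_integral_fst[OF this] show ?thesis
    by (simp add: frame_density_def[abs_def])
qed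

lemma measurable_haar_frame: 
  "(\<lambda>U. indicator B (frame_map U q) * ennreal (jac (frame_map U))) \<in> borel_measurable \<mu>"
  using measurable_Pair1[OF measurable_frame_integrand, of q]
  by simp

text \<open>Right invariance absorbs V, and \<rho> leaves the Jacobian unchanged.\<close>

lemma frame_weight_rotate:
  assumes V: "orthogonal_transformation V" and \<rho>: "orthogonal_transformation \<rho>"
    and eq: "\<And>v. V (frame v) = frame (\<rho> v)"
  shows "frame_weight (\<rho> x, w) = frame_weight (x, w)"
proof -
  obtain V' where V': "V' \<in> orthogonal_group" "act V' = V"
    by (rule orthogonal_transformation_eq_act[OF V])
  have lr: "linear \<rho>" using \<rho> by (rule orthogonal_transformation_linear)
  have mul: "frame_map (U ** V') = frame_map U \<circ> map_prod \<rho> id" for U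
    using V V' eq by (intro frame_map_right_mul lr) simp_all
  have "jac (map_prod \<rho> (id :: real^3 \<Rightarrow> real^3)) = 1"
    using jac_orthogonal[where 'n=6, OF _ \<rho>] jac_orthogonal[where 'n=3, of "id :: real^3 \<Rightarrow> real^3"]
    by (simp add: jac_map_prod lr linear_id) (simp add: id_def)
  then have "jac (frame_map (U ** V')) = jac (frame_map U)" for U
    unfolding mul using lr
    by (subst jac_compose[where 'n=9]) (simp_all add: linear_frame_map linear_map_prod linear_id)
  then have "frame_weight (\<rho> x, w) =
      (\<integral>\<^sup>+U. indicator B (frame_map (U ** V') (x, w)) * ennreal (jac (frame_map (U ** V'))) \<partial>\<mu>)"
    by (simp add: frame_weight_def mul)
  also have "\<dots> = frame_weight (x, w)"
    unfolding frame_weight_def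
    by (rule nn_integral_haar_right[OF haar measurable_haar_frame V'(1)])
  finally show ?thesis .
qed

lemma frame_density_norm:
  assumes "norm x = norm y"
  shows "frame_density x = frame_density y"
proof -
  obtain V \<rho> where V: "orthogonal_transformation V" "orthogonal_transformation \<rho>" "\<rho> x = y"
    "\<And>v. V (frame v) = frame (\<rho> v)"
    using frame_isometry[OF assms] by blast
  show ?thesis
    unfolding frame_density_def using frame_weight_rotate[OF V(1,2,4), of x] V(3) by simp
qed

text \<open>A nonzero kernel element, rescaled, would give a unit vector of
  \<open>range frame\<close> that U moves into W.\<close>

lemma inj_frame_map:
  assumes avoid: "\<forall>x\<in>range frame \<inter> sphere 0 1. act U x \<notin> range first_row"
  shows "inj (frame_map U)"
proof (subst linear_injective_0[OF linear_frame_map], intro allI impI)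
  fix q assume "frame_map U q = 0"
  then have q: "act U (frame (fst q)) = first_row (- snd q)"
    by (simp add: frame_map_def linear_neg[OF linear_first_row] eq_neg_iff_add_eq_0)
  have "fst q = 0"
  proof (rule ccontr)
    assume nz: "fst q \<noteq> 0"
    define c where "c = 1 / norm (fst q)"
    have nf: "norm (frame v) = norm v" for v
      by (simp add: norm_eq_sqrt_inner inner_frame)
    have "frame (c *\<^sub>R fst q) \<in> range frame \<inter> sphere 0 1"
      using nz by (simp add: nf c_def)
    with avoid have "act U (frame (c *\<^sub>R fst q)) \<notin> range first_row" by blast
    moreover have "act U (frame (c *\<^sub>R fst q)) = first_row (c *\<^sub>R - snd q)"
      by (simp only: linear_scale[OF linear_frame] linear_scale[OF linear_act] q linear_scale[OF linear_first_row])
    ultimately show False by simp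
  qed
  moreover from this q have "first_row (- snd q) = first_row 0"
    by (simp add: linear_0[OF linear_frame] linear_0[OF linear_act] linear_0[OF linear_first_row])
  then have "- snd q = 0" using injD[OF inj_first_row] by blast
  ultimately show "q = 0" by (simp add: prod_eq_iff)
qed

text \<open>An injective linear map between nine-dimensional spaces is bijective. Every z then has
  exactly one solution, and the area formula returns the volume of B.\<close>

lemma nn_integral_frame_map:
  assumes inj: "inj (frame_map U)"
  shows "(\<integral>\<^sup>+q. indicator B (frame_map U q) * ennreal (jac (frame_map U)) \<partial>lborel) = 1"
proof -
  have "dim (range (frame_map U)) = DIM(real^3^3)"
    using dim_image_eq[OF linear_frame_map, of U UNIV] inj by simp
  then have "range (frame_map U) = UNIV"
    using linear_subspace_image[OF linear_frame_map subspace_UNIV, of U]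
    by (metis dim_eq_full span_eq_iff)
  have one: "num_points {q. frame_map U q = z} = 1" for z
  proof -
    obtain q where q: "frame_map U q = z"
      using \<open>range (frame_map U) = UNIV\<close> by (metis UNIV_I imageE)
    have "{q. frame_map U q = z} = {q}"
    proof (intro set_eqI iffI)
      fix q' assume "q' \<in> {q. frame_map U q = z}"
      then have "frame_map U q' = frame_map U q" using q by simp
      then have "q' = q" by (rule injD[OF inj])
      then show "q' \<in> {q}" by simp
    qed (use q in simp)
    then show ?thesis by simp
  qed
  have "(\<integral>\<^sup>+z. indicator B z * num_points {q. frame_map U q = z} \<partial>lborel) =
      (\<integral>\<^sup>+q. indicator B (frame_map U q) * ennreal (jac (frame_map U)) \<partial>lborel)"
    by (rule area_formula[OF dims9 linear_imp_has_derivative[OF linear_frame_map] continuous_on_const B])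
  then show ?thesis
    using B B1 by (simp add: one)
qed

text \<open>The normalisation: after exchanging the integrals, the inner one is 1 for almost every
  U. The passage to \<open>transpose U\<close> fits the form in which generic avoidance is
  known.\<close>

lemma nn_integral_frame_density: "(\<integral>\<^sup>+x. frame_density x \<partial>lborel) = 1"
proof -
  let ?F = "\<lambda>U. \<integral>\<^sup>+q. indicator B (frame_map U q) * ennreal (jac (frame_map U)) \<partial>lborel"
  have F: "?F \<in> borel_measurable \<mu>"
    using lborel.borel_measurable_nn_integral_fst[OF measurable_frame_integrand] by simp
  let ?K = "range frame \<inter> sphere 0 1"
  have "subspace (range frame)"
    by (rule linear_subspace_image[OF linear_frame subspace_UNIV])
  then have cK: "compact ?K"
    by (intro closed_Int_compact closed_subspace compact_sphere)
  have "AE U in \<mu>. \<forall>x\<in>?K. act (transpose U) x \<notin> range first_row"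
  proof (rule AE_avoid[OF haar cK _ subspace_range_first_row])
    show "dim (range first_row) \<le> 3" by (simp add: dim_range_first_row)
    show "negligible (sweep ?K W' U)" if "subspace W'" "dim W' < 3" for W' U
      by (rule negligible_sweep_frame[OF that])
  qed auto
  then have one: "AE U in \<mu>. ?F (transpose U) = 1"
    by (rule AE_mp) (intro AE_I2 impI nn_integral_frame_map inj_frame_map)
  have "(\<integral>\<^sup>+x. frame_density x \<partial>lborel) = (\<integral>\<^sup>+q. frame_weight q \<partial>(lborel \<Otimes>\<^sub>M lborel))"
    unfolding frame_density_def
    by (rule lborel.nn_integral_fst) (use measurable_frame_weight in \<open>simp add: lborel_prod\<close>)
  also have "\<dots> = (\<integral>\<^sup>+q. frame_weight q \<partial>lborel)"
    by (simp add: lborel_prod)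
  also have "\<dots> = (\<integral>\<^sup>+U. ?F U \<partial>\<mu>)"
    unfolding frame_weight_def
    using Fubini'[of "\<lambda>U q. indicator B (frame_map U q) * ennreal (jac (frame_map U))"]
      measurable_frame_integrand by (simp add: case_prod_beta')
  also have "\<dots> = (\<integral>\<^sup>+U. ?F (transpose U) \<partial>\<mu>)"
    by (rule nn_integral_haar_transpose[OF haar F, symmetric])
  also have "\<dots> = (\<integral>\<^sup>+U. 1 \<partial>\<mu>)"
    using one by (rule nn_integral_cong_AE)
  also have "\<dots> = 1"
    by (simp add: emeasure_space_1)
  finally show ?thesis .
qed

lemma measurable_chart_integrand:
  "(\<lambda>x. indicator B (chart_map (fst x) (snd x)) * ennreal (jac (chart_velocity (fst x) (fst (snd x))))) \<in>
    borel_measurable (\<mu> \<Otimes>\<^sub>M lborel)"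
proof (rule borel_measurable_pair_haar[OF haar])
  have [measurable]: "(\<lambda>x. chart_map (fst x) (snd x)) \<in> borel_measurable borel"
    by (intro borel_measurable_continuous_onI continuous_on_chart_map continuous_on_fst continuous_on_snd
        continuous_on_id)
  have [measurable]: "(\<lambda>x :: _ \<times> ((real^3) \<times> (real^3)) \<times> (real^3). jac (chart_velocity (fst x) (fst (snd x))))
      \<in> borel_measurable borel"
  proof (intro borel_measurable_continuous_onI)
    have "continuous_on UNIV (\<lambda>x :: (real^(3 \<times> 3)^(3 \<times> 3)) \<times> ((real^3) \<times> (real^3)) \<times> (real^3). (fst x, fst (snd x)))"
      by (intro continuous_intros)
    from continuous_on_compose2[OF continuous_on_jac_chart_velocity this]
    show "continuous_on UNIV (\<lambda>x :: (real^(3 \<times> 3)^(3 \<times> 3)) \<times> ((real^3) \<times> (real^3)) \<times> (real^3).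
        jac (chart_velocity (fst x) (fst (snd x))))"
      by simp
  qed
  note [measurable] = B
  show "(\<lambda>x. indicator B (chart_map (fst x) (snd x)) * ennreal (jac (chart_velocity (fst x) (fst (snd x)))))
      \<in> borel_measurable borel"
    by measurable
qed

text \<open>At p the value and the derivative of the chart pass through the same isometry V of the
  matrix space. Right invariance removes V, and the Jacobian of S is all that remains of the
  curvature of the cone.\<close>

lemma nn_integral_chart_eq_frame:
  "(\<integral>\<^sup>+U. indicator B (chart_map U (p, w)) * ennreal (jac (chart_velocity U p)) \<partial>\<mu>) =
    ennreal (2 * norm (fst p) ^ 3 * (8 / (1 + (norm (snd p))\<^sup>2)\<^sup>2)) *
      frame_weight ((axis 1 (sqrt 2 * norm (fst p)), 0), w)"
proof -
  let ?x = "(axis 1 (sqrt 2 * norm (fst p)), 0) :: (real^3) \<times> (real^3)"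
  let ?j = "2 * norm (fst p) ^ 3 * (8 / (1 + (norm (snd p))\<^sup>2)\<^sup>2)"
  obtain V S where V: "orthogonal_transformation V" and S: "linear S" "jac S = ?j"
    and chart: "essential_chart (fst p) (snd p) = V (frame ?x)"
    and vel_all: "\<forall>h. essential_velocity (fst p) (snd p) h = V (frame (S h))"
    by (rule essential_frame)
  have vel: "essential_velocity (fst p) (snd p) h = V (frame (S h))" for h
    using vel_all by (rule spec)
  obtain V' where V': "V' \<in> orthogonal_group" "act V' = V"
    by (rule orthogonal_transformation_eq_act[OF V])
  have map: "chart_map U (p, w) = frame_map (U ** V') (?x, w)" for U
    by (simp add: chart_map_def frame_map_def chart act_matrix_mul V'(2))
  have "chart_velocity U p = frame_map (U ** V') \<circ> map_prod S id" for U
    by (simp add: fun_eq_iff chart_velocity_def frame_map_def vel act_matrix_mul V'(2))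
  moreover have "jac (map_prod S (id :: real^3 \<Rightarrow> real^3)) = ?j"
    using jac_orthogonal[where 'n=3, of "id :: real^3 \<Rightarrow> real^3"]
    by (simp add: jac_map_prod S linear_id) (simp add: id_def)
  ultimately have vj: "jac (chart_velocity U p) = jac (frame_map (U ** V')) * ?j" for U
    by (subst \<open>\<And>U. chart_velocity U p = _\<close>, subst jac_compose[where 'n=9])
      (simp_all add: linear_frame_map linear_map_prod linear_id S)
  define j where "j = ?j"
  have jpos: "j \<ge> 0" by (simp add: j_def)
  have jnn: "jac L \<ge> 0" for L :: "((real^3) \<times> (real^3)) \<times> (real^3) \<Rightarrow> real^3^3"
    by (simp add: jac_def)
  have "(\<integral>\<^sup>+U. indicator B (chart_map U (p, w)) * ennreal (jac (chart_velocity U p)) \<partial>\<mu>) =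
      (\<integral>\<^sup>+U. ennreal j * (indicator B (frame_map (U ** V') (?x, w)) * ennreal (jac (frame_map (U ** V')))) \<partial>\<mu>)"
  proof (rule nn_integral_cong)
    fix U
    have "ennreal (jac (chart_velocity U p)) = ennreal (jac (frame_map (U ** V'))) * ennreal j"
      unfolding vj j_def[symmetric] by (rule ennreal_mult[OF jnn jpos])
    then show "indicator B (chart_map U (p, w)) * ennreal (jac (chart_velocity U p)) =
        ennreal j * (indicator B (frame_map (U ** V') (?x, w)) * ennreal (jac (frame_map (U ** V'))))"
      unfolding map by (simp only: mult.assoc mult.left_commute mult.commute)
  qed
  also have "\<dots> = (\<integral>\<^sup>+U. ennreal j * (indicator B (frame_map U (?x, w)) * ennreal (jac (frame_map U))) \<partial>\<mu>)"
    by (rule nn_integral_haar_right[OF haar _ V'(1)])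
      (intro borel_measurable_times_ennreal borel_measurable_const measurable_haar_frame)
  also have "\<dots> = ennreal j * frame_weight (?x, w)"
    unfolding frame_weight_def by (rule nn_integral_cmult[OF measurable_haar_frame])
  finally show ?thesis unfolding j_def .
qed

text \<open>Integration over w produces \<kappa>, the radial profile of
  \<open>frame_density\<close>. The integral over a then contributes \<open>8 * pi ^ 2\<close>, and
  the one over t contributes \<open>1 / pi ^ 2\<close> times the total mass 1.\<close>

lemma nn_integral_chart:
  "(\<integral>\<^sup>+U. (\<integral>\<^sup>+q. indicator B (chart_map U q) * ennreal (jac (chart_velocity U (fst q))) \<partial>lborel) \<partial>\<mu>) = 8"
proof -
  let ?c = "\<lambda>q. \<integral>\<^sup>+U. indicator B (chart_map U q) * ennreal (jac (chart_velocity U (fst q))) \<partial>\<mu>"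
  let ?x = "\<lambda>r. (axis 1 r, 0) :: (real^3) \<times> (real^3)"
  define \<kappa> where "\<kappa> r = frame_density (?x r)" for r
  have cx: "continuous_on UNIV ?x"
  proof (intro continuous_on_Pair continuous_on_const)
    show "continuous_on UNIV (\<lambda>r :: real. axis 1 r :: real^3)"
      unfolding axis_def
    proof (rule continuous_on_vec_lambda)
      fix i :: 3
      show "continuous_on UNIV (\<lambda>r :: real. if i = 1 then r else 0)"
        by (cases "i = 1") simp_all
    qed
  qed
  have \<kappa>m [measurable]: "\<kappa> \<in> borel_measurable borel"
    unfolding \<kappa>_def[abs_def]
    by (intro measurable_compose[OF borel_measurable_continuous_onI[OF cx] measurable_frame_density])
  have \<kappa>: "frame_density x = \<kappa> (norm x)" for x
  proof -
    have "norm (axis 1 r :: real^3) = \<bar>r\<bar>" for r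
      by (simp add: norm_eq_sqrt_inner inner_axis_axis)
    then show ?thesis
      unfolding \<kappa>_def by (intro frame_density_norm) (simp add: norm_Pair)
  qed
  have cm: "?c \<in> borel_measurable (lborel \<Otimes>\<^sub>M lborel)"
    using measurable_nn_integral_haar[OF measurable_chart_integrand] by (simp add: lborel_prod)
  have fwm: "(\<lambda>w. frame_weight (y, w)) \<in> borel_measurable lborel" for y
  proof -
    have "frame_weight \<in> borel_measurable (lborel \<Otimes>\<^sub>M lborel)"
      using measurable_frame_weight by (simp add: lborel_prod)
    from measurable_compose[OF measurable_Pair1' this] show ?thesis by simp
  qed
  have "(\<integral>\<^sup>+U. (\<integral>\<^sup>+q. indicator B (chart_map U q) * ennreal (jac (chart_velocity U (fst q))) \<partial>lborel) \<partial>\<mu>) =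
      (\<integral>\<^sup>+q. ?c q \<partial>lborel)"
    using Fubini'[of "\<lambda>U q. indicator B (chart_map U q) * ennreal (jac (chart_velocity U (fst q)))"]
      measurable_chart_integrand by (simp add: case_prod_beta')
  also have "\<dots> = (\<integral>\<^sup>+q. ?c q \<partial>(lborel \<Otimes>\<^sub>M lborel))"
    by (simp add: lborel_prod)
  also have "\<dots> = (\<integral>\<^sup>+p. (\<integral>\<^sup>+w. ?c (p, w) \<partial>lborel) \<partial>lborel)"
    by (rule lborel.nn_integral_fst[OF cm, symmetric])
  also have "\<dots> = (\<integral>\<^sup>+(p :: (real^3) \<times> (real^3)). ennreal (8 / (1 + (norm (snd p))\<^sup>2)\<^sup>2) *
      (ennreal (2 * norm (fst p) ^ 3) * \<kappa> (sqrt 2 * norm (fst p))) \<partial>lborel)"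
  proof (rule nn_integral_cong)
    fix p :: "(real^3) \<times> (real^3)"
    let ?j = "2 * norm (fst p) ^ 3 * (8 / (1 + (norm (snd p))\<^sup>2)\<^sup>2)"
    have "(\<integral>\<^sup>+w. ?c (p, w) \<partial>lborel) = (\<integral>\<^sup>+w. ennreal ?j * frame_weight (?x (sqrt 2 * norm (fst p)), w) \<partial>lborel)"
      by (simp only: fst_conv nn_integral_chart_eq_frame)
    also have "\<dots> = ennreal ?j * \<kappa> (sqrt 2 * norm (fst p))"
      unfolding \<kappa>_def frame_density_def by (rule nn_integral_cmult[OF fwm])
    also have "ennreal ?j = ennreal (8 / (1 + (norm (snd p))\<^sup>2)\<^sup>2) * ennreal (2 * norm (fst p) ^ 3)"
      by (subst mult.commute) (intro ennreal_mult, simp_all)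
    finally show "(\<integral>\<^sup>+w. ?c (p, w) \<partial>lborel) = ennreal (8 / (1 + (norm (snd p))\<^sup>2)\<^sup>2) *
        (ennreal (2 * norm (fst p) ^ 3) * \<kappa> (sqrt 2 * norm (fst p)))"
      by (simp only: mult.assoc)
  qed
  also have "\<dots> = (\<integral>\<^sup>+(p :: (real^3) \<times> (real^3)). ennreal (8 / (1 + (norm (snd p))\<^sup>2)\<^sup>2) *
      (ennreal (2 * norm (fst p) ^ 3) * \<kappa> (sqrt 2 * norm (fst p))) \<partial>((lborel :: (real^3) measure) \<Otimes>\<^sub>M (lborel :: (real^3) measure)))"
    by (simp add: lborel_prod)
  also have "\<dots> = (\<integral>\<^sup>+t. (\<integral>\<^sup>+a. ennreal (8 / (1 + (norm (a :: real^3))\<^sup>2)\<^sup>2) *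
      (ennreal (2 * norm (t :: real^3) ^ 3) * \<kappa> (sqrt 2 * norm t)) \<partial>lborel) \<partial>lborel)"
    by (subst lborel.nn_integral_fst[symmetric]) (simp_all, measurable)
  also have "\<dots> = (\<integral>\<^sup>+t. ennreal (8 * pi\<^sup>2) * (ennreal (2 * norm (t :: real^3) ^ 3) * \<kappa> (sqrt 2 * norm t)) \<partial>lborel)"
    by (intro nn_integral_cong, subst nn_integral_multc) (simp_all add: nn_integral_rotation_volume)
  also have "\<dots> = ennreal (8 * pi\<^sup>2) * (\<integral>\<^sup>+t. ennreal (2 * norm (t :: real^3) ^ 3) * \<kappa> (sqrt 2 * norm t) \<partial>lborel)"
    by (rule nn_integral_cmult) measurable
  also have "\<dots> = ennreal (8 * pi\<^sup>2) * (ennreal (1 / pi\<^sup>2) * 1)"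
    using nn_integral_frame_density by (simp only: nn_integral_radial_3_6[OF \<kappa>m] \<kappa>)
  also have "\<dots> = ennreal (8 * pi\<^sup>2 * (1 / pi\<^sup>2))"
    by (subst mult_1_right, rule ennreal_mult[symmetric]) simp_all
  finally show ?thesis by simp
qed

text \<open>The pairs of a group element and a value attained on a compact set K form a continuous
  image of the compact product of the group with K.\<close>

lemma measurable_num_points_chart_map:
  "(\<lambda>x. num_points {q. chart_map (fst x) q = snd x}) \<in> borel_measurable (\<mu> \<Otimes>\<^sub>M lborel)"
proof (rule borel_measurable_num_points)
  fix K :: "(((real^3) \<times> (real^3)) \<times> (real^3)) set" assume K: "compact K"
  let ?S = "(\<lambda>x. (fst x, chart_map (fst x) (snd x))) ` (orthogonal_group \<times> K)"
  have "compact ?S"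
    by (intro compact_continuous_image compact_Times compact_orthogonal_group K continuous_on_Pair
        continuous_on_chart_map continuous_on_fst continuous_on_snd continuous_on_id)
  then have "(indicator ?S :: _ \<Rightarrow> real) \<in> borel_measurable (\<mu> \<Otimes>\<^sub>M lborel)"
    by (intro borel_measurable_pair_haar[OF haar]) (intro borel_measurable_indicator borel_compact)
  then have "?S \<inter> space (\<mu> \<Otimes>\<^sub>M lborel) \<in> sets (\<mu> \<Otimes>\<^sub>M lborel)"
    by (simp only: borel_measurable_indicator_iff)
  moreover have "{x \<in> space (\<mu> \<Otimes>\<^sub>M lborel). {q. chart_map (fst x) q = snd x} \<inter> K \<noteq> {}} =
      ?S \<inter> space (\<mu> \<Otimes>\<^sub>M lborel)"
  proof (intro set_eqI iffI)
    fix x assume x: "x \<in> {x \<in> space (\<mu> \<Otimes>\<^sub>M lborel). {q. chart_map (fst x) q = snd x} \<inter> K \<noteq> {}}"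
    then obtain q where "q \<in> K" "chart_map (fst x) q = snd x" by blast
    then show "x \<in> ?S \<inter> space (\<mu> \<Otimes>\<^sub>M lborel)"
      using x by (auto simp: space_pair_measure space_haar[OF haar] intro!: image_eqI[of _ _ "(fst x, q)"])
  next
    fix x assume "x \<in> ?S \<inter> space (\<mu> \<Otimes>\<^sub>M lborel)"
    then show "x \<in> {x \<in> space (\<mu> \<Otimes>\<^sub>M lborel). {q. chart_map (fst x) q = snd x} \<inter> K \<noteq> {}}"
      by auto
  qed
  ultimately show "{x \<in> space (\<mu> \<Otimes>\<^sub>M lborel). {q. chart_map (fst x) q = snd x} \<inter> K \<noteq> {}} \<in> sets (\<mu> \<Otimes>\<^sub>M lborel)"
    by (simp only:)
qed

text \<open>This holds for every z outside W separately, and the left side does not mention z. The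
  mean number of solutions is therefore the same for all such z, which is what permits averaging
  over B.\<close>

lemma twice_nn_integral_orbit:
  assumes L0: "L0 \<in> grassmannian 3" and z: "z \<notin> range first_row"
  shows "2 * (\<integral>\<^sup>+U. num_points (essential_variety \<inter> act_subspace U L0) \<partial>\<mu>) =
    (\<integral>\<^sup>+U. num_points {q. chart_map U q = z} \<partial>\<mu>)"
proof -
  let ?V = "span (insert z (range first_row))"
  let ?f = "\<lambda>L. num_points (essential_variety \<inter> L)"
  have spanr: "span (range first_row) = range first_row"
    by (simp add: span_eq_iff subspace_range_first_row)
  have dimV: "dim ?V = 4"
    using z by (simp add: dim_insert spanr dim_range_first_row)
  then have L: "projectivization ?V \<in> grassmannian 3"
    unfolding grassmannian_def by (intro CollectI exI[of _ ?V]) (simp add: subspace_span)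
  have m: "?f \<in> borel_measurable (grassmannian_borel 3)"
    by (rule borel_measurable_num_points_essential)
  have mN: "(\<lambda>U. num_points {q. chart_map U q = z}) \<in> borel_measurable \<mu>"
    using measurable_Pair1[OF measurable_num_points_chart_map, of z]
    by simp
  have E: "AE U in \<mu>. \<forall>x\<in>essential_matrices \<inter> sphere 0 1. act (transpose U) x \<notin> range first_row"
  proof (rule AE_avoid[OF haar compact_essential_sphere _ subspace_range_first_row])
    show "dim (range first_row) \<le> 3" by (simp add: dim_range_first_row)
    show "negligible (sweep (essential_matrices \<inter> sphere 0 1) W' U)" if "subspace W'" "dim W' < 3" for W' U
      by (rule negligible_sweep_essential[OF that])
  qed simp
  have H: "AE U in \<mu>. \<forall>x\<in>half_turn_cone \<inter> sphere 0 1. act (transpose U) x \<notin> ?V"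
  proof (rule AE_avoid[OF haar compact_half_turn_sphere _ subspace_span])
    show "dim ?V \<le> 4" by (simp only: dimV)
    show "negligible (sweep (half_turn_cone \<inter> sphere 0 1) W' U)" if "subspace W'" "dim W' < 4" for W' U
      using that by (intro negligible_sweep_half_turn) auto
  qed simp
  have "2 * (\<integral>\<^sup>+U. ?f (act_subspace U L0) \<partial>\<mu>) = 2 * (\<integral>\<^sup>+U. ?f (act_subspace U (projectivization ?V)) \<partial>\<mu>)"
    using nn_integral_orbit_eq[OF haar L0 L m] by simp
  also have "\<dots> = (\<integral>\<^sup>+U. 2 * ?f (act_subspace U (projectivization ?V)) \<partial>\<mu>)"
    by (rule nn_integral_cmult[symmetric]) (rule measurable_compose[OF measurable_orbit_map[OF haar L] m])
  also have "\<dots> = (\<integral>\<^sup>+U. num_points {q. chart_map (transpose U) q = z} \<partial>\<mu>)"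
  proof (rule nn_integral_cong_AE, use E H AE_space in eventually_elim)
    case (elim U)
    then show ?case
      using num_points_chart[OF _ z elim(1,2)] unfolding chart_map_def by (simp add: space_haar[OF haar])
  qed
  also have "\<dots> = (\<integral>\<^sup>+U. num_points {q. chart_map U q = z} \<partial>\<mu>)"
    by (rule nn_integral_haar_transpose[OF haar mN])
  finally show ?thesis .
qed

lemma nn_integral_orbit:
  assumes L0: "L0 \<in> grassmannian 3"
  shows "(\<integral>\<^sup>+U. num_points (essential_variety \<inter> act_subspace U L0) \<partial>\<mu>) = 4"
proof -
  let ?I = "\<integral>\<^sup>+U. num_points (essential_variety \<inter> act_subspace U L0) \<partial>\<mu>"
  have "negligible (range first_row)"
    by (rule negligible_lowdim) (simp add: dim_range_first_row)
  then have "emeasure lborel (range first_row) = 0"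
    using closed_subspace[OF subspace_range_first_row] by (intro negligible_imp_lborel_null) auto
  then have "AE z in lborel. z \<notin> range first_row"
    using closed_subspace[OF subspace_range_first_row] by (intro AE_not_in) (auto simp: null_sets_def)
  then have AE: "AE z in lborel. indicator B z * (2 * ?I) =
      (\<integral>\<^sup>+U. indicator B z * num_points {q. chart_map U q = z} \<partial>\<mu>)"
  proof eventually_elim
    case (elim z)
    have "(\<lambda>U. num_points {q. chart_map U q = z}) \<in> borel_measurable \<mu>"
      using measurable_Pair1[OF measurable_num_points_chart_map, of z]
      by simp
    then show ?case
      by (subst nn_integral_cmult) (simp_all only: twice_nn_integral_orbit[OF L0 elim])
  qed
  have meas: "(\<lambda>x. indicator B (snd x) * num_points {q. chart_map (fst x) q = snd x}) \<in> borel_measurable (\<mu> \<Otimes>\<^sub>M lborel)"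
  proof (rule borel_measurable_times_ennreal[OF _ measurable_num_points_chart_map])
    show "(\<lambda>x. indicator B (snd x)) \<in> borel_measurable (\<mu> \<Otimes>\<^sub>M lborel)"
      using B by (intro measurable_compose[OF measurable_snd]) simp
  qed
  \<comment> \<open>A constant is averaged over the set B of volume one, to bring in the integral
    over z that the area formula needs.\<close>
  have "2 * ?I = (\<integral>\<^sup>+z. indicator B z * (2 * ?I) \<partial>lborel)"
    using B B1 by (subst nn_integral_multc) simp_all
  also have "\<dots> = (\<integral>\<^sup>+z. (\<integral>\<^sup>+U. indicator B z * num_points {q. chart_map U q = z} \<partial>\<mu>) \<partial>lborel)"
    using AE by (rule nn_integral_cong_AE)
  also have "\<dots> = (\<integral>\<^sup>+U. (\<integral>\<^sup>+z. indicator B z * num_points {q. chart_map U q = z} \<partial>lborel) \<partial>\<mu>)"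
    using pair_M.Fubini'[of "\<lambda>U z. indicator B z * num_points {q. chart_map U q = z}"] meas
    by (simp add: case_prod_beta')
  also have "\<dots> = (\<integral>\<^sup>+U. (\<integral>\<^sup>+q. indicator B (chart_map U q) * ennreal (jac (chart_velocity U (fst q))) \<partial>lborel) \<partial>\<mu>)"
  proof (rule nn_integral_cong)
    fix U
    show "(\<integral>\<^sup>+z. indicator B z * num_points {q. chart_map U q = z} \<partial>lborel) =
        (\<integral>\<^sup>+q. indicator B (chart_map U q) * ennreal (jac (chart_velocity U (fst q))) \<partial>lborel)"
      by (rule area_formula[OF dims9 has_derivative_chart_map _ B])
        (intro continuous_on_chart_velocity continuous_on_fst continuous_on_id continuous_on_const)
  qed
  also have "\<dots> = 8" by (rule nn_integral_chart)
  finally have "2 * ?I = 2 * 4" by simp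
  then show ?thesis
    by (subst (asm) ennreal_mult_cancel_left) auto
qed

end

theorem theorem1p1:
  fixes \<nu> :: "(real^3^3) set set measure"
  assumes "unif_grassmannian 3 \<nu>"
  shows "(\<lambda>L. num_points (essential_variety \<inter> L)) \<in> borel_measurable \<nu> \<and>
         (\<integral>\<^sup>+ L. num_points (essential_variety \<inter> L) \<partial>\<nu>) = 4"
proof -
  obtain \<mu> L0 where haar: "normalized_haar \<mu>" and L0: "L0 \<in> grassmannian 3"
    and \<nu>: "\<nu> = distr \<mu> (grassmannian_borel 3) (\<lambda>U. act_subspace U L0)"
    using assms by (auto simp: unif_grassmannian_def)
  have m: "(\<lambda>L. num_points (essential_variety \<inter> L)) \<in> borel_measurable (grassmannian_borel 3)"
    by (rule borel_measurable_num_points_essential)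
  have "(\<integral>\<^sup>+ L. num_points (essential_variety \<inter> L) \<partial>\<nu>) =
      (\<integral>\<^sup>+U. num_points (essential_variety \<inter> act_subspace U L0) \<partial>\<mu>)"
    unfolding \<nu> by (rule nn_integral_distr[OF measurable_orbit_map[OF haar L0]]) (simp add: m)
  \<comment> \<open>The unit cube serves as the set B of volume one.\<close>
  also have "\<dots> = 4"
    by (rule nn_integral_orbit[OF haar _ _ L0, of "cbox 0 One"]) (simp_all add: emeasure_lborel_cbox_eq)
  finally show ?thesis
    using m by (simp add: \<nu>)
qed

end
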